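(* Let $X$ be a compact metric space and let $T:X\to X$ be an expanding map. Then there is an open and dense set $\mathcal{O}\subset\mathrm{Lip}(X,\mathbb{R})$ (for the topology of the Lipschitz norm) such that for every $F\in\mathcal{O}$ the zero temperature limit $\lim_{\beta\to+\infty}\mu_{\beta F}$ exists and it is supported on a single periodic orbit of $T$. Here $\mu_{\beta F}$ denotes an equilibrium state for $\beta F$.
   Context: $(X,d)$ is a non-empty compact metric space. A map $T:X\to X$ is expanding if it is Lipschitz continuous and there are $D\in\mathbb{Z}^+$ and $0<\lambda<1$ such that every $x\in X$ has a neighborhood $U_x$, an integer $1\le \ell_x\le D$ and continuous maps $S_i:U_x\to X$, $i=1,\dots,\ell_x$ (branches of the inverse of $T$), with pairwise disjoint images, such that $T^{-1}(U_x)=\bigcup_{i=1}^{\ell_x}S_i(U_x)$, $T\circ S_i=\mathrm{id}_{U_x}$ for all $i$, and $d(S_i(y),S_i(z))\le\lambda\, d(y,z)$ for all $y,z\in U_x$ and all $i$. $\mathrm{Lip}(X,\mathbb{R})$ is the space of Lipschitz functions $f:X\to\mathbb{R}$ with the norm $\|f\|=\sup_{x\in X}|f(x)|+\sup_{x\ne y}\frac{|f(x)-f(y)|}{d(x,y)}$. $\mathcal{M}(T)$ is the set of $T$-invariant Borel probability measures on $X$, and $h_\mu(T)$ is the metric (Kolmogorov–Sinai) entropy of $\mu\in\mathcal{M}(T)$. An equilibrium state for a continuous function $F:X\to\mathbb{R}$ is a measure $\mu_F\in\mathcal{M}(T)$ which maximizes $\mu\mapsto h_\mu(T)+\int F\,d\mu$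 over $\mathcal{M}(T)$. The limit $\lim_{\beta\to+\infty}\mu_{\beta F}$ is taken in the weak* topology and, if equilibrium states are not unique, $\mu_{\beta F}$ stands for any choice of an equilibrium state for each $\beta>0$. A periodic orbit is a set $\{y,T(y),\dots,T^{p-1}(y)\}$ with $p\ge1$ and $T^p(y)=y$. *)

theory Defs
  imports "HOL-Probability.Probability"
begin

text \<open>
  The compact space is a type \<open>'a :: metric_space\<close>; theorems about it assume
  \<open>compact (UNIV :: 'a set)\<close>.
\<close>

definition expanding :: "('a::metric_space \<Rightarrow> 'a) \<Rightarrow> bool" where
  "expanding T \<longleftrightarrow>
    (\<exists>L. L-lipschitz_on UNIV T) \<and>
    (\<exists>D::nat. \<exists>\<kappa>::real. 1 \<le> D \<and> 0 < \<kappa> \<and> \<kappa> < 1 \<and>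
      (\<forall>x. \<exists>U. \<exists>l::nat. \<exists>S :: nat \<Rightarrow> 'a \<Rightarrow> 'a.
        x \<in> interior U \<and> 1 \<le> l \<and> l \<le> D \<and>
        (\<forall>i\<in>{1..l}. continuous_on U (S i)) \<and>
        disjoint_family_on (\<lambda>i. S i ` U) {1..l} \<and>
        T -` U = (\<Union>i\<in>{1..l}. S i ` U) \<and>
        (\<forall>i\<in>{1..l}. \<forall>y\<in>U. T (S i y) = y) \<and>
        (\<forall>i\<in>{1..l}. \<forall>y\<in>U. \<forall>z\<in>U. dist (S i y) (S i z) \<le> \<kappa> * dist y z)))"

definition periodic_orbit :: "('a \<Rightarrow> 'a) \<Rightarrow> 'a set \<Rightarrow> bool" where
  "periodic_orbit T Q \<longleftrightarrow> (\<exists>y. \<exists>p\<ge>1. (T ^^ p) y = y \<and> Q = (\<lambda>i. (T ^^ i) y) ` {..<p})"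


section \<open>The space of Lipschitz functions\<close>

definition Lip :: "('a::metric_space \<Rightarrow> real) set" where
  "Lip = {f. \<exists>L. L-lipschitz_on UNIV f}"

text \<open>
  The second supremum also ranges over the pairs \<open>x = y\<close>. They contribute
  \<open>0 / 0 = 0\<close>, which leaves the value unchanged and makes it \<open>0\<close> on a one-point space.
\<close>

definition lip_norm :: "('a::metric_space \<Rightarrow> real) \<Rightarrow> real" where
  "lip_norm f = (SUP x. \<bar>f x\<bar>) + (SUP (x, y). \<bar>f x - f y\<bar> / dist x y)"

text \<open>
  The value \<open>0\<close> outside \<^const>\<open>Lip\<close> is irrelevant for the topology; \<^locale>\<open>Metric_space\<close>
  requires nonnegativity and symmetry for all arguments.
\<close>

definition lip_dist :: "('a::metric_space \<Rightarrow> real) \<Rightarrow> ('a \<Rightarrow> real) \<Rightarrow> real" where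
  "lip_dist f g = (if f \<in> Lip \<and> g \<in> Lip then lip_norm (\<lambda>x. f x - g x) else 0)"

abbreviation lip_topology :: "('a::metric_space \<Rightarrow> real) topology" where
  "lip_topology \<equiv> Metric_space.mtopology Lip lip_dist"

lemma Lip_diff: "f \<in> Lip \<Longrightarrow> g \<in> Lip \<Longrightarrow> (\<lambda>x. f x - g x) \<in> Lip"
  unfolding Lip_def by (auto intro: lipschitz_on_diff)

lemma Lip_bdd:
  fixes f :: "'a::metric_space \<Rightarrow> real"
  assumes "compact (UNIV :: 'a set)" "f \<in> Lip"
  shows "bdd_above (range (\<lambda>x. \<bar>f x\<bar>))"
    and "bdd_above (range (\<lambda>(x, y). \<bar>f x - f y\<bar> / dist x y))"
proof -
  obtain L where L: "L-lipschitz_on UNIV f"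
    using assms(2) by (auto simp: Lip_def)
  have "compact (range f)"
    using L assms(1) by (blast intro: compact_continuous_image lipschitz_on_continuous_on)
  then obtain B where "\<bar>f x\<bar> \<le> B" for x
    using compact_imp_bounded[of "range f"] by (auto simp: bounded_iff)
  then show "bdd_above (range (\<lambda>x. \<bar>f x\<bar>))"
    by (auto intro!: bdd_aboveI[where M = B])
  have "\<bar>f x - f y\<bar> / dist x y \<le> L" for x y
  proof (cases "x = y")
    case True
    then show ?thesis using lipschitz_on_nonneg[OF L] by simp
  next
    case False
    then show ?thesis
      using lipschitz_onD[OF L, of x y] by (simp add: dist_real_def divide_le_eq)
  qed
  then show "bdd_above (range (\<lambda>(x, y). \<bar>f x - f y\<bar> / dist x y))"
    by (auto intro!: bdd_aboveI[where M = L])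
qed

lemma Metric_space_Lip:
  assumes cpt: "compact (UNIV :: 'a::metric_space set)"
  shows "Metric_space (Lip :: ('a \<Rightarrow> real) set) lip_dist"
proof -
  define s where "s f = (SUP x. \<bar>f x\<bar>)" for f :: "'a \<Rightarrow> real"
  define q where "q f = (SUP (x, y). \<bar>f x - f y\<bar> / dist x y)" for f :: "'a \<Rightarrow> real"
  have n: "lip_norm f = s f + q f" for f
    by (simp add: lip_norm_def s_def q_def)
  have s_ub: "\<bar>f x\<bar> \<le> s f" if "f \<in> Lip" for f x
    unfolding s_def by (rule cSUP_upper[OF UNIV_I Lip_bdd(1)[OF cpt that]])
  have q_ub: "\<bar>f x - f y\<bar> / dist x y \<le> q f" if "f \<in> Lip" for f x y
    unfolding q_def using cSUP_upper[OF UNIV_I Lip_bdd(2)[OF cpt that], of "(x, y)"] by simp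
  have s0: "0 \<le> s f" if "f \<in> Lip" for f
    using s_ub[OF that, of undefined] by linarith
  have q0: "0 \<le> q f" if "f \<in> Lip" for f
    using q_ub[OF that, of undefined undefined] by simp
  show ?thesis
  proof
    fix f g :: "'a \<Rightarrow> real"
    show "0 \<le> lip_dist f g"
      by (simp add: lip_dist_def n s0 q0 Lip_diff)
    show "lip_dist f g = lip_dist g f"
      by (simp add: lip_dist_def lip_norm_def abs_minus_commute algebra_simps)
  next
    fix f g :: "'a \<Rightarrow> real"
    assume fg: "f \<in> Lip" "g \<in> Lip"
    note d = Lip_diff[OF fg]
    show "lip_dist f g = 0 \<longleftrightarrow> f = g"
    proof
      assume "lip_dist f g = 0"
      then have "s (\<lambda>x. f x - g x) = 0"
        using s0[OF d] q0[OF d] fg by (simp add: lip_dist_def n)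
      then show "f = g" using s_ub[OF d] by fastforce
    next
      assume "f = g"
      then show "lip_dist f g = 0"
        using fg by (simp add: lip_dist_def lip_norm_def case_prod_unfold)
    qed
  next
    fix f g h :: "'a \<Rightarrow> real"
    assume fgh: "f \<in> Lip" "g \<in> Lip" "h \<in> Lip"
    note d1 = Lip_diff[OF fgh(1,2)] and d2 = Lip_diff[OF fgh(2,3)]
    have "s (\<lambda>x. f x - h x) \<le> s (\<lambda>x. f x - g x) + s (\<lambda>x. g x - h x)"
      unfolding s_def[of "\<lambda>x. f x - h x"]
    proof (rule cSUP_least)
      fix x
      show "\<bar>f x - h x\<bar> \<le> s (\<lambda>x. f x - g x) + s (\<lambda>x. g x - h x)"
        using s_ub[OF d1, of x] s_ub[OF d2, of x] by linarith
    qed simp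
    moreover have "q (\<lambda>x. f x - h x) \<le> q (\<lambda>x. f x - g x) + q (\<lambda>x. g x - h x)"
      unfolding q_def[of "\<lambda>x. f x - h x"]
    proof (rule cSUP_least)
      fix z :: "'a \<times> 'a"
      obtain x y where z: "z = (x, y)" by (cases z)
      have "\<bar>f x - h x - (f y - h y)\<bar> / dist x y
          \<le> (\<bar>f x - g x - (f y - g y)\<bar> + \<bar>g x - h x - (g y - h y)\<bar>) / dist x y"
        by (rule divide_right_mono) auto
      also have "\<dots> \<le> q (\<lambda>x. f x - g x) + q (\<lambda>x. g x - h x)"
        using q_ub[OF d1, of x y] q_ub[OF d2, of x y] by (simp add: add_divide_distrib)
      finally show "(case z of (x, y) \<Rightarrow> \<bar>f x - h x - (f y - h y)\<bar> / dist x y)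
          \<le> q (\<lambda>x. f x - g x) + q (\<lambda>x. g x - h x)"
        by (simp add: z)
    qed simp
    ultimately show "lip_dist f h \<le> lip_dist f g + lip_dist g h"
      using fgh by (simp add: lip_dist_def n)
  qed
qed


section \<open>Invariant measures and entropy\<close>

definition invariant_measures :: "('a::metric_space \<Rightarrow> 'a) \<Rightarrow> 'a measure set" where
  "invariant_measures T = {\<mu>. prob_space \<mu> \<and> sets \<mu> = sets borel \<and> distr \<mu> borel T = \<mu>}"

definition partition_entropy :: "'a measure \<Rightarrow> 'a set set \<Rightarrow> real" where
  "partition_entropy \<mu> P = - (\<Sum>A\<in>P. measure \<mu> A * ln (measure \<mu> A))"

text \<open>
  The join of the partitions \<open>T\<^sup>-\<^sup>i P\<close> for \<open>i < n\<close>; \<^const>\<open>common_refinement\<close> drops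
  the empty set.
\<close>

definition dynamical_join :: "('a \<Rightarrow> 'a) \<Rightarrow> 'a set set \<Rightarrow> nat \<Rightarrow> 'a set set" where
  "dynamical_join T P n = common_refinement ((\<lambda>i. (\<lambda>A. (T ^^ i) -` A) ` P) ` {..<n})"

definition entropy_of_partition :: "('a \<Rightarrow> 'a) \<Rightarrow> 'a measure \<Rightarrow> 'a set set \<Rightarrow> real" where
  "entropy_of_partition T \<mu> P = lim (\<lambda>n. partition_entropy \<mu> (dynamical_join T P n) / real n)"

definition KS_entropy :: "('a::metric_space \<Rightarrow> 'a) \<Rightarrow> 'a measure \<Rightarrow> ereal" where
  "KS_entropy T \<mu> =
    (SUP P \<in> {P. finite P \<and> P \<subseteq> sets borel \<and> partition_on UNIV P}.
      ereal (entropy_of_partition T \<mu> P))"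


section \<open>Equilibrium states and zero temperature limits\<close>

definition free_energy :: "('a::metric_space \<Rightarrow> 'a) \<Rightarrow> ('a \<Rightarrow> real) \<Rightarrow> 'a measure \<Rightarrow> ereal" where
  "free_energy T F \<mu> = KS_entropy T \<mu> + ereal (\<integral>x. F x \<partial>\<mu>)"

definition equilibrium_state :: "('a::metric_space \<Rightarrow> 'a) \<Rightarrow> ('a \<Rightarrow> real) \<Rightarrow> 'a measure \<Rightarrow> bool" where
  "equilibrium_state T F \<mu> \<longleftrightarrow>
    \<mu> \<in> invariant_measures T \<and>
    (\<forall>\<nu>\<in>invariant_measures T. free_energy T F \<nu> \<le> free_energy T F \<mu>)"

definition weak_star_tendsto ::
    "('i \<Rightarrow> 'a::metric_space measure) \<Rightarrow> 'a measure \<Rightarrow> 'i filter \<Rightarrow> bool" where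
  "weak_star_tendsto m \<mu> \<F> \<longleftrightarrow>
    (\<forall>g :: 'a \<Rightarrow> real. continuous_on UNIV g \<longrightarrow>
      ((\<lambda>i. \<integral>x. g x \<partial>(m i)) \<longlongrightarrow> (\<integral>x. g x \<partial>\<mu>)) \<F>)"

text \<open>
  Equilibrium states need not be unique, so the limit is required for every choice of them.
  The existence clause keeps this from holding vacuously.
\<close>

definition zero_temperature_limit ::
    "('a::metric_space \<Rightarrow> 'a) \<Rightarrow> ('a \<Rightarrow> real) \<Rightarrow> 'a measure \<Rightarrow> bool" where
  "zero_temperature_limit T F \<mu> \<longleftrightarrow>
    \<mu> \<in> invariant_measures T \<and>
    (\<forall>\<beta>>0::real. \<exists>\<nu>. equilibrium_state T (\<lambda>x. \<beta> * F x) \<nu>) \<and>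
    (\<forall>m :: real \<Rightarrow> 'a measure.
      (\<forall>\<beta>>0. equilibrium_state T (\<lambda>x. \<beta> * F x) (m \<beta>)) \<longrightarrow> weak_star_tendsto m \<mu> at_top)"

end

theory Submission
  imports Defs
begin

text \<open>
  Only measures that maximize \<open>\<integral>F\<close> among the invariant measures can be zero temperature limits: an
  equilibrium state \<open>\<mu>\<close> of \<open>\<beta>F\<close> satisfies \<open>h(\<mu>) + \<beta>\<integral>F d\<mu> \<ge> \<beta> max \<integral>F\<close>, the entropy is bounded, and so
  \<open>\<integral>F d\<mu>\<close> tends to the maximum. If the maximum is attained only by the invariant measure on a
  periodic orbit, and with a gap that is linear in the mean distance to this orbit, then \<open>\<mu>\<close> must
  converge to that measure (\<open>zero_temperature_limit_periodic\<close>). What has to be shown is that this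
  situation is open and dense (\<open>perturb_to_uniquely_maximized\<close>, a form of Contreras' theorem) and
  that equilibrium states exist (\<open>equilibrium_state_exists\<close>).

  Density follows the approach of Huang, Lian, Ma, Xu and Zhang. Up to a constant and a coboundary, \<open>F\<close>
  becomes a nonpositive Lipschitz function \<open>g\<close> that vanishes along a whole orbit (\<open>mane\<close>), hence
  on an invariant set \<open>Z\<close>. For a periodic orbit \<open>Q\<close> near \<open>Z\<close>, subtracting \<open>\<epsilon> dist(\<cdot>, Q)\<close> makes \<open>Q\<close>
  the maximizing orbit, stably under small perturbations, provided that the distances from the points of \<open>Q\<close>
  to \<open>Z\<close> sum up to a small multiple of the minimal distance \<open>\<Delta>\<close> between points of \<open>Q\<close>
  (\<open>locking\<close>): an orbit near \<open>Q\<close> then gains almost nothing, and before it can come near \<open>Q\<close> again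
  it pays \<open>\<epsilon>\<close> times a fixed fraction of \<open>\<Delta>\<close>.

  Such an orbit exists for every \<open>Z\<close> (\<open>tight_periodic_orbit\<close>). One starts from a periodic orbit whose
  distance to \<open>Z\<close> is smaller than a large negative power of its period, which a counting argument of
  Bressaud and Quas provides (\<open>superpolynomial_approximation\<close>). If two of its points are too close
  to each other, it is cut there and the shorter loop is closed. This at least halves the period while the
  distance to \<open>Z\<close> grows by a bounded factor only, so the loss during all such steps is polynomial in the
  period.

  Equilibrium states exist because the invariant measures are weak* sequentially compact
  (\<open>weak_star_sequentially_compact\<close>) and the entropy is upper semicontinuous
  (\<open>KS_entropy_upper_semicontinuous\<close>). The latter rests on the generator theorem
  (\<open>KS_entropy_generator\<close>): the entropy is the growth rate of the entropies of the itineraries with respect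
  to any single partition into sets of small diameter. Along a weak* convergent sequence these entropies
  converge at every fixed time when the partition is adapted to the limit, and the rate is their infimum.
\<close>

section \<open>Uniformly expanding open maps\<close>

text \<open>The neighborhoods and branches of an expanding map are replaced by uniform constants. This is the form
  in which two orbits can be compared and orbits can be pulled back.\<close>

locale expanding_system =
  fixes T :: "'a::metric_space \<Rightarrow> 'a" and L \<kappa> \<delta> :: real
  assumes compact_space: "compact (UNIV :: 'a set)"
    and L_ge_1: "1 \<le> L" and \<kappa>_pos: "0 < \<kappa>" and \<kappa>_less_1: "\<kappa> < 1" and \<delta>_pos: "0 < \<delta>"
    and T_lip: "dist (T x) (T y) \<le> L * dist x y"
    and expand: "dist x y < \<delta> \<Longrightarrow> dist x y \<le> \<kappa> * dist (T x) (T y)"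
    and lift: "dist (T x) y < \<delta> \<Longrightarrow> \<exists>x'. T x' = y \<and> dist x x' \<le> \<kappa> * dist (T x) y"

text \<open>Lifting is a Lebesgue number argument. Expansion could fail for nearby points on different
  branches, but there are only finitely many preimages of a point, so they are isolated from each other.\<close>

lemma expanding_imp_expanding_system:
  fixes T :: "'a::metric_space \<Rightarrow> 'a"
  assumes cpt: "compact (UNIV :: 'a set)" and "expanding T"
  shows "\<exists>L \<kappa> \<delta>. expanding_system T L \<kappa> \<delta>"
proof -
  obtain L0 D \<kappa> where L0: "L0-lipschitz_on UNIV T" and \<kappa>: "0 < \<kappa>" "\<kappa> < 1"
    and ex: "\<forall>x. \<exists>U. \<exists>l::nat. \<exists>S :: nat \<Rightarrow> 'a \<Rightarrow> 'a.
        x \<in> interior U \<and> 1 \<le> l \<and> l \<le> (D::nat) \<and>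
        (\<forall>i\<in>{1..l}. continuous_on U (S i)) \<and>
        disjoint_family_on (\<lambda>i. S i ` U) {1..l} \<and>
        T -` U = (\<Union>i\<in>{1..l}. S i ` U) \<and>
        (\<forall>i\<in>{1..l}. \<forall>y\<in>U. T (S i y) = y) \<and>
        (\<forall>i\<in>{1..l}. \<forall>y\<in>U. \<forall>z\<in>U. dist (S i y) (S i z) \<le> \<kappa> * dist y z)"
    using assms(2) unfolding expanding_def by blast
  obtain U l S where U: "\<And>x. x \<in> interior (U x)"
    and dj: "\<And>x. disjoint_family_on (\<lambda>i. S x i ` U x) {1..l x :: nat}"
    and pre: "\<And>x. T -` U x = (\<Union>i\<in>{1..l x}. S x i ` U x)"
    and inv: "\<And>x i y. i \<in> {1..l x} \<Longrightarrow> y \<in> U x \<Longrightarrow> T (S x i y) = y"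
    and con: "\<And>x i y z. i \<in> {1..l x} \<Longrightarrow> y \<in> U x \<Longrightarrow> z \<in> U x \<Longrightarrow>
        dist (S x i y) (S x i z) \<le> \<kappa> * dist y z"
    using ex by metis
  define L where "L = max 1 L0"
  have L: "1 \<le> L" "dist (T x) (T y) \<le> L * dist x y" for x y
  proof -
    show "1 \<le> L" by (simp add: L_def)
    have "dist (T x) (T y) \<le> L0 * dist x y" using lipschitz_onD[OF L0] by auto
    also have "\<dots> \<le> L * dist x y" unfolding L_def by (intro mult_right_mono) auto
    finally show "dist (T x) (T y) \<le> L * dist x y" .
  qed
  \<comment> \<open>The inverse branches exist on balls of a uniform radius, by the Lebesgue number lemma.\<close>
  obtain e where e: "e > 0" "\<And>x. \<exists>z. ball x e \<subseteq> U z"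
  proof -
    have "\<exists>e>0. \<forall>x\<in>UNIV. \<exists>G\<in>range (\<lambda>x. interior (U x)). ball x e \<subseteq> G"
    proof (rule Heine_Borel_lemma[OF cpt])
      show "UNIV \<subseteq> \<Union> (range (\<lambda>x. interior (U x)))" using U by blast
    qed auto
    then obtain e where "e > 0" "\<forall>x. \<exists>z. ball x e \<subseteq> interior (U z)" by auto
    then show ?thesis using that[of e] interior_subset by (meson subset_trans)
  qed
  have branch: "\<exists>i\<in>{1..l z}. x = S z i (T x)" if "T x \<in> U z" for x z
  proof -
    have "x \<in> (\<Union>i\<in>{1..l z}. S z i ` U z)" using that unfolding pre[of z, symmetric] by simp
    then show ?thesis using inv by force
  qed
  have li: "\<exists>x'. T x' = y \<and> dist x x' \<le> \<kappa> * dist (T x) y" if d: "dist (T x) y < e" for x y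
  proof -
    obtain z where z: "ball (T x) e \<subseteq> U z" using e by blast
    then have in_U: "T x \<in> U z" "y \<in> U z" using e(1) d by auto
    obtain i where i: "i \<in> {1..l z}" "x = S z i (T x)" using branch in_U by blast
    show ?thesis
      using inv[OF i(1) in_U(2)] con[OF i(1) in_U] i(2) by (intro exI[of _ "S z i y"]) auto
  qed
  \<comment> \<open>Near a point \<open>p\<close> every point lies on the branch through \<open>p\<close>, since the other
    preimages of \<open>T p\<close> stay away from \<open>p\<close>.\<close>
  have loc: "\<exists>r>0. \<forall>x\<in>ball p r. \<forall>y\<in>ball p r. dist x y \<le> \<kappa> * dist (T x) (T y)" for p
  proof -
    obtain z where z: "ball (T p) e \<subseteq> U z" using e by blast
    then have pU: "T p \<in> U z" using e(1) by auto
    obtain i where i: "i \<in> {1..l z}" "p = S z i (T p)" using branch pU by blast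
    define m where "m = Min (insert 1 ((\<lambda>j. dist (S z j (T p)) p) ` ({1..l z} - {i})))"
    have m: "m > 0"
    proof -
      have "dist (S z j (T p)) p > 0" if "j \<in> {1..l z} - {i}" for j
      proof -
        have "S z j ` U z \<inter> S z i ` U z = {}"
          using dj[of z] that i(1) unfolding disjoint_family_on_def by blast
        then have "S z j (T p) \<noteq> S z i (T p)" using pU by blast
        then show ?thesis using i(2) by auto
      qed
      then show ?thesis unfolding m_def by (subst Min_gr_iff) auto
    qed
    have m_le: "m \<le> dist (S z j (T p)) p" if "j \<in> {1..l z}" "j \<noteq> i" for j
      unfolding m_def using that by (intro Min_le) auto
    define r where "r = min (e / L) (m / (1 + L))"
    have r: "r > 0" "L * r \<le> e" "(1 + L) * r \<le> m"
    proof -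
      show "r > 0" using e(1) m L(1) by (auto simp: r_def)
      have "r \<le> e / L" "r \<le> m / (1 + L)" by (auto simp: r_def)
      then show "L * r \<le> e" "(1 + L) * r \<le> m" using L(1) by (auto simp: field_simps)
    qed
    have br: "T x \<in> U z \<and> x = S z i (T x)" if "x \<in> ball p r" for x
    proof -
      have px: "dist p x < r" using that by simp
      have "dist (T p) (T x) \<le> L * dist p x" by (rule L)
      also have "\<dots> < L * r" using px L(1) by simp
      finally have a: "dist (T p) (T x) < L * r" .
      then have xU: "T x \<in> U z" using z r by auto
      obtain j where j: "j \<in> {1..l z}" "x = S z j (T x)" using branch xU by blast
      have "dist (S z j (T p)) p \<le> dist (S z j (T p)) (S z j (T x)) + dist p x"
        using j(2) dist_triangle[of "S z j (T p)" p x] by (simp add: dist_commute)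
      also have "\<dots> \<le> \<kappa> * dist (T p) (T x) + dist p x" using con[OF j(1) pU xU] by simp
      also have "\<dots> \<le> dist (T p) (T x) + dist p x"
        using \<kappa> mult_right_mono[of \<kappa> 1 "dist (T p) (T x)"] by simp
      also have "\<dots> < L * r + r" using a px by simp
      also have "\<dots> \<le> m" using r(3) by (simp add: algebra_simps)
      finally have "j = i" using m_le[OF j(1)] by fastforce
      then show ?thesis using j(2) xU by simp
    qed
    show ?thesis
      using r(1) br con[OF i(1)] by (intro exI[of _ r]) metis
  qed
  obtain r where r: "\<And>p. r p > 0" "\<And>p x y. x \<in> ball p (r p) \<Longrightarrow> y \<in> ball p (r p) \<Longrightarrow>
      dist x y \<le> \<kappa> * dist (T x) (T y)"
    using loc by metis
  obtain d where d: "d > 0" "\<And>x. \<exists>p. ball x d \<subseteq> ball p (r p)"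
  proof -
    have "\<exists>d>0. \<forall>x\<in>UNIV. \<exists>G\<in>range (\<lambda>p. ball p (r p)). ball x d \<subseteq> G"
    proof (rule Heine_Borel_lemma[OF cpt])
      show "UNIV \<subseteq> \<Union> (range (\<lambda>p. ball p (r p)))" using r(1) centre_in_ball by blast
    qed auto
    then show ?thesis using that by auto
  qed
  have "expanding_system T L \<kappa> (min e d)"
  proof
    fix x y :: 'a
    assume "dist x y < min e d"
    then have "y \<in> ball x d" "x \<in> ball x d" using d(1) by auto
    then show "dist x y \<le> \<kappa> * dist (T x) (T y)" using d(2)[of x] r(2) by blast
  qed (use cpt L \<kappa> e(1) d(1) li in auto)
  then show ?thesis by blast
qed

definition orbit_sum :: "('a \<Rightarrow> 'a) \<Rightarrow> ('a \<Rightarrow> real) \<Rightarrow> nat \<Rightarrow> 'a \<Rightarrow> real" where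
  "orbit_sum T g n x = (\<Sum>i<n. g ((T ^^ i) x))"

lemma orbit_sum_0 [simp]: "orbit_sum T g 0 x = 0"
  by (simp add: orbit_sum_def)

lemma orbit_sum_add: "orbit_sum T g (m + n) x = orbit_sum T g m x + orbit_sum T g n ((T ^^ m) x)"
proof (induction n)
  case (Suc n)
  have "orbit_sum T g (m + Suc n) x = orbit_sum T g (m + n) x + g ((T ^^ (m + n)) x)"
    by (simp add: orbit_sum_def)
  also have "(T ^^ (m + n)) x = (T ^^ n) ((T ^^ m) x)" by (metis add.commute comp_apply funpow_add)
  finally show ?case using Suc by (simp add: orbit_sum_def)
qed simp

lemma orbit_sum_1 [simp]: "orbit_sum T g (Suc 0) x = g x"
  by (simp add: orbit_sum_def)

lemma orbit_sum_shift_period: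
  assumes "(T ^^ p) y = y"
  shows "orbit_sum T g p ((T ^^ j) y) = orbit_sum T g p y"
  using orbit_sum_add[of T g j p y] orbit_sum_add[of T g p j y] assms by (simp add: add.commute)

lemma orbit_sum_periods:
  assumes "(T ^^ p) y = y"
  shows "orbit_sum T g (k * p) y = real k * orbit_sum T g p y"
proof (induction k)
  case (Suc k)
  then show ?case using orbit_sum_add[of T g p "k * p" y] assms by (simp add: algebra_simps)
qed simp

lemma orbit_sum_mono: "m \<le> n \<Longrightarrow> (\<And>x. 0 \<le> g x) \<Longrightarrow> orbit_sum T g m x \<le> orbit_sum T g n x"
  unfolding orbit_sum_def by (intro sum_mono2) auto

lemma sum_geometric_le:
  fixes \<kappa> :: real
  assumes "0 \<le> \<kappa>" "\<kappa> < 1"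
  shows "(\<Sum>i<n. \<kappa> ^ i) \<le> 1 / (1 - \<kappa>)"
proof -
  have "(\<Sum>i<n. \<kappa> ^ i) = (1 - \<kappa> ^ n) / (1 - \<kappa>)"
    using assms by (simp add: sum_gp_strict)
  also have "\<dots> \<le> 1 / (1 - \<kappa>)" using assms by (intro divide_right_mono) auto
  finally show ?thesis .
qed

lemma sum_geometric_rev_le:
  fixes \<kappa> :: real
  assumes "0 \<le> \<kappa>" "\<kappa> < 1"
  shows "(\<Sum>i<n. \<kappa> ^ (n - Suc i)) \<le> 1 / (1 - \<kappa>)"
  using sum_geometric_le[OF assms] sum.nat_diff_reindex[of "\<lambda>i. \<kappa> ^ i" n] by simp

context expanding_system begin

lemma continuous_T: "continuous_on UNIV T"
proof (rule lipschitz_on_continuous_on)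
  show "L-lipschitz_on UNIV T" using T_lip L_ge_1 by (auto intro!: lipschitz_onI)
qed

lemma continuous_T_iterate: "continuous_on UNIV (T ^^ n)"
proof (induction n)
  case (Suc n)
  have "continuous_on UNIV (T \<circ> (T ^^ n))"
    using Suc continuous_T by (metis continuous_on_compose continuous_on_subset subset_UNIV)
  then show ?case by (simp add: comp_def)
qed (simp add: id_def)

lemma bounded_dist: "\<exists>d>0. \<forall>x y::'a. dist x y \<le> d"
proof -
  obtain d where "\<forall>x\<in>UNIV. \<forall>y\<in>UNIV. dist (x::'a) y \<le> d"
    using compact_imp_bounded[OF compact_space] by (auto simp: bounded_two_points)
  then show ?thesis by (intro exI[of _ "max d 1"]) (auto intro: max.coboundedI1)
qed

lemma expand_iterate:
  assumes "\<And>i. i \<le> m \<Longrightarrow> dist ((T ^^ i) x) ((T ^^ i) y) < \<delta>" "i \<le> m"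
  shows "dist ((T ^^ i) x) ((T ^^ i) y) \<le> \<kappa> ^ (m - i) * dist ((T ^^ m) x) ((T ^^ m) y)"
  using assms(2)
proof (induction "m - i" arbitrary: i)
  case (Suc k)
  then have i: "k = m - Suc i" "Suc i \<le> m" by auto
  have "dist ((T ^^ i) x) ((T ^^ i) y) \<le> \<kappa> * dist ((T ^^ Suc i) x) ((T ^^ Suc i) y)"
    using expand[OF assms(1)[of i]] Suc.prems by simp
  also have "\<dots> \<le> \<kappa> * (\<kappa> ^ (m - Suc i) * dist ((T ^^ m) x) ((T ^^ m) y))"
    using Suc.hyps(1)[OF i] \<kappa>_pos by simp
  also have "\<dots> = \<kappa> ^ (m - i) * dist ((T ^^ m) x) ((T ^^ m) y)"
    using i Suc.hyps(2) by (metis mult.assoc power_Suc)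
  finally show ?case .
qed simp

lemma pullback:
  assumes "dist ((T ^^ n) z) w < \<delta>"
  shows "\<exists>z'. (T ^^ n) z' = w \<and>
    (\<forall>i\<le>n. dist ((T ^^ i) z) ((T ^^ i) z') \<le> \<kappa> ^ (n - i) * dist ((T ^^ n) z) w)"
  using assms
proof (induction n arbitrary: w)
  case 0
  then show ?case by auto
next
  case (Suc n)
  obtain v where v: "T v = w" "dist ((T ^^ n) z) v \<le> \<kappa> * dist ((T ^^ Suc n) z) w"
    using lift[of "(T ^^ n) z" w] Suc.prems by auto
  have "\<kappa> * dist ((T ^^ Suc n) z) w \<le> dist ((T ^^ Suc n) z) w"
    using mult_right_mono[of \<kappa> 1 "dist ((T ^^ Suc n) z) w"] \<kappa>_less_1 by simp
  then have "dist ((T ^^ n) z) v < \<delta>" using Suc.prems v(2) by linarith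
  then obtain z' where z': "(T ^^ n) z' = v"
    "\<And>i. i \<le> n \<Longrightarrow> dist ((T ^^ i) z) ((T ^^ i) z') \<le> \<kappa> ^ (n - i) * dist ((T ^^ n) z) v"
    using Suc.IH by blast
  have "dist ((T ^^ i) z) ((T ^^ i) z') \<le> \<kappa> ^ (Suc n - i) * dist ((T ^^ Suc n) z) w"
    if "i \<le> Suc n" for i
  proof (cases "i = Suc n")
    case False
    then have i: "i \<le> n" using that by simp
    have "dist ((T ^^ i) z) ((T ^^ i) z') \<le> \<kappa> ^ (n - i) * dist ((T ^^ n) z) v" by (rule z'(2)[OF i])
    also have "\<dots> \<le> \<kappa> ^ (n - i) * (\<kappa> * dist ((T ^^ Suc n) z) w)"
      using v(2) \<kappa>_pos by (intro mult_left_mono) auto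
    finally show ?thesis using i by (simp add: Suc_diff_le algebra_simps)
  qed (use v z' in auto)
  then show ?case using z'(1) v(1) by (intro exI[of _ z']) auto
qed

text \<open>The contraction of the inverse branches absorbs the error made at each jump, so the errors along a
  pseudo-orbit do not accumulate.\<close>

lemma pseudo_pullback:
  assumes e: "4 * e < \<delta> * (1 - \<kappa>)" and r: "r = e / (1 - \<kappa>)" and "0 \<le> e"
  shows "(\<And>i. i < n \<Longrightarrow> dist (T (x i)) (x (Suc i)) \<le> e) \<Longrightarrow> dist w (x n) \<le> r \<Longrightarrow>
    \<exists>y. (T ^^ n) y = w \<and> (\<forall>i\<le>n. dist ((T ^^ i) y) (x i) \<le> r)"
proof (induction n arbitrary: w)
  case 0
  then show ?case by auto
next
  case (Suc n)
  have k: "0 < 1 - \<kappa>" using \<kappa>_less_1 by simp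
  have er: "e = (1 - \<kappa>) * r" using r k by simp
  have r0: "0 \<le> r" using r assms(3) k by simp
  have "4 * r < \<delta>" using e mult_less_cancel_right_pos[OF k, of "4 * r" \<delta>] unfolding er by (simp add: mult_ac)
  have er': "e \<le> r" using er r0 \<kappa>_pos mult_right_mono[of "1 - \<kappa>" 1 r] by simp
  have d: "dist (T (x n)) w \<le> e + r"
    using dist_triangle[of "T (x n)" w "x (Suc n)"] Suc.prems(1)[of n] Suc.prems(2)
    by (simp add: dist_commute)
  also have "\<dots> < \<delta>" using er' r0 \<open>4 * r < \<delta>\<close> by linarith
  finally obtain v where v: "T v = w" "dist (x n) v \<le> \<kappa> * dist (T (x n)) w" using lift by blast
  have "\<kappa> * dist (T (x n)) w \<le> \<kappa> * (e + r)" using d \<kappa>_pos by simp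
  also have "\<dots> = \<kappa> * e + \<kappa> * r" by (simp add: algebra_simps)
  also have "\<dots> \<le> e + \<kappa> * r" using assms(3) \<kappa>_less_1 mult_right_mono[of \<kappa> 1 e] by simp
  also have "\<dots> = r" unfolding er by (simp add: algebra_simps)
  finally have "dist v (x n) \<le> r" using v(2) by (simp add: dist_commute)
  then obtain y where y: "(T ^^ n) y = v" "\<forall>i\<le>n. dist ((T ^^ i) y) (x i) \<le> r"
    using Suc.IH[of v] Suc.prems(1) by auto
  then show ?case using v(1) Suc.prems(2) by (intro exI[of _ y]) (auto simp: le_Suc_eq)
qed

text \<open>Going backwards once along the closed pseudo-orbit defines a contraction of the ball of radius \<open>r\<close> around
  its starting point. The periodic point is its fixed point.\<close>

lemma periodic_shadowing:
  assumes e: "4 * e < \<delta> * (1 - \<kappa>)" and r: "r = e / (1 - \<kappa>)" and "0 \<le> e" and n: "1 \<le> n"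
    and chain: "\<And>i. i < n \<Longrightarrow> dist (T (x i)) (x (Suc i)) \<le> e" and closed: "x n = x 0"
  shows "\<exists>y. (T ^^ n) y = y \<and> (\<forall>i\<le>n. dist ((T ^^ i) y) (x i) \<le> r)"
proof -
  have k: "0 < 1 - \<kappa>" using \<kappa>_less_1 by simp
  have r0: "0 \<le> r" using r assms(3) k by simp
  have "4 * r < \<delta>" using e k r pos_divide_less_eq[OF k, of "4 * e" \<delta>] by simp
  have "\<exists>y. (T ^^ n) y = w \<and> (\<forall>i\<le>n. dist ((T ^^ i) y) (x i) \<le> r)" if "w \<in> cball (x 0) r" for w
    using pseudo_pullback[OF e r assms(3), of n x w] chain that closed by (auto simp: dist_commute)
  then obtain g where g: "\<And>w. w \<in> cball (x 0) r \<Longrightarrow> (T ^^ n) (g w) = w"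
    "\<And>w i. w \<in> cball (x 0) r \<Longrightarrow> i \<le> n \<Longrightarrow> dist ((T ^^ i) (g w)) (x i) \<le> r"
    by metis
  have "compact (cball (x 0) r)" using compact_space closed_cball compact_Int_closed[of UNIV] by auto
  then have "\<exists>!y. y \<in> cball (x 0) r \<and> g y = y"
  proof (intro Banach_fix[OF compact_imp_complete, of "cball (x 0) r" "\<kappa> ^ n" g])
    show "cball (x 0) r \<noteq> {}" using r0 by auto
    show "0 \<le> \<kappa> ^ n" using \<kappa>_pos by simp
    show "\<kappa> ^ n < 1"
      using n \<kappa>_pos \<kappa>_less_1 power_Suc_less_one[of \<kappa> "n - 1"] by simp
    show "g ` cball (x 0) r \<subseteq> cball (x 0) r" using g(2)[of _ 0] by (auto simp: dist_commute)
    show "dist (g w) (g w') \<le> \<kappa> ^ n * dist w w'" if "w \<in> cball (x 0) r" "w' \<in> cball (x 0) r" for w w'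
    proof -
      have "dist ((T ^^ i) (g w)) ((T ^^ i) (g w')) < \<delta>" if "i \<le> n" for i
      proof -
        have "dist ((T ^^ i) (g w)) ((T ^^ i) (g w')) \<le> dist ((T ^^ i) (g w)) (x i) + dist ((T ^^ i) (g w')) (x i)"
          by (rule dist_triangle2)
        also have "\<dots> \<le> r + r" using g(2) \<open>w \<in> _\<close> \<open>w' \<in> _\<close> that by (intro add_mono) auto
        finally show ?thesis using r0 \<open>4 * r < \<delta>\<close> by linarith
      qed
      then show ?thesis
        using expand_iterate[of n "g w" "g w'" 0] g(1)[OF \<open>w \<in> _\<close>] g(1)[OF \<open>w' \<in> _\<close>] by simp
    qed
  qed
  then show ?thesis using g by metis
qed

text \<open>Not only the largest distance but the sum of the distances is controlled by the gap, as the distances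
  decay geometrically away from the end of the loop.\<close>

lemma closing:
  assumes e: "4 * dist ((T ^^ p) z) z < \<delta> * (1 - \<kappa>)" and p: "1 \<le> p"
  shows "\<exists>y. (T ^^ p) y = y \<and>
    (\<Sum>i<p. dist ((T ^^ i) y) ((T ^^ i) z)) \<le> dist ((T ^^ p) z) z / (1 - \<kappa>)\<^sup>2"
proof -
  define e where "e = dist ((T ^^ p) z) z"
  define r where "r = e / (1 - \<kappa>)"
  have k: "0 < 1 - \<kappa>" using \<kappa>_less_1 by simp
  have r0: "0 \<le> r" using k by (simp add: r_def e_def)
  have r\<delta>: "4 * r < \<delta>"
    using e pos_divide_less_eq[OF k, of "4 * dist ((T ^^ p) z) z" \<delta>] by (simp add: r_def e_def)
  define x where "x i = (if i < p then (T ^^ i) z else z)" for i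
  have "\<exists>y. (T ^^ p) y = y \<and> (\<forall>i\<le>p. dist ((T ^^ i) y) (x i) \<le> r)"
  proof (rule periodic_shadowing[OF _ r_def _ p])
    show "dist (T (x i)) (x (Suc i)) \<le> e" if "i < p" for i
    proof (cases "Suc i < p")
      case False
      then have "p = Suc i" using that by simp
      then show ?thesis by (simp add: x_def e_def)
    qed (simp add: x_def e_def)
  qed (use e p in \<open>auto simp: e_def x_def\<close>)
  then obtain y where y: "(T ^^ p) y = y" "\<And>i. i < p \<Longrightarrow> dist ((T ^^ i) y) ((T ^^ i) z) \<le> r"
    by (metis less_imp_le x_def)
  have "(\<Sum>i<p. dist ((T ^^ i) y) ((T ^^ i) z)) \<le> (\<Sum>i<p. \<kappa> ^ (p - Suc i) * r)"
  proof (rule sum_mono)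
    fix i assume i: "i \<in> {..<p}"
    have "dist ((T ^^ i) y) ((T ^^ i) z) \<le>
        \<kappa> ^ (p - 1 - i) * dist ((T ^^ (p - 1)) y) ((T ^^ (p - 1)) z)"
    proof (rule expand_iterate)
      fix j assume "j \<le> p - 1"
      then show "dist ((T ^^ j) y) ((T ^^ j) z) < \<delta>" using y(2)[of j] p r\<delta> r0 by linarith
    qed (use i in auto)
    also have "\<dots> \<le> \<kappa> ^ (p - 1 - i) * r" using y(2)[of "p - 1"] p \<kappa>_pos by (intro mult_left_mono) auto
    finally show "dist ((T ^^ i) y) ((T ^^ i) z) \<le> \<kappa> ^ (p - Suc i) * r" by simp
  qed
  also have "\<dots> = (\<Sum>i<p. \<kappa> ^ (p - Suc i)) * r" by (simp add: sum_distrib_right)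
  also have "\<dots> \<le> 1 / (1 - \<kappa>) * r"
    using sum_geometric_rev_le[of \<kappa> p] \<kappa>_pos \<kappa>_less_1 r0 by (intro mult_right_mono) auto
  also have "\<dots> = e / (1 - \<kappa>)\<^sup>2" by (simp add: r_def power2_eq_square)
  finally show ?thesis using y(1) e_def by blast
qed

end

section \<open>Maximal means and sub-actions\<close>

lemma funpow_diff_apply: "i \<le> j \<Longrightarrow> (T ^^ (j - i)) ((T ^^ i) x) = (T ^^ j) x"
  using funpow_add[of "j - i" i T] by simp

lemma orbit_sum_dist_le:
  assumes "K-lipschitz_on UNIV f"
  shows "\<bar>orbit_sum T f n x - orbit_sum T f n y\<bar> \<le> K * (\<Sum>i<n. dist ((T ^^ i) x) ((T ^^ i) y))"
proof -
  have "\<bar>orbit_sum T f n x - orbit_sum T f n y\<bar> = \<bar>\<Sum>i<n. f ((T ^^ i) x) - f ((T ^^ i) y)\<bar>"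
    by (simp add: orbit_sum_def sum_subtractf)
  also have "\<dots> \<le> (\<Sum>i<n. \<bar>f ((T ^^ i) x) - f ((T ^^ i) y)\<bar>)" by (rule sum_abs)
  also have "\<dots> \<le> (\<Sum>i<n. K * dist ((T ^^ i) x) ((T ^^ i) y))"
    using lipschitz_onD[OF assms] by (intro sum_mono) (auto simp: dist_real_def)
  finally show ?thesis by (simp add: sum_distrib_left)
qed

lemma orbit_sum_abs_le:
  assumes "\<And>x. \<bar>f x\<bar> \<le> M"
  shows "\<bar>orbit_sum T f n x\<bar> \<le> real n * M"
proof -
  have "\<bar>orbit_sum T f n x\<bar> \<le> (\<Sum>i<n. \<bar>f ((T ^^ i) x)\<bar>)" unfolding orbit_sum_def by (rule sum_abs)
  also have "\<dots> \<le> (\<Sum>i<n. M)" by (intro sum_mono assms)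
  finally show ?thesis by simp
qed

context expanding_system begin

lemma continuous_bounded:
  assumes "continuous_on UNIV (g :: 'a \<Rightarrow> real)"
  shows "\<exists>M\<ge>0. \<forall>x. \<bar>g x\<bar> \<le> M"
proof -
  have "compact (range g)" using assms compact_space by (rule compact_continuous_image)
  then obtain M where M: "\<And>x. \<bar>g x\<bar> \<le> M" using compact_imp_bounded[of "range g"] by (auto simp: bounded_iff)
  have "0 \<le> M" using M[of undefined] by linarith
  then show ?thesis using M by blast
qed

lemma lipschitz_bounded:
  assumes "K-lipschitz_on UNIV (f :: 'a \<Rightarrow> real)"
  shows "\<exists>M. \<forall>x. \<bar>f x\<bar> \<le> M"
  using continuous_bounded[OF lipschitz_on_continuous_on[OF assms]] by blast

lemma finite_cover: "0 < e \<Longrightarrow> \<exists>F::'a set. finite F \<and> (\<forall>x. \<exists>c\<in>F. dist c x < e)"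
  using compact_space unfolding compact_eq_totally_bounded by (auto simp: subset_eq) 

lemma ex_periodic: "\<exists>y p. 1 \<le> p \<and> (T ^^ p) y = y"
proof -
  define e where "e = \<delta> * (1 - \<kappa>) / 8"
  have e: "e > 0" using \<delta>_pos \<kappa>_less_1 by (simp add: e_def)
  obtain F :: "'a set" where F: "finite F" "\<And>x. \<exists>c\<in>F. dist c x < e" using finite_cover[OF e] by blast
  then obtain c where c: "\<And>x. c x \<in> F" "\<And>x. dist (c x) x < e" by metis
  obtain x :: 'a where True by blast
  have "\<not> inj (\<lambda>n. c ((T ^^ n) x))"
  proof
    assume "inj (\<lambda>n. c ((T ^^ n) x))"
    then have "infinite (range (\<lambda>n. c ((T ^^ n) x)))" by (rule range_inj_infinite)
    moreover have "range (\<lambda>n. c ((T ^^ n) x)) \<subseteq> F" using c(1) by blast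
    ultimately show False using F(1) finite_subset by blast
  qed
  then obtain i j where ij: "i < j" "c ((T ^^ i) x) = c ((T ^^ j) x)"
    unfolding inj_def by (metis nat_neq_iff)
  define z where "z = (T ^^ i) x"
  have z: "(T ^^ (j - i)) z = (T ^^ j) x"
    unfolding z_def using ij(1) by (simp add: funpow_diff_apply)
  have "dist ((T ^^ (j - i)) z) z < e + e"
    using c(2)[of "(T ^^ i) x"] c(2)[of "(T ^^ j) x"] ij(2) dist_triangle3[of "(T ^^ j) x" z "c z"]
    unfolding z unfolding z_def by (simp add: dist_commute)
  then have "4 * dist ((T ^^ (j - i)) z) z < 8 * e" using e by linarith
  then have near: "4 * dist ((T ^^ (j - i)) z) z < \<delta> * (1 - \<kappa>)" by (simp add: e_def)
  have "1 \<le> j - i" using ij(1) by simp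
  then show ?thesis using closing[OF near] by blast
qed

text \<open>The orbit segment is cut at its first and last visit to a ball around \<open>c\<close>. The part in between is almost
  closed and can be replaced by a periodic orbit at bounded cost, and the two other parts avoid this ball.
  Induction on the number of balls therefore yields an error independent of the length.\<close>

lemma orbit_sum_cover_bound:
  assumes f: "K-lipschitz_on UNIV f"
    and per: "\<And>y p. 1 \<le> p \<Longrightarrow> (T ^^ p) y = y \<Longrightarrow> orbit_sum T f p y \<le> real p * \<beta>"
    and e: "e = \<delta> * (1 - \<kappa>) / 8" and "finite F"
  shows "\<exists>C\<ge>0. \<forall>n x. (\<forall>i<n. \<exists>c\<in>F. dist c ((T ^^ i) x) < e) \<longrightarrow> orbit_sum T f n x \<le> real n * \<beta> + C"
  using \<open>finite F\<close>
proof (induction F rule: finite_induct)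
  case empty
  show ?case
  proof (intro exI[of _ 0] conjI allI impI)
    fix n x
    assume "\<forall>i<n. \<exists>c\<in>{}. dist c ((T ^^ i) x) < e"
    then have "n = 0" by (cases n) auto
    then show "orbit_sum T f n x \<le> real n * \<beta> + 0" by simp
  qed simp
next
  case (insert c F)
  then obtain C where C: "0 \<le> C"
    "\<And>n x. (\<And>i. i < n \<Longrightarrow> \<exists>c\<in>F. dist c ((T ^^ i) x) < e) \<Longrightarrow> orbit_sum T f n x \<le> real n * \<beta> + C"
    by blast
  obtain M where M: "\<And>x. \<bar>f x\<bar> \<le> M" using lipschitz_bounded[OF f] by blast
  have M0: "0 \<le> M" using M[of undefined] by linarith
  have K0: "0 \<le> K" using f lipschitz_on_nonneg by blast
  have e0: "0 < e" unfolding e using \<delta>_pos \<kappa>_less_1 by simp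
  define D where "D = K * (2 * e / (1 - \<kappa>)\<^sup>2)"
  have D0: "0 \<le> D" using K0 e0 by (simp add: D_def)
  have loop: "orbit_sum T f p z \<le> real p * \<beta> + D" if "dist ((T ^^ p) z) z < 2 * e" for p z
  proof (cases "p = 0")
    case False
    have near: "4 * dist ((T ^^ p) z) z < \<delta> * (1 - \<kappa>)" using that e by simp
    obtain y where y: "(T ^^ p) y = y"
      "(\<Sum>i<p. dist ((T ^^ i) y) ((T ^^ i) z)) \<le> dist ((T ^^ p) z) z / (1 - \<kappa>)\<^sup>2"
      using closing[of p z] near False by auto
    have "orbit_sum T f p z \<le> orbit_sum T f p y + K * (\<Sum>i<p. dist ((T ^^ i) y) ((T ^^ i) z))"
      using orbit_sum_dist_le[OF f, of T p y z] by linarith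
    also have "\<dots> \<le> real p * \<beta> + K * (2 * e / (1 - \<kappa>)\<^sup>2)"
      using per[OF _ y(1)] False K0 that
      by (intro add_mono mult_left_mono order.trans[OF y(2)] divide_right_mono) auto
    finally show ?thesis by (simp add: D_def)
  qed (use D0 in simp)
  show ?case
  proof (intro exI[of _ "2 * C + D + M + \<bar>\<beta>\<bar>"] conjI allI impI)
    show "0 \<le> 2 * C + D + M + \<bar>\<beta>\<bar>" using C(1) D0 M0 by simp
    fix n x
    assume *: "\<forall>i<n. \<exists>c\<in>insert c F. dist c ((T ^^ i) x) < e"
    define I where "I = {i. i < n \<and> dist c ((T ^^ i) x) < e}"
    show "orbit_sum T f n x \<le> real n * \<beta> + (2 * C + D + M + \<bar>\<beta>\<bar>)"
    proof (cases "I = {}")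
      case True
      then have "orbit_sum T f n x \<le> real n * \<beta> + C" using * by (intro C(2)) (auto simp: I_def)
      then show ?thesis using C(1) D0 M0 by linarith
    next
      case False
      have fin: "finite I" by (simp add: I_def)
      define a b where "a = Min I" and "b = Max I"
      have aI: "a \<in> I" and bI: "b \<in> I" using Min_in[OF fin False] Max_in[OF fin False] by (auto simp: a_def b_def)
      have ab: "a \<le> b" using fin bI by (simp add: a_def)
      have bn: "b < n" using bI by (simp add: I_def)
      have bef: "i \<notin> I" if "i < a" for i using that Min_le[OF fin, of i] by (auto simp: a_def)
      have aft: "i \<notin> I" if "b < i" for i using that Max_ge[OF fin, of i] by (auto simp: b_def)
      define s where "s = n - Suc b"
      have n: "n = a + ((b - a) + (1 + s))" using ab bn by (simp add: s_def)
      have Tab: "(T ^^ (b - a)) ((T ^^ a) x) = (T ^^ b) x" using ab by (rule funpow_diff_apply)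
      have split: "orbit_sum T f n x = orbit_sum T f a x + orbit_sum T f (b - a) ((T ^^ a) x)
          + f ((T ^^ b) x) + orbit_sum T f s ((T ^^ Suc b) x)"
        by (subst n, subst orbit_sum_add, subst orbit_sum_add, subst Tab, subst orbit_sum_add) simp
      have 1: "orbit_sum T f a x \<le> real a * \<beta> + C"
      proof (rule C(2))
        fix i assume i: "i < a"
        then have "i < n" using ab bn by simp
        then show "\<exists>c\<in>F. dist c ((T ^^ i) x) < e" using * bef[OF i] by (auto simp: I_def)
      qed
      have 2: "orbit_sum T f (b - a) ((T ^^ a) x) \<le> real (b - a) * \<beta> + D"
      proof (rule loop)
        have "dist ((T ^^ b) x) ((T ^^ a) x) \<le> dist c ((T ^^ b) x) + dist c ((T ^^ a) x)"
          by (rule dist_triangle3)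
        also have "\<dots> < 2 * e" using aI bI by (simp add: I_def)
        finally show "dist ((T ^^ (b - a)) ((T ^^ a) x)) ((T ^^ a) x) < 2 * e" by (simp add: Tab)
      qed
      have 3: "f ((T ^^ b) x) \<le> \<beta> + (M + \<bar>\<beta>\<bar>)" using M[of "(T ^^ b) x"] by linarith
      have 4: "orbit_sum T f s ((T ^^ Suc b) x) \<le> real s * \<beta> + C"
      proof (rule C(2))
        fix i assume i: "i < s"
        have eq: "(T ^^ i) ((T ^^ Suc b) x) = (T ^^ (i + Suc b)) x" unfolding funpow_add comp_apply ..
        have "i + Suc b < n" using i by (simp add: s_def)
        then show "\<exists>c\<in>F. dist c ((T ^^ i) ((T ^^ Suc b) x)) < e"
          unfolding eq using * aft[of "i + Suc b"] by (fastforce simp: I_def)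
      qed
      have "real n = real a + real (b - a) + 1 + real s" using arg_cong[OF n, of real] by simp
      then have nb: "real n * \<beta> = real a * \<beta> + real (b - a) * \<beta> + \<beta> + real s * \<beta>"
        by (simp add: algebra_simps)
      show ?thesis using 1 2 3 4 unfolding split nb by linarith
    qed
  qed
qed

text \<open>Here \<open>\<beta>\<close> is the supremum of the means of \<open>f\<close> along periodic orbits. If all segments of length \<open>n\<close> fell
  below \<open>n\<beta> - 1\<close>, then all these means would stay below \<open>\<beta> - 1/n\<close>.\<close>

lemma maximal_mean:
  assumes f: "K-lipschitz_on UNIV f"
  shows "\<exists>\<beta> C. (\<forall>n x. orbit_sum T f n x \<le> real n * \<beta> + C) \<and>
    (\<forall>n. \<exists>x. real n * \<beta> - 1 \<le> orbit_sum T f n x)"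
proof -
  obtain M where M: "\<And>x. \<bar>f x\<bar> \<le> M" using lipschitz_bounded[OF f] by blast
  define A where "A = {orbit_sum T f p y / real p |p y. 1 \<le> p \<and> (T ^^ p) y = y}"
  define \<beta> where "\<beta> = Sup A"
  have ne: "A \<noteq> {}" using ex_periodic by (auto simp: A_def)
  have bdd: "bdd_above A"
  proof (rule bdd_aboveI[of _ M])
    fix a assume "a \<in> A"
    then obtain p y where p: "a = orbit_sum T f p y / real p" "1 \<le> p" by (auto simp: A_def)
    have "orbit_sum T f p y \<le> real p * M" using orbit_sum_abs_le[of f M T p y] M by auto
    then show "a \<le> M" using p by (simp add: divide_le_eq mult.commute)
  qed
  have per: "orbit_sum T f p y \<le> real p * \<beta>" if "1 \<le> p" "(T ^^ p) y = y" for p y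
  proof -
    have "orbit_sum T f p y / real p \<le> \<beta>"
      unfolding \<beta>_def using bdd that by (intro cSup_upper) (auto simp: A_def)
    then show ?thesis using that by (simp add: divide_le_eq mult.commute)
  qed
  define e where "e = \<delta> * (1 - \<kappa>) / 8"
  have e: "e > 0" using \<delta>_pos \<kappa>_less_1 by (simp add: e_def)
  obtain F :: "'a set" where F: "finite F" "\<And>x. \<exists>c\<in>F. dist c x < e" using finite_cover[OF e] by blast
  obtain C where C: "\<forall>n x. (\<forall>i<n. \<exists>c\<in>F. dist c ((T ^^ i) x) < e) \<longrightarrow> orbit_sum T f n x \<le> real n * \<beta> + C"
    using orbit_sum_cover_bound[OF f per e_def F(1)] by auto
  then have "\<forall>n x. orbit_sum T f n x \<le> real n * \<beta> + C" using F(2) by simp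
  moreover have "\<exists>x. real n * \<beta> - 1 \<le> orbit_sum T f n x" for n
  proof (cases "n = 0")
    case False
    show ?thesis
    proof (rule ccontr)
      assume "\<not> ?thesis"
      then have less: "orbit_sum T f n x \<le> real n * \<beta> - 1" for x by (meson linear)
      have blocks: "orbit_sum T f (k * n) x \<le> real k * (real n * \<beta> - 1)" for k x
      proof (induction k arbitrary: x)
        case (Suc k)
        have "orbit_sum T f (Suc k * n) x = orbit_sum T f n x + orbit_sum T f (k * n) ((T ^^ n) x)"
          using orbit_sum_add[of T f n "k * n" x] by simp
        also have "\<dots> \<le> (real n * \<beta> - 1) + real k * (real n * \<beta> - 1)" by (intro add_mono less Suc)
        finally show ?case by (simp add: algebra_simps)
      qed simp
      have "\<beta> - 1 / real n < \<beta>" using False by simp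
      then obtain a where "a \<in> A" and a: "\<beta> - 1 / real n < a"
        unfolding \<beta>_def using less_cSupD[OF ne] by blast
      then obtain p y where p: "a = orbit_sum T f p y / real p" "1 \<le> p" "(T ^^ p) y = y" by (auto simp: A_def)
      have "real n * orbit_sum T f p y = orbit_sum T f (p * n) y"
        using orbit_sum_periods[OF p(3), of f n] by (simp add: mult.commute)
      also have "\<dots> \<le> real p * (real n * \<beta> - 1)" by (rule blocks)
      finally have "real n * (a * real p) \<le> real p * (real n * \<beta> - 1)" using p(1,2) by simp
      then have "real p * (real n * a) \<le> real p * (real n * \<beta> - 1)" by (simp add: mult_ac)
      then have "real n * a \<le> real n * \<beta> - 1" using p(2) by simp
      then have "a \<le> \<beta> - 1 / real n" using False by (simp add: field_simps)
      then show False using a by simp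
    qed
  qed (auto intro: exI[of _ undefined])
  ultimately show ?thesis by blast
qed

text \<open>The value \<open>u x\<close> is the largest normalized sum that an orbit can collect before it arrives at \<open>x\<close>.
  Extending the orbit by one step gives the inequality, and pulling an orbit back to a nearby end point
  gives the Lipschitz bound.\<close>

lemma sub_action:
  assumes f: "K-lipschitz_on UNIV f" and C: "\<And>n x. orbit_sum T f n x \<le> real n * \<beta> + C"
  shows "\<exists>u K'. K'-lipschitz_on UNIV u \<and> (\<forall>x. f x - \<beta> + u x - u (T x) \<le> 0) \<and> (\<forall>x. 0 \<le> u x \<and> u x \<le> C)"
proof -
  define A where "A x = {orbit_sum T f n z - real n * \<beta> |n z. (T ^^ n) z = x}" for x
  define u where "u x = Sup (A x)" for x
  have zero: "0 \<in> A x" for x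
    unfolding A_def by (rule CollectI, rule exI[of _ 0], rule exI[of _ x]) simp
  then have ne: "A x \<noteq> {}" for x by blast
  have le_C: "a \<le> C" if "a \<in> A x" for a x using that C by (auto simp: A_def diff_le_eq add.commute)
  have bdd: "bdd_above (A x)" for x using le_C by (rule bdd_aboveI)
  have upper: "orbit_sum T f n z - real n * \<beta> \<le> u x" if "(T ^^ n) z = x" for n z x
    unfolding u_def by (rule cSup_upper[OF _ bdd]) (use that in \<open>auto simp: A_def\<close>)
  have u: "0 \<le> u x" "u x \<le> C" for x
    unfolding u_def using zero bdd by (auto intro: cSup_upper cSup_least[OF ne le_C])
  have "f x - \<beta> + u x - u (T x) \<le> 0" for x
  proof -
    have "u x \<le> u (T x) - (f x - \<beta>)"
      unfolding u_def[of x]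
    proof (rule cSup_least[OF ne])
      fix a assume "a \<in> A x"
      then obtain n z where a: "a = orbit_sum T f n z - real n * \<beta>" "(T ^^ n) z = x" by (auto simp: A_def)
      have "orbit_sum T f (n + 1) z - real (n + 1) * \<beta> \<le> u (T x)" by (rule upper) (simp add: a)
      then show "a \<le> u (T x) - (f x - \<beta>)" using a orbit_sum_add[of T f n 1 z] by (simp add: algebra_simps)
    qed
    then show ?thesis by simp
  qed
  moreover have "\<exists>K'. K'-lipschitz_on UNIV u"
  proof -
    have K0: "0 \<le> K" using f lipschitz_on_nonneg by blast
    have C0: "0 \<le> C" using u[of undefined] by linarith
    define K' where "K' = max (K / (1 - \<kappa>)) (C / \<delta>)"
    have K'0: "0 \<le> K'" using K0 \<kappa>_less_1 by (simp add: K'_def le_max_iff_disj)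
    have loc: "u x - u y \<le> K / (1 - \<kappa>) * dist x y" if d: "dist x y < \<delta>" for x y
    proof -
      have "u x \<le> u y + K / (1 - \<kappa>) * dist x y"
        unfolding u_def[of x]
      proof (rule cSup_least[OF ne])
        fix a assume "a \<in> A x"
        then obtain n z where a: "a = orbit_sum T f n z - real n * \<beta>" "(T ^^ n) z = x" by (auto simp: A_def)
        obtain z' where z': "(T ^^ n) z' = y"
          "\<And>i. i \<le> n \<Longrightarrow> dist ((T ^^ i) z) ((T ^^ i) z') \<le> \<kappa> ^ (n - i) * dist x y"
          using pullback[of n z y] d a(2) by blast
        have "(\<Sum>i<n. dist ((T ^^ i) z) ((T ^^ i) z')) \<le> (\<Sum>i<n. \<kappa> ^ (n - Suc i) * dist x y)"
        proof (rule sum_mono)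
          fix i assume i: "i \<in> {..<n}"
          have "dist ((T ^^ i) z) ((T ^^ i) z') \<le> \<kappa> ^ (n - i) * dist x y" using z'(2) i by simp
          also have "\<dots> \<le> \<kappa> ^ (n - Suc i) * dist x y"
            using \<kappa>_pos \<kappa>_less_1 by (intro mult_right_mono power_decreasing) auto
          finally show "dist ((T ^^ i) z) ((T ^^ i) z') \<le> \<kappa> ^ (n - Suc i) * dist x y" .
        qed
        also have "\<dots> \<le> 1 / (1 - \<kappa>) * dist x y"
          unfolding sum_distrib_right[symmetric]
          using sum_geometric_rev_le[of \<kappa> n] \<kappa>_pos \<kappa>_less_1 by (intro mult_right_mono) auto
        finally have "K * (\<Sum>i<n. dist ((T ^^ i) z) ((T ^^ i) z')) \<le> K * (1 / (1 - \<kappa>) * dist x y)"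
          using K0 by (rule mult_left_mono)
        then have "orbit_sum T f n z - orbit_sum T f n z' \<le> K / (1 - \<kappa>) * dist x y"
          using orbit_sum_dist_le[OF f, of T n z z'] by simp
        then show "a \<le> u y + K / (1 - \<kappa>) * dist x y" using a(1) upper[OF z'(1)] by linarith
      qed
      then show ?thesis by simp
    qed
    have "u x - u y \<le> K' * dist x y" for x y
    proof (cases "dist x y < \<delta>")
      case True
      have "K / (1 - \<kappa>) * dist x y \<le> K' * dist x y" by (intro mult_right_mono) (auto simp: K'_def)
      then show ?thesis using loc[OF True] by simp
    next
      case False
      have "u x - u y \<le> C" using u(2)[of x] u(1)[of y] by linarith
      also have "C = C / \<delta> * \<delta>" using \<delta>_pos by simp
      also have "\<dots> \<le> K' * dist x y" using False C0 \<delta>_pos K'0 by (intro mult_mono) (auto simp: K'_def)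
      finally show ?thesis .
    qed
    note * = this
    have "dist (u x) (u y) \<le> K' * dist x y" for x y
      using *[of x y] *[of y x] by (simp add: dist_real_def dist_commute abs_le_iff)
    moreover note K'0
    ultimately show ?thesis by (intro exI lipschitz_onI)
  qed
  ultimately show ?thesis using u by blast
qed

lemma lipschitz_comp_T:
  assumes u: "K-lipschitz_on UNIV (u :: 'a \<Rightarrow> real)"
  shows "(K * L)-lipschitz_on UNIV (\<lambda>x. u (T x))"
proof (rule lipschitz_onI)
  fix x y :: 'a
  have "dist (u (T x)) (u (T y)) \<le> K * dist (T x) (T y)" using u lipschitz_onD by blast
  also have "\<dots> \<le> K * (L * dist x y)" using T_lip lipschitz_on_nonneg[OF u] by (intro mult_left_mono) auto
  finally show "dist (u (T x)) (u (T y)) \<le> K * L * dist x y" by (simp add: mult.assoc)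
next
  show "0 \<le> K * L" using lipschitz_on_nonneg[OF u] L_ge_1 by simp
qed

lemma orbit_sum_coboundary:
  "orbit_sum T (\<lambda>x. f x - \<beta> + u x - u (T x)) n x = orbit_sum T f n x - real n * \<beta> + u x - u ((T ^^ n) x)"
proof (induction n)
  case (Suc n)
  have step: "orbit_sum T g (Suc n) x = orbit_sum T g n x + g ((T ^^ n) x)" for g
    by (simp add: orbit_sum_def)
  show ?case unfolding step Suc by (simp add: algebra_simps)
qed simp

text \<open>Mane's lemma together with an orbit inside the zero set of \<open>g\<close>. Orbit segments of
  all lengths have sums of \<open>g\<close> bounded below by the same constant; a limit point of their starting points
  inherits this, and the zero orbit lies in its limit set.\<close>

lemma mane:
  assumes f: "K-lipschitz_on UNIV (f :: 'a \<Rightarrow> real)"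
  shows "\<exists>\<beta> u K' g K''. K'-lipschitz_on UNIV u \<and> g = (\<lambda>x. f x - \<beta> + u x - u (T x)) \<and>
    K''-lipschitz_on UNIV g \<and> (\<forall>x. g x \<le> 0) \<and> (\<exists>z. \<forall>n. g ((T ^^ n) z) = 0)"
proof -
  obtain \<beta> C where \<beta>: "\<And>n x. orbit_sum T f n x \<le> real n * \<beta> + C"
    "\<And>n. \<exists>x. real n * \<beta> - 1 \<le> orbit_sum T f n x"
    using maximal_mean[OF f] by blast
  obtain u K' where u: "K'-lipschitz_on UNIV u" "\<And>x. f x - \<beta> + u x - u (T x) \<le> 0" "\<And>x. 0 \<le> u x" "\<And>x. u x \<le> C"
    using sub_action[OF f \<beta>(1)] by blast
  define g where "g = (\<lambda>x. f x - \<beta> + u x - u (T x))"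
  have g0: "g x \<le> 0" for x using u(2) by (simp add: g_def)
  have g: "(K + 0 + K' + K' * L)-lipschitz_on UNIV g"
    unfolding g_def
    by (rule lipschitz_on_diff[OF lipschitz_on_add[OF lipschitz_on_diff[OF f lipschitz_on_constant] u(1)]
          lipschitz_comp_T[OF u(1)]])
  have gcont: "isCont g x" for x
    using lipschitz_on_continuous_on[OF g] by (simp add: continuous_on_eq_continuous_at)
  have Tcont: "isCont (T ^^ n) x" for n x
    using continuous_T_iterate[of n] by (simp add: continuous_on_eq_continuous_at)
  have anti: "orbit_sum T g n x \<le> orbit_sum T g m x" if "m \<le> n" for m n x
    using orbit_sum_mono[OF that, of "\<lambda>x. - g x" T x] g0 by (simp add: orbit_sum_def sum_negf)
  have "\<exists>x. - 1 - C \<le> orbit_sum T g n x" for n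
  proof -
    obtain x where x: "real n * \<beta> - 1 \<le> orbit_sum T f n x" using \<beta>(2) by blast
    show ?thesis
      using x u(3)[of x] u(4)[of "(T ^^ n) x"]
      by (intro exI[of _ x]) (simp add: g_def orbit_sum_coboundary)
  qed
  then obtain x where x: "\<And>n. - 1 - C \<le> orbit_sum T g n (x n)" by metis
  obtain y r where r: "strict_mono r" "(x \<circ> r) \<longlonglongrightarrow> y"
    using compact_space unfolding compact_def by blast
  have y: "- 1 - C \<le> orbit_sum T g n y" for n
  proof (rule Lim_bounded2)
    show "(\<lambda>k. orbit_sum T g n ((x \<circ> r) k)) \<longlonglongrightarrow> orbit_sum T g n y"
      unfolding orbit_sum_def
      by (intro tendsto_sum isCont_tendsto_compose[OF gcont] isCont_tendsto_compose[OF Tcont] r)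
    show "\<forall>k\<ge>n. - 1 - C \<le> orbit_sum T g n ((x \<circ> r) k)"
    proof (intro allI impI)
      fix k assume "k \<ge> n"
      then have "n \<le> r k" using seq_suble[OF r(1), of k] by simp
      then show "- 1 - C \<le> orbit_sum T g n ((x \<circ> r) k)" using anti[OF \<open>n \<le> r k\<close>, of "x (r k)"] x[of "r k"] by simp
    qed
  qed
  \<comment> \<open>Along the orbit of \<open>y\<close> the nonpositive function \<open>g\<close> has a bounded sum, so it tends to \<open>0\<close>
    and vanishes on the limit points.\<close>
  have "summable (\<lambda>i. - g ((T ^^ i) y))"
  proof (rule bounded_imp_summable[of _ "1 + C"])
    fix n
    show "(\<Sum>i\<le>n. - g ((T ^^ i) y)) \<le> 1 + C"
      using y[of "Suc n"] by (simp add: orbit_sum_def sum_negf lessThan_Suc_atMost)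
  qed (use g0 in auto)
  then have lim0: "(\<lambda>i. g ((T ^^ i) y)) \<longlonglongrightarrow> 0"
    using summable_LIMSEQ_zero tendsto_minus_cancel_left[of "\<lambda>i. g ((T ^^ i) y)" 0 sequentially] by fastforce
  obtain z s where s: "strict_mono s" "((\<lambda>n. (T ^^ n) y) \<circ> s) \<longlonglongrightarrow> z"
    using compact_space unfolding compact_def by blast
  have "g ((T ^^ n) z) = 0" for n
  proof (rule LIMSEQ_unique)
    show "(\<lambda>k. g ((T ^^ n) (((\<lambda>n. (T ^^ n) y) \<circ> s) k))) \<longlonglongrightarrow> g ((T ^^ n) z)"
      by (intro isCont_tendsto_compose[OF gcont] isCont_tendsto_compose[OF Tcont] s)
    have "strict_mono (\<lambda>k. n + s k)" using s(1) by (simp add: strict_mono_def)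
    from LIMSEQ_subseq_LIMSEQ[OF lim0 this]
    show "(\<lambda>k. g ((T ^^ n) (((\<lambda>n. (T ^^ n) y) \<circ> s) k))) \<longlonglongrightarrow> 0" by (simp add: comp_def funpow_add)
  qed
  then show ?thesis using u(1) g g0 g_def by blast
qed

end

section \<open>Periodic orbits close to an invariant set\<close>

text \<open>Fekete's lemma, in the form needed for the number of itineraries and for the entropies of itineraries.\<close>

lemma fekete:
  fixes a :: "nat \<Rightarrow> real"
  assumes nonneg: "\<And>n. 0 \<le> a n" and sub: "\<And>m n. a (m + n) \<le> a m + a n"
  shows "\<exists>h. (\<lambda>n. a n / real n) \<longlonglongrightarrow> h \<and> (\<forall>n. real n * h \<le> a n)"
proof -
  define h where "h = (INF n\<in>{1..}. a n / real n)"
  have bdd: "bdd_below ((\<lambda>n. a n / real n) ` {1..})"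
    by (rule bdd_belowI[of _ 0]) (use nonneg in auto)
  have h_le: "h \<le> a n / real n" if "1 \<le> n" for n
    unfolding h_def using that by (intro cINF_lower[OF bdd]) auto
  have mult: "a (k * m + r) \<le> real k * a m + a r" for k m r
  proof (induction k)
    case (Suc k)
    have "a (Suc k * m + r) \<le> a m + a (k * m + r)" using sub[of m "k * m + r"] by (simp add: add.assoc)
    then show ?case using Suc by (simp add: algebra_simps)
  qed simp
  have "(\<lambda>n. a n / real n) \<longlonglongrightarrow> h"
  proof (rule LIMSEQ_I)
    fix e :: real assume e: "0 < e"
    have "\<exists>m\<in>{1..}. a m / real m < h + e / 2"
      using cINF_less_iff[OF _ bdd, of "h + e / 2"] e unfolding h_def[symmetric] by simp
    then obtain m where m: "1 \<le> m" "a m / real m < h + e / 2" by auto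
    define B where "B = Max (a ` {..<m})"
    have B: "a r \<le> B" if "r < m" for r unfolding B_def using that by (intro Max_ge) auto
      obtain N where N: "2 * B / e < real N" using reals_Archimedean2 by blast
    show "\<exists>no. \<forall>n\<ge>no. norm (a n / real n - h) < e"
    proof (intro exI[of _ "Suc N"] allI impI)
      fix n assume n: "Suc N \<le> n"
      then have n0: "0 < real n" "2 * B / e < real n" using N by auto
      have "a n \<le> real (n div m) * a m + a (n mod m)" using mult[of "n div m" m "n mod m"] by simp
      also have "\<dots> \<le> real (n div m) * a m + B" using B[of "n mod m"] m by simp
      also have "real (n div m) \<le> real n / real m" by (simp add: of_nat_div_le_of_nat)
      finally have "a n \<le> real n / real m * a m + B" using nonneg[of m] by (simp add: mult_right_mono)
      then have "a n / real n \<le> (real n / real m * a m + B) / real n" using n0 by (intro divide_right_mono) auto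
      also have "\<dots> = a m / real m + B / real n" using n0 m by (simp add: field_simps)
      finally have "a n / real n \<le> a m / real m + B / real n" .
      moreover have "B / real n < e / 2" using n0 e by (simp add: divide_simps mult.commute)
      ultimately have "a n / real n < h + e" using m(2) by linarith
      then show "norm (a n / real n - h) < e" using h_le[of n] n by simp
    qed
  qed
  moreover have "real n * h \<le> a n" for n
  proof (cases "n = 0")
    case False
    then show ?thesis using h_le[of n] by (simp add: field_simps)
  qed (use nonneg in simp)
  ultimately show ?thesis by blast
qed

lemma reversed_pair:
  assumes "distinct u" "distinct v" "length u = q" "length v = q" "set u = set v" "u \<noteq> v"
  shows "\<exists>i j i' j'. i < j \<and> j < q \<and> i' < j' \<and> j' < q \<and> u ! i = v ! j' \<and> u ! j = v ! i'"
proof -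
  have "\<exists>m<q. u ! m \<noteq> v ! m" using assms by (metis nth_equalityI)
  then obtain m where m: "m < q" "u ! m \<noteq> v ! m" and least: "\<And>i. i < m \<Longrightarrow> u ! i = v ! i"
    using exists_least_iff[of "\<lambda>m. m < q \<and> u ! m \<noteq> v ! m"] by (metis less_trans)
  obtain j' where j': "j' < q" "v ! j' = u ! m" using assms m by (metis in_set_conv_nth)
  obtain j where j: "j < q" "u ! j = v ! m" using assms m by (metis in_set_conv_nth)
  have "m < j'"
  proof (rule ccontr)
    assume "\<not> m < j'"
    then have "j' < m" using m(2) j'(2) by (metis linorder_neqE_nat)
    then have "u ! j' = u ! m" using least j' by simp
    then show False using \<open>j' < m\<close> assms(1,3) m(1) by (simp add: nth_eq_iff_index_eq)
  qed
  moreover have "m < j"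
  proof (rule ccontr)
    assume "\<not> m < j"
    then have "j < m" using m(2) j(2) by (metis linorder_neqE_nat)
    then have "v ! j = v ! m" using least[of j] j by simp
    then show False using \<open>j < m\<close> assms(2,4) m(1) by (simp add: nth_eq_iff_index_eq)
  qed
  ultimately show ?thesis using j j' by metis
qed

text \<open>There are only \<open>card W choose q\<close> possible sets of entries, so otherwise a list would be
  determined by its set.\<close>

lemma many_lists_collide:
  assumes W: "finite W" and P: "\<And>u. u \<in> P \<Longrightarrow> length u = q \<and> set u \<subseteq> W"
    and card: "card W choose q < card P"
  shows "(\<exists>u\<in>P. \<not> distinct u) \<or>
    (\<exists>u\<in>P. \<exists>v\<in>P. distinct u \<and> distinct v \<and> set u = set v \<and> u \<noteq> v)"
proof (rule ccontr)
  assume neg: "\<not> ?thesis"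
  then have inj: "inj_on set P" by (auto simp: inj_on_def)
  have "set ` P \<subseteq> {A. A \<subseteq> W \<and> card A = q}" using P neg by (auto simp: distinct_card)
  then have "card (set ` P) \<le> card {A. A \<subseteq> W \<and> card A = q}" using W by (intro card_mono) auto
  then show False using card n_subsets[OF W, of q] card_image[OF inj] by simp
qed

lemma fact_lower: "real n ^ n \<le> fact n * exp (real n)"
proof (induction n)
  case (Suc n)
  have "real (Suc n) ^ n \<le> exp 1 * real n ^ n"
  proof (cases "n = 0")
    case False
    have "(1 + 1 / real n) ^ n \<le> exp 1" using exp_ge_one_plus_x_over_n_power_n[of n 1] False by simp
    then have "(1 + 1 / real n) ^ n * real n ^ n \<le> exp 1 * real n ^ n" by (intro mult_right_mono) auto
    moreover have "(1 + 1 / real n) ^ n * real n ^ n = real (Suc n) ^ n"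
      using False by (simp add: power_mult_distrib[symmetric] field_simps)
    ultimately show ?thesis by simp
  qed (use one_le_exp_iff[of "1::real"] in simp)
  then have "real (Suc n) ^ Suc n \<le> real (Suc n) * (exp 1 * real n ^ n)"
    by (simp add: mult_left_mono)
  also have "\<dots> \<le> real (Suc n) * (exp 1 * (fact n * exp (real n)))" using Suc by (intro mult_left_mono) auto
  also have "\<dots> = fact (Suc n) * exp (real (Suc n))" by (simp add: exp_add algebra_simps)
  finally show ?case .
qed simp

definition itinerary :: "('a \<Rightarrow> 'a) \<Rightarrow> ('a \<Rightarrow> 'b) \<Rightarrow> nat \<Rightarrow> 'a \<Rightarrow> 'b list" where
  "itinerary T c n x = map (\<lambda>i. c ((T ^^ i) x)) [0..<n]"

lemma length_itinerary [simp]: "length (itinerary T c n x) = n"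
  by (simp add: itinerary_def)

lemma funpow_add_apply: "(T ^^ i) ((T ^^ m) x) = (T ^^ (m + i)) x"
  using funpow_add[of i m T] by (simp add: add.commute)

lemma itinerary_add: "itinerary T c (m + n) x = itinerary T c m x @ itinerary T c n ((T ^^ m) x)"
  by (rule nth_equalityI) (auto simp: itinerary_def nth_append funpow_add_apply)

lemma itinerary_concat: "itinerary T c (k * q) x = concat (map (\<lambda>i. itinerary T c k ((T ^^ (k * i)) x)) [0..<q])"
proof (induction q)
  case (Suc q)
  have "itinerary T c (k * Suc q) x = itinerary T c (k * q + k) x" by (simp add: add.commute)
  then show ?case unfolding itinerary_add using Suc by simp
qed (simp add: itinerary_def)

lemma funpow_in_invariant: "T ` Z \<subseteq> Z \<Longrightarrow> z \<in> Z \<Longrightarrow> (T ^^ n) z \<in> Z"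
  by (induction n) auto

lemma finite_itineraries:
  assumes "\<And>x. c x \<in> F" "finite F"
  shows "finite (itinerary T c n ` Z)"
proof (rule finite_subset)
  show "itinerary T c n ` Z \<subseteq> {u. set u \<subseteq> F \<and> length u = n}" using assms(1) by (auto simp: itinerary_def)
  show "finite {u. set u \<subseteq> F \<and> length u = n}" by (rule finite_lists_length_eq[OF assms(2)])
qed

text \<open>An orbit is read as a sequence of words of length \<open>k\<close>. If a word repeats along an orbit, the orbit
  almost closes up. Otherwise two orbits pass through the same words in different orders, hence through
  some two words in opposite orders, and following one orbit and then the other gives a loop with two
  jumps.\<close>

lemma short_cycle:
  assumes c: "\<And>x. c x \<in> F" "finite F" and Z: "T ` Z \<subseteq> Z" and k: "1 \<le> k"
    and many: "card (itinerary T c k ` Z) choose q < card (itinerary T c (k * q) ` Z)"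
  shows "\<exists>a\<in>Z. \<exists>b\<in>Z. \<exists>m n. 1 \<le> m \<and> m \<le> k * q \<and> 1 \<le> n \<and> n \<le> k * q \<and>
    itinerary T c k ((T ^^ m) a) = itinerary T c k b \<and> itinerary T c k ((T ^^ n) b) = itinerary T c k a"
proof -
  define s where "s z i = itinerary T c k ((T ^^ (k * i)) z)" for z i
  define path where "path z = map (s z) [0..<q]" for z
  have "itinerary T c (k * q) ` Z = concat ` path ` Z"
    unfolding image_image path_def s_def itinerary_concat ..
  moreover have "finite (path ` Z)"
  proof (rule finite_subset)
    show "path ` Z \<subseteq> {u. set u \<subseteq> itinerary T c k ` Z \<and> length u = q}"
      using funpow_in_invariant[OF Z] by (auto simp: path_def s_def)
    show "finite {u. set u \<subseteq> itinerary T c k ` Z \<and> length u = q}"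
      by (rule finite_lists_length_eq) (rule finite_itineraries[OF c])
  qed
  ultimately have "card (itinerary T c (k * q) ` Z) \<le> card (path ` Z)" by (simp add: card_image_le)
  then have le: "card (itinerary T c k ` Z) choose q < card (path ` Z)" using many by simp
  have path: "length u = q \<and> set u \<subseteq> itinerary T c k ` Z" if "u \<in> path ` Z" for u
    using that funpow_in_invariant[OF Z] by (auto simp: path_def s_def)
  have "(\<exists>u\<in>path ` Z. \<not> distinct u) \<or>
    (\<exists>u\<in>path ` Z. \<exists>v\<in>path ` Z. distinct u \<and> distinct v \<and> set u = set v \<and> u \<noteq> v)"
    by (rule many_lists_collide[OF _ path le]) (rule finite_itineraries[OF c])
  then consider (rep) u where "u \<in> path ` Z" "\<not> distinct u"
    | (two) u v where "u \<in> path ` Z" "v \<in> path ` Z" "distinct u" "distinct v" "set u = set v" "u \<noteq> v"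
    by blast
  moreover have loop: "(T ^^ (k * (j - i))) ((T ^^ (k * i)) z) = (T ^^ (k * j)) z" if "i < j" for i j z
    using that by (simp add: funpow_add_apply diff_mult_distrib2)
  moreover have len: "1 \<le> k * (j - i) \<and> k * (j - i) \<le> k * q" if "i < j" "j < q" for i j
    using that k by auto
  ultimately show ?thesis
  proof cases
    case rep
    then obtain z where z: "z \<in> Z" "\<not> distinct (path z)" by blast
    then obtain i j where ij: "i < j" "j < q" "s z i = s z j"
      unfolding distinct_conv_nth path_def by (auto simp: nat_neq_iff)
    show ?thesis
      using ij len[OF ij(1,2)] loop[OF ij(1), of z] funpow_in_invariant[OF Z z(1), of "k * i"]
      by (intro bexI[of _ "(T ^^ (k * i)) z"] exI[of _ "k * (j - i)"]) (auto simp: s_def)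
  next
    case two
    then obtain z z' where z: "z \<in> Z" "z' \<in> Z" "u = path z" "v = path z'" by blast
    obtain i j i' j' where ij: "i < j" "j < q" "i' < j'" "j' < q" "s z i = s z' j'" "s z j = s z' i'"
      using reversed_pair[OF two(3,4) _ _ two(5,6), of q] unfolding z(3,4) by (auto simp: path_def)
    show ?thesis
      using ij len[OF ij(1,2)] len[OF ij(3,4)] loop[OF ij(1), of z] loop[OF ij(3), of z']
        funpow_in_invariant[OF Z z(1), of "k * i"] funpow_in_invariant[OF Z z(2), of "k * i'"]
      by (intro bexI[of _ "(T ^^ (k * i)) z"] bexI[of _ "(T ^^ (k * i')) z'"]
          exI[of _ "k * (j - i)"] exI[of _ "k * (j' - i')"]) (auto simp: s_def)
  qed
qed

context expanding_system begin

lemma two_jump_shadowing: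
  assumes Z: "T ` Z \<subseteq> Z" "a \<in> Z" "b \<in> Z" and m: "1 \<le> m" "1 \<le> n"
    and e: "4 * e < \<delta> * (1 - \<kappa>)" "0 \<le> e"
    and ab: "dist ((T ^^ m) a) b \<le> e" "dist ((T ^^ n) b) a \<le> e"
  shows "\<exists>y. (T ^^ (m + n)) y = y \<and> (\<forall>i<m + n. infdist ((T ^^ i) y) Z \<le> e / (1 - \<kappa>))"
proof -
  define x where "x i = (if i < m then (T ^^ i) a else if i < m + n then (T ^^ (i - m)) b else a)" for i
  have xZ: "x i \<in> Z" for i using funpow_in_invariant[OF Z(1)] Z(2,3) by (simp add: x_def)
  have "\<exists>y. (T ^^ (m + n)) y = y \<and> (\<forall>i\<le>m + n. dist ((T ^^ i) y) (x i) \<le> e / (1 - \<kappa>))"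
  proof (rule periodic_shadowing[OF e(1) refl e(2)])
    fix i assume i: "i < m + n"
    consider "Suc i < m" | "Suc i = m" | "m \<le> i" "Suc i < m + n" | "m \<le> i" "Suc i = m + n"
      using i by linarith
    then show "dist (T (x i)) (x (Suc i)) \<le> e"
    proof cases
      case 2
      then have "T (x i) = (T ^^ m) a" by (auto simp: x_def)
      then show ?thesis using 2 m ab(1) by (simp add: x_def)
    next
      case 3
      then show ?thesis using e(2) by (simp add: x_def Suc_diff_le)
    next
      case 4
      then have "n = Suc (i - m)" by simp
      then have "T (x i) = (T ^^ n) b" using 4 i by (simp add: x_def)
      then show ?thesis using 4 ab(2) by (simp add: x_def)
    qed (use e(2) in \<open>simp add: x_def\<close>)
  qed (use m in \<open>auto simp: x_def\<close>)
  then show ?thesis using xZ by (meson infdist_le2 less_imp_le)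
qed

lemma itinerary_eq_imp_close:
  assumes c: "\<And>x y. c x = c y \<Longrightarrow> dist x y < \<delta>" and k: "1 \<le> k"
    and eq: "itinerary T c k x = itinerary T c k y"
  shows "dist x y \<le> \<kappa> ^ (k - 1) * \<delta>"
proof -
  have near: "dist ((T ^^ i) x) ((T ^^ i) y) < \<delta>" if "i \<le> k - 1" for i
  proof (rule c)
    have "i < k" using that k by simp
    then show "c ((T ^^ i) x) = c ((T ^^ i) y)" using eq by (auto simp: itinerary_def)
  qed
  have "dist ((T ^^ 0) x) ((T ^^ 0) y) \<le> \<kappa> ^ (k - 1 - 0) * dist ((T ^^ (k - 1)) x) ((T ^^ (k - 1)) y)"
    by (rule expand_iterate) (use near in auto)
  also have "\<dots> \<le> \<kappa> ^ (k - 1 - 0) * \<delta>" using near[of "k - 1"] \<kappa>_pos by (intro mult_left_mono) auto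
  finally show ?thesis by simp
qed

lemma small_coding:
  assumes "0 < r"
  obtains c :: "'a \<Rightarrow> 'a" and F where "finite F" "\<And>x. c x \<in> F" "\<And>x y. c x = c y \<Longrightarrow> dist x y < r"
proof -
  obtain F :: "'a set" where F: "finite F" "\<And>x. \<exists>c\<in>F. dist c x < r / 2"
    using finite_cover[of "r / 2"] assms by auto
  then obtain c where c: "\<And>x. c x \<in> F" "\<And>x. dist (c x) x < r / 2" by metis
  have "dist x y < r" if "c x = c y" for x y
    using dist_triangle3[of x y "c x"] c(2)[of x] c(2)[of y] that by simp
  then show ?thesis using that F(1) c(1) by blast
qed

text \<open>The argument of Bressaud and Quas. Let \<open>h\<close> be the exponential growth rate of the number \<open>w n\<close> of
  itineraries of \<open>Z\<close>. Then \<open>w k \<le> exp (k (h + \<eta>))\<close> for large \<open>k\<close>, whereas \<open>w (k q) \<ge> exp (k q h)\<close> always. As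
  \<open>w k choose q \<le> (w k)^q / q!\<close>, a number \<open>q\<close> of order \<open>exp (k \<eta>)\<close> suffices for a short cycle. Its period is of
  order \<open>k exp (k \<eta>)\<close>, while its jumps are of size \<open>\<kappa>^k\<close>; so \<open>\<eta>\<close> is chosen such that \<open>\<kappa>\<close> is a high power
  of \<open>exp (- \<eta>)\<close>.\<close>

lemma superpolynomial_approximation:
  assumes Z: "T ` Z \<subseteq> Z" "Z \<noteq> {}" and c0: "0 < c0"
  shows "\<exists>y p. 1 \<le> p \<and> (T ^^ p) y = y \<and> orbit_sum T (\<lambda>x. infdist x Z) p y * real p ^ a \<le> c0"
proof -
  obtain c :: "'a \<Rightarrow> 'a" and F where c: "\<And>x. c x \<in> F" "finite F" "\<And>x y. c x = c y \<Longrightarrow> dist x y < \<delta>"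
    using small_coding[OF \<delta>_pos] by metis
  define w where "w n = card (itinerary T c n ` Z)" for n
  have fin: "finite (itinerary T c n ` Z)" for n by (rule finite_itineraries[OF c(1,2)])
  have w1: "1 \<le> w n" for n
    using fin[of n] Z(2) by (simp add: w_def Suc_le_eq card_gt_0_iff)
  have w_mult: "w (m + n) \<le> w m * w n" for m n
  proof -
    have "itinerary T c (m + n) ` Z \<subseteq> (\<lambda>(u, v). u @ v) ` (itinerary T c m ` Z \<times> itinerary T c n ` Z)"
      using funpow_in_invariant[OF Z(1)] by (force simp: itinerary_add)
    then have "w (m + n) \<le> card ((\<lambda>(u, v). u @ v) ` (itinerary T c m ` Z \<times> itinerary T c n ` Z))"
      unfolding w_def using fin by (intro card_mono) auto
    also have "\<dots> \<le> w m * w n"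
      unfolding w_def using card_image_le[of "itinerary T c m ` Z \<times> itinerary T c n ` Z"] fin
      by (simp add: card_cartesian_product)
    finally show ?thesis .
  qed
  have "\<exists>h. (\<lambda>n. ln (real (w n)) / real n) \<longlonglongrightarrow> h \<and> (\<forall>n. real n * h \<le> ln (real (w n)))"
  proof (rule fekete)
    show "0 \<le> ln (real (w n))" for n using w1[of n] by simp
    show "ln (real (w (m + n))) \<le> ln (real (w m)) + ln (real (w n))" for m n
    proof -
      have "ln (real (w (m + n))) \<le> ln (real (w m * w n))"
        using w_mult[of m n] w1[of "m + n"] by (intro ln_mono) (auto simp del: of_nat_mult)
      then show ?thesis using w1[of m] w1[of n] by (simp add: ln_mult)
    qed
  qed
  then obtain h where h: "(\<lambda>n. ln (real (w n)) / real n) \<longlonglongrightarrow> h" "\<And>n. real n * h \<le> ln (real (w n))"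
    by blast
  define \<eta> where "\<eta> = - ln \<kappa> / (2 * real (a + 1))"
  have \<eta>: "0 < \<eta>" using ln_less_zero[OF \<kappa>_pos \<kappa>_less_1] unfolding \<eta>_def by (intro divide_pos_pos) auto
  have \<kappa>_eq: "\<kappa> = exp (- \<eta>) ^ (2 * (a + 1))"
  proof -
    have "exp (- \<eta>) ^ (2 * (a + 1)) = exp (real (2 * (a + 1)) * - \<eta>)" by (rule exp_of_nat_mult[symmetric])
    also have "real (2 * (a + 1)) * - \<eta> = ln \<kappa>" by (simp add: \<eta>_def field_simps)
    finally show ?thesis using \<kappa>_pos by simp
  qed
  define D where "D = \<delta> / (\<kappa> * (1 - \<kappa>))"
  \<comment> \<open>A word length at which the complexity is close to its exponential rate and at which all
    error terms are small.\<close>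
  have ev1: "\<forall>\<^sub>F k in sequentially. ln (real (w k)) / real k < h + \<eta>"
    using h(1) \<eta> by (intro order_tendstoD(2)) auto
  have "(\<lambda>k. (10 * (real k * exp (- \<eta>) ^ k)) ^ (a + 1) * D) \<longlonglongrightarrow> (10 * 0) ^ (a + 1) * D"
    using powser_times_n_limit_0[of "exp (- \<eta>)"] \<eta> by (intro tendsto_intros) simp
  then have ev2: "\<forall>\<^sub>F k in sequentially. (10 * (real k * exp (- \<eta>) ^ k)) ^ (a + 1) * D < c0"
    using c0 by (intro order_tendstoD(2)) auto
  have "(\<lambda>k. 4 * \<delta> / \<kappa> * \<kappa> ^ k) \<longlonglongrightarrow> 4 * \<delta> / \<kappa> * 0"
    using \<kappa>_pos \<kappa>_less_1 by (intro tendsto_intros LIMSEQ_power_zero) auto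
  then have ev3: "\<forall>\<^sub>F k in sequentially. 4 * \<delta> / \<kappa> * \<kappa> ^ k < \<delta> * (1 - \<kappa>)"
    using \<delta>_pos \<kappa>_less_1 by (intro order_tendstoD(2)) auto
  have "\<forall>\<^sub>F k in sequentially. 1 \<le> (k::nat)" by (rule eventually_ge_at_top)
  with ev1 ev2 ev3 have "\<forall>\<^sub>F k in sequentially. 1 \<le> k \<and> ln (real (w k)) / real k < h + \<eta> \<and>
      (10 * (real k * exp (- \<eta>) ^ k)) ^ (a + 1) * D < c0 \<and> 4 * \<delta> / \<kappa> * \<kappa> ^ k < \<delta> * (1 - \<kappa>)"
    by eventually_elim auto
  then obtain k where k: "1 \<le> k" "ln (real (w k)) / real k < h + \<eta>"
    "(10 * (real k * exp (- \<eta>) ^ k)) ^ (a + 1) * D < c0" "4 * \<delta> / \<kappa> * \<kappa> ^ k < \<delta> * (1 - \<kappa>)"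
    using eventually_happens by (metis (no_types, lifting) sequentially_bot)
  define X where "X = exp (real k * \<eta>)"
  have X1: "1 \<le> X" using \<eta> by (simp add: X_def)
  \<comment> \<open>Any factor above the base of the natural logarithm makes \<open>q!\<close> exceed \<open>X ^ q\<close>.\<close>
  define q where "q = nat \<lceil>4 * X\<rceil>"
  have q: "4 * X \<le> real q" "real q \<le> 5 * X" using X1 unfolding q_def by linarith+
  have q1: "1 \<le> q" using q(1) X1 by linarith
  have kp: "\<kappa> ^ k = \<kappa> * \<kappa> ^ (k - 1)" using k(1) by (metis One_nat_def Suc_pred' power_Suc less_eq_Suc_le)
  have "card (itinerary T c k ` Z) choose q < card (itinerary T c (k * q) ` Z)"
  proof -
    have "ln (real (w k)) < real k * (h + \<eta>)" using k(1,2) by (simp add: divide_less_eq mult.commute)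
    then have "real (w k) < exp (real k * (h + \<eta>))" using w1[of k] by (subst ln_less_cancel_iff[symmetric]) auto
    then have "real (w k) \<le> exp (real k * h) * X" by (simp add: X_def exp_add[symmetric] algebra_simps)
    then have "real (w k) ^ q \<le> (exp (real k * h) * X) ^ q" by (intro power_mono) auto
    also have "\<dots> = exp (real (k * q) * h) * X ^ q"
      by (simp add: power_mult_distrib exp_of_nat_mult[symmetric] algebra_simps)
    also have "\<dots> \<le> real (w (k * q)) * X ^ q"
      using h(2)[of "k * q"] w1[of "k * q"] X1
      by (intro mult_right_mono) (auto simp del: of_nat_mult simp flip: ln_ge_iff)
    finally have 1: "real (w k) ^ q \<le> real (w (k * q)) * X ^ q" .
    have "3 ^ q * X ^ q < 4 ^ q * X ^ q" using q1 X1 by (intro mult_strict_right_mono power_strict_mono) auto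
    also have "\<dots> = (4 * X) ^ q" by (simp add: power_mult_distrib)
    also have "\<dots> \<le> real q ^ q" using q(1) X1 by (intro power_mono) auto
    also have "\<dots> \<le> fact q * exp (real q)" by (rule fact_lower)
    also have "exp (real q) = exp 1 ^ q" using exp_of_nat_mult[of q "1::real"] by simp
    also have "fact q * exp 1 ^ q \<le> fact q * (3::real) ^ q"
      using exp_le by (intro mult_left_mono power_mono) auto
    finally have 2: "X ^ q < fact q" by (simp add: mult.commute)
    have "real (w k choose q) * fact q \<le> real (w k) ^ q"
      using binomial_fact_pow[of "w k" q] by (metis of_nat_fact of_nat_le_iff of_nat_mult of_nat_power)
    also note 1
    also have "real (w (k * q)) * X ^ q < real (w (k * q)) * fact q"
      using 2 w1[of "k * q"] by (intro mult_strict_left_mono) auto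
    finally have "real (w k choose q) < real (w (k * q))" by (simp add: mult_less_cancel_right)
    then show ?thesis by (simp add: w_def)
  qed
  then obtain x b m n where cyc: "x \<in> Z" "b \<in> Z" "1 \<le> m" "m \<le> k * q" "1 \<le> n" "n \<le> k * q"
    "itinerary T c k ((T ^^ m) x) = itinerary T c k b" "itinerary T c k ((T ^^ n) b) = itinerary T c k x"
    using short_cycle[where c = c, OF c(1,2) Z(1) k(1)] by blast
  define e where "e = \<kappa> ^ (k - 1) * \<delta>"
  have e: "4 * e < \<delta> * (1 - \<kappa>)" "0 \<le> e" using k(4) kp \<kappa>_pos \<delta>_pos by (auto simp: e_def mult.commute)
  define p where "p = m + n"
  obtain y where y: "(T ^^ p) y = y" "\<And>i. i < p \<Longrightarrow> infdist ((T ^^ i) y) Z \<le> e / (1 - \<kappa>)"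
    unfolding p_def
    using two_jump_shadowing[OF Z(1) cyc(1,2,3,5) e] itinerary_eq_imp_close[OF c(3) k(1)] cyc(7,8)
    unfolding e_def by blast
  have p: "1 \<le> p" "real p \<le> 10 * (real k * X)"
  proof -
    have "real p \<le> real (2 * (k * q))" unfolding p_def using cyc by (simp only: of_nat_le_iff)
    also have "\<dots> = 2 * real k * real q" by simp
    also have "\<dots> \<le> 2 * real k * (5 * X)" using q(2) by (intro mult_left_mono) auto
    finally show "real p \<le> 10 * (real k * X)" by simp
  qed (use cyc in \<open>simp add: p_def\<close>)
  have "orbit_sum T (\<lambda>x. infdist x Z) p y \<le> (\<Sum>i<p. e / (1 - \<kappa>))"
    unfolding orbit_sum_def using y(2) by (intro sum_mono) auto
  then have "orbit_sum T (\<lambda>x. infdist x Z) p y * real p ^ a \<le> real p * (e / (1 - \<kappa>)) * real p ^ a"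
    by (intro mult_right_mono) auto
  also have "\<dots> = real p ^ (a + 1) * (e / (1 - \<kappa>))" by simp
  also have "\<dots> \<le> (10 * (real k * X)) ^ (a + 1) * (e / (1 - \<kappa>))"
    using p e(2) \<kappa>_less_1 by (intro mult_right_mono power_mono) auto
  also have "e / (1 - \<kappa>) = (exp (- \<eta>) ^ k) ^ (2 * (a + 1)) * D"
  proof -
    have "e / (1 - \<kappa>) = \<kappa> ^ k * D" using \<kappa>_pos kp by (simp add: e_def D_def)
    also have "\<kappa> ^ k = (exp (- \<eta>) ^ k) ^ (2 * (a + 1))"
      by (subst \<kappa>_eq) (simp only: power_mult[symmetric] mult.commute)
    finally show ?thesis .
  qed
  also have "(10 * (real k * X)) ^ (a + 1) * ((exp (- \<eta>) ^ k) ^ (2 * (a + 1)) * D) =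
      (10 * (real k * X) * (exp (- \<eta>) ^ k)\<^sup>2) ^ (a + 1) * D"
    by (simp only: power_mult power_mult_distrib mult.assoc)
  also have "10 * (real k * X) * (exp (- \<eta>) ^ k)\<^sup>2 = 10 * (real k * exp (- \<eta>) ^ k)"
  proof -
    have "X * exp (- \<eta>) ^ k = 1"
      unfolding exp_of_nat_mult[symmetric] X_def exp_add[symmetric] by simp
    then show ?thesis by (simp add: power2_eq_square mult_ac)
  qed
  finally have "orbit_sum T (\<lambda>x. infdist x Z) p y * real p ^ a \<le> c0" using k(3) by linarith
  then show ?thesis using p(1) y(1) by blast
qed

text \<open>The orbit has minimal period among those with \<open>E p y * p ^ a \<le> c\<close>, where \<open>E\<close> is the sum of the distances to \<open>Z\<close>.
  The exponent \<open>a\<close> is so large that halving the period outweighs the factor \<open>1 + C / \<tau>\<close> by which \<open>E\<close>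
  grows when a loop is cut off and closed.\<close>

lemma tight_periodic_orbit:
  assumes Z: "T ` Z \<subseteq> Z" "Z \<noteq> {}" and \<tau>: "0 < \<tau>" and \<Delta>0: "0 < \<Delta>0"
  shows "\<exists>y p \<Delta>. 1 \<le> p \<and> (T ^^ p) y = y \<and> 0 < \<Delta> \<and> \<Delta> \<le> \<Delta>0 \<and>
    (\<forall>i j. i < j \<longrightarrow> j < p \<longrightarrow> \<Delta> \<le> dist ((T ^^ i) y) ((T ^^ j) y)) \<and>
    orbit_sum T (\<lambda>x. infdist x Z) p y \<le> \<tau> * \<Delta>"
proof -
  define E where "E p y = orbit_sum T (\<lambda>x. infdist x Z) p y" for p y
  define C where "C = 1 / (1 - \<kappa>)\<^sup>2"
  have C0: "0 < C" using \<kappa>_less_1 by (simp add: C_def)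
  have E0: "0 \<le> E p y" for p y by (simp add: E_def orbit_sum_def sum_nonneg infdist_nonneg)
  obtain a :: nat where a: "1 + C / \<tau> < 2 ^ a" using real_arch_pow[of 2 "1 + C / \<tau>"] by auto
  define c where "c = min (\<tau> * \<Delta>0) (\<tau> * (\<delta> * (1 - \<kappa>) / 8))"
  have c0: "0 < c" using \<tau> \<Delta>0 \<delta>_pos \<kappa>_less_1 by (simp add: c_def)
  define good where "good p y \<longleftrightarrow> 1 \<le> p \<and> (T ^^ p) y = y \<and> E p y * real p ^ a \<le> c" for p y
  have "\<exists>p y. good p y"
    using superpolynomial_approximation[OF Z c0, of a] unfolding good_def E_def by blast
  then obtain p y where gd: "good p y" and min: "\<And>m z. m < p \<Longrightarrow> \<not> good m z"
    using exists_least_iff[of "\<lambda>p. \<exists>y. good p y"] by blast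
  have p: "1 \<le> p" "(T ^^ p) y = y" "E p y * real p ^ a \<le> c" using gd by (auto simp: good_def)
  have "E p y * 1 \<le> E p y * real p ^ a" using p(1) E0 by (intro mult_left_mono one_le_power) auto
  then have Ec: "E p y \<le> c" using p(3) by linarith
  \<comment> \<open>Two points of the orbit that are too close cut it into two loops. Closing the shorter loop
    halves the period at the price of a bounded factor in the distance to \<open>Z\<close>.\<close>
  have shortcut: False if z: "E p z = E p y" "(T ^^ m) z = z'" "1 \<le> m" "2 * m \<le> p" "\<tau> * dist z' z \<le> E p y" for z z' m
  proof -
    define d where "d = dist ((T ^^ m) z) z"
    have d: "\<tau> * d \<le> E p y" using z by (simp add: d_def)
    have "\<tau> * d \<le> \<tau> * (\<delta> * (1 - \<kappa>) / 8)" using d Ec by (simp add: c_def)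
    then have "d \<le> \<delta> * (1 - \<kappa>) / 8" using \<tau> by simp
    moreover have "0 < \<delta> * (1 - \<kappa>)" using \<delta>_pos \<kappa>_less_1 by simp
    ultimately have "4 * d < \<delta> * (1 - \<kappa>)" by linarith
    then obtain x where x: "(T ^^ m) x = x" "(\<Sum>i<m. dist ((T ^^ i) x) ((T ^^ i) z)) \<le> d / (1 - \<kappa>)\<^sup>2"
      using closing[of m z] z(3) by (auto simp: d_def)
    have "1-lipschitz_on UNIV (\<lambda>x. infdist x Z)"
      by (rule lipschitz_onI) (auto simp: dist_real_def infdist_triangle_abs)
    from orbit_sum_dist_le[OF this, of T m x z] have "E m x \<le> E m z + C * d"
      using x(2) by (simp add: E_def C_def)
    also have "E m z + C * d \<le> E p z + C * d"
      unfolding E_def using z(3,4) by (intro add_right_mono orbit_sum_mono infdist_nonneg) auto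
    also have "E p z + C * d \<le> E p y + C * (E p y / \<tau>)"
      using z(1) d C0 \<tau> by (intro add_mono mult_left_mono) (auto simp: pos_le_divide_eq mult.commute)
    also have "\<dots> = (1 + C / \<tau>) * E p y" by (simp add: algebra_simps)
    also have "\<dots> \<le> 2 ^ a * E p y" using a E0 by (intro mult_right_mono) auto
    finally have "E m x * real m ^ a \<le> 2 ^ a * E p y * real m ^ a" by (rule mult_right_mono) simp
    also have "\<dots> = E p y * real (2 * m) ^ a" by (simp add: power_mult_distrib)
    also have "\<dots> \<le> E p y * real p ^ a" using z(4) E0 by (intro mult_left_mono power_mono) auto
    finally have "good m x" using p(3) x(1) z(3) by (simp add: good_def)
    then show False using min[of m x] z(3,4) by simp
  qed
  have gap: "E p y < \<tau> * dist ((T ^^ i) y) ((T ^^ j) y)" if ij: "i < j" "j < p" for i j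
  proof (rule ccontr)
    assume "\<not> ?thesis"
    then have le: "\<tau> * dist ((T ^^ i) y) ((T ^^ j) y) \<le> E p y" by simp
    have sh: "E p ((T ^^ l) y) = E p y" for l unfolding E_def by (rule orbit_sum_shift_period[OF p(2)])
    show False
    proof (cases "2 * (j - i) \<le> p")
      case True
      have loop: "(T ^^ (j - i)) ((T ^^ i) y) = (T ^^ j) y" using ij by (simp add: funpow_add_apply)
      then show False using shortcut[OF sh loop _ True] ij le by (simp add: dist_commute Suc_le_eq)
    next
      case False
      have "(T ^^ (p - (j - i))) ((T ^^ j) y) = (T ^^ (p + i)) y" using ij by (simp add: funpow_add_apply)
      also have "\<dots> = (T ^^ i) y" using funpow_add_apply[of i T p y] p(2) by simp
      finally have loop: "(T ^^ (p - (j - i))) ((T ^^ j) y) = (T ^^ i) y" .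
      have "1 \<le> p - (j - i)" "2 * (p - (j - i)) \<le> p" using False ij by linarith+
      then show False using shortcut[OF sh loop] le by blast
    qed
  qed
  define S where "S = insert \<Delta>0 ((\<lambda>(i, j). dist ((T ^^ i) y) ((T ^^ j) y)) ` {(i, j). i < j \<and> j < p})"
  have "{(i, j). i < j \<and> j < p} \<subseteq> {..<p} \<times> {..<p}" by auto
  then have "finite {(i, j). i < j \<and> j < p}" by (rule finite_subset) simp
  then have finS: "finite S" unfolding S_def by simp
  have S: "E p y \<le> \<tau> * s \<and> 0 < s" if "s \<in> S" for s
  proof -
    have "E p y \<le> \<tau> * \<Delta>0" using Ec by (simp add: c_def)
    moreover have "0 < dist ((T ^^ i) y) ((T ^^ j) y)" if "i < j" "j < p" for i j
      using gap[OF that] E0[of p y] zero_less_mult_pos[OF _ \<tau>, of "dist ((T ^^ i) y) ((T ^^ j) y)"] by linarith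
    ultimately show ?thesis using that \<Delta>0 gap by (auto simp: S_def intro: less_imp_le)
  qed
  have "Min S \<in> S" using finS by (intro Min_in) (auto simp: S_def)
  then show ?thesis
    using S[of "Min S"] p finS
    by (intro exI[of _ y] exI[of _ p] exI[of _ "Min S"]) (auto simp: E_def S_def intro!: Min_le)
qed

end

section \<open>Locking onto a periodic orbit\<close>

context expanding_system begin

lemma near_point_of_orbit:
  assumes "infdist x ((\<lambda>i. (T ^^ i) y) ` {..<p}) < r" "1 \<le> p"
  shows "\<exists>i<p. dist x ((T ^^ i) y) < r"
proof (rule ccontr)
  assume "\<not> ?thesis"
  then have "r \<le> dist x a" if "a \<in> (\<lambda>i. (T ^^ i) y) ` {..<p}" for a using that by force
  moreover have "0 \<in> {..<p}" using assms(2) by simp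
  then have "(\<lambda>i. (T ^^ i) y) ` {..<p} \<noteq> {}" by blast
  ultimately have "r \<le> infdist x ((\<lambda>i. (T ^^ i) y) ` {..<p})"
    by (simp add: infdist_notempty cINF_greatest)
  then show False using assms(1) by simp
qed

lemma periodic_mod: "(T ^^ p) y = y \<Longrightarrow> (T ^^ i) y = (T ^^ (i mod p)) y"
proof -
  assume p: "(T ^^ p) y = y"
  have "(T ^^ (k * p)) y = y" for k
    by (induction k) (use p in \<open>simp_all add: funpow_add\<close>)
  then show ?thesis using funpow_add_apply[of "i mod p" T "i div p * p" y] by simp
qed

text \<open>Near the orbit the phase is determined: \<open>T\<close> moves a point at distance \<open>r\<close> by at most \<open>L * r\<close> away from the
  image of its companion, which is too little to come close to another point of the orbit.\<close>

lemma follows_orbit: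
  assumes p: "1 \<le> p" "(T ^^ p) y = y"
    and gap: "\<And>i j. i < j \<Longrightarrow> j < p \<Longrightarrow> \<Delta> \<le> dist ((T ^^ i) y) ((T ^^ j) y)"
    and r: "(L + 1) * r < \<Delta>"
    and near: "\<And>i. i < m \<Longrightarrow> infdist ((T ^^ i) x) ((\<lambda>i. (T ^^ i) y) ` {..<p}) < r"
  shows "\<exists>s. \<forall>i<m. dist ((T ^^ i) x) ((T ^^ i) ((T ^^ s) y)) < r"
proof (cases "m = 0")
  case False
  have eq: "a = b" if ab: "a \<in> range (\<lambda>i. (T ^^ i) y)" "b \<in> range (\<lambda>i. (T ^^ i) y)" "dist a b < \<Delta>" for a b
  proof -
    obtain i j where "a = (T ^^ i) y" "b = (T ^^ j) y" using ab by blast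
    then have ij: "a = (T ^^ (i mod p)) y" "b = (T ^^ (j mod p)) y" using periodic_mod[OF p(2)] by metis+
    have lt: "i mod p < p" "j mod p < p" using p(1) by auto
    consider "i mod p < j mod p" | "i mod p = j mod p" | "j mod p < i mod p" by linarith
    then show ?thesis
      by cases (use ij gap[of "i mod p" "j mod p"] gap[of "j mod p" "i mod p"] lt ab(3)
        in \<open>auto simp: dist_commute\<close>)
  qed
  obtain s where s: "dist x ((T ^^ s) y) < r" using near_point_of_orbit[OF near[of 0]] p(1) False by auto
  have "dist ((T ^^ i) x) ((T ^^ i) ((T ^^ s) y)) < r" if "i < m" for i
    using that
  proof (induction i)
    case (Suc i)
    let ?q = "(T ^^ Suc i) ((T ^^ s) y)"
    have "dist ((T ^^ Suc i) x) ?q \<le> L * dist ((T ^^ i) x) ((T ^^ i) ((T ^^ s) y))" using T_lip by simp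
    also have "\<dots> \<le> L * r" using Suc L_ge_1 by (intro mult_left_mono) auto
    finally have 1: "dist ((T ^^ Suc i) x) ?q \<le> L * r" .
    obtain j where j: "dist ((T ^^ Suc i) x) ((T ^^ j) y) < r"
      using near_point_of_orbit[OF near[OF Suc.prems] p(1)] by blast
    have "dist ((T ^^ j) y) ?q \<le> dist ((T ^^ Suc i) x) ((T ^^ j) y) + dist ((T ^^ Suc i) x) ?q"
      by (rule dist_triangle3)
    also have "\<dots> < \<Delta>" using 1 j r by (simp add: algebra_simps)
    finally have lt: "dist ((T ^^ j) y) ?q < \<Delta>" .
    have "?q \<in> range (\<lambda>i. (T ^^ i) y)" unfolding funpow_add_apply by (rule rangeI)
    then have "(T ^^ j) y = ?q" using lt by (intro eq) auto
    then show ?case using j by simp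
  qed (use s in simp)
  then show ?thesis by blast
qed simp

text \<open>While an orbit stays near the periodic orbit, complete periods contribute the mean \<open>A\<close> and an
  incomplete one contributes little, since \<open>g\<close> is almost \<open>0\<close> on the periodic orbit. The parameter \<open>j\<close> is
  the number of final steps that are estimated separately: they cost \<open>j * (K * E)\<close>, and the
  earlier ones only a multiple of \<open>\<kappa> ^ j\<close>.\<close>

lemma orbit_sum_near_orbit:
  assumes g: "K-lipschitz_on UNIV g" "\<And>x. g x \<le> 0" and h: "\<eta>-lipschitz_on UNIV h" "\<And>x. \<bar>h x\<bar> \<le> \<eta>"
    and K: "0 \<le> K"
    and p: "1 \<le> p" "(T ^^ p) y = y"
    and E: "0 \<le> E" "- K * E \<le> orbit_sum T g p y" "\<And>i. - K * E \<le> g ((T ^^ i) y)"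
    and r: "0 < r" "r < \<delta>"
    and near: "\<And>i. i < m \<Longrightarrow> dist ((T ^^ i) x) ((T ^^ i) ((T ^^ s) y)) < r"
    and A: "A = orbit_sum T (\<lambda>x. g x + h x) p y / real p"
  shows "orbit_sum T (\<lambda>x. g x + h x) m x - real m * A \<le>
    (real j + 1) * (K * E) + 2 * real p * \<eta> + \<eta> * (r / (1 - \<kappa>)) + K * (\<kappa> ^ j * (r / (1 - \<kappa>)))"
proof -
  define q where "q = (T ^^ s) y"
  have \<eta>0: "0 \<le> \<eta>" using h(1) lipschitz_on_nonneg by blast
  have qp: "(T ^^ p) q = q"
    unfolding q_def using p(2) funpow_add_apply[of p T s y] funpow_add_apply[of s T p y] by (simp add: add.commute)
  have KE: "0 \<le> K * E" using K E(1) by simp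
  have close: "dist ((T ^^ i) x) ((T ^^ i) q) \<le> \<kappa> ^ (m - Suc i) * r" if "i < m" for i
  proof -
    have "dist ((T ^^ i) x) ((T ^^ i) q) \<le> \<kappa> ^ (m - 1 - i) * dist ((T ^^ (m - 1)) x) ((T ^^ (m - 1)) q)"
    proof (rule expand_iterate)
      fix l assume "l \<le> m - 1"
      then have "l < m" using that by linarith
      then show "dist ((T ^^ l) x) ((T ^^ l) q) < \<delta>" using near[of l] r by (simp add: q_def)
    qed (use that in simp)
    also have "\<dots> \<le> \<kappa> ^ (m - 1 - i) * r"
      using near[of "m - 1"] that \<kappa>_pos by (intro mult_left_mono) (auto simp: q_def)
    finally show ?thesis by simp
  qed
  have geo: "(\<Sum>i<n. \<kappa> ^ (n - Suc i) * r) \<le> r / (1 - \<kappa>)" for n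
    using mult_right_mono[OF sum_geometric_rev_le[of \<kappa> n], of r] \<kappa>_pos \<kappa>_less_1 r(1)
    by (simp add: sum_distrib_right)
  have hsum: "orbit_sum T h m x \<le> orbit_sum T h m q + \<eta> * (r / (1 - \<kappa>))"
  proof -
    have "(\<Sum>i<m. dist ((T ^^ i) x) ((T ^^ i) q)) \<le> (\<Sum>i<m. \<kappa> ^ (m - Suc i) * r)"
      by (intro sum_mono close) simp
    also have "\<dots> \<le> r / (1 - \<kappa>)" by (rule geo)
    finally have "\<eta> * (\<Sum>i<m. dist ((T ^^ i) x) ((T ^^ i) q)) \<le> \<eta> * (r / (1 - \<kappa>))"
      using \<eta>0 by (rule mult_left_mono)
    then show ?thesis using orbit_sum_dist_le[OF h(1), of T m x q] by linarith
  qed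
  \<comment> \<open>Except for the last \<open>j\<close> steps the distance to the orbit is exponentially small; in the
    last \<open>j\<close> steps \<open>g \<le> 0\<close> while \<open>g\<close> is almost \<open>0\<close> on the orbit.\<close>
  have gsum: "orbit_sum T g m x \<le> orbit_sum T g m q + real j * (K * E) + K * (\<kappa> ^ j * (r / (1 - \<kappa>)))"
  proof -
    define m' where "m' = m - j"
    have m: "m = m' + (m - m')" and mm: "real (m - m') \<le> real j" by (auto simp: m'_def)
    have "(\<Sum>i<m'. dist ((T ^^ i) x) ((T ^^ i) q)) \<le> (\<Sum>i<m'. \<kappa> ^ j * (\<kappa> ^ (m' - Suc i) * r))"
    proof (rule sum_mono)
      fix i assume i: "i \<in> {..<m'}"
      then have e: "m - Suc i = j + (m' - Suc i)" by (auto simp: m'_def)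
      have "dist ((T ^^ i) x) ((T ^^ i) q) \<le> \<kappa> ^ (m - Suc i) * r" using close[of i] i by (auto simp: m'_def)
      then show "dist ((T ^^ i) x) ((T ^^ i) q) \<le> \<kappa> ^ j * (\<kappa> ^ (m' - Suc i) * r)"
        unfolding e by (simp add: power_add mult.assoc)
    qed
    also have "\<dots> = \<kappa> ^ j * (\<Sum>i<m'. \<kappa> ^ (m' - Suc i) * r)" by (simp add: sum_distrib_left)
    also have "\<dots> \<le> \<kappa> ^ j * (r / (1 - \<kappa>))" using geo \<kappa>_pos by (intro mult_left_mono) auto
    finally have "K * (\<Sum>i<m'. dist ((T ^^ i) x) ((T ^^ i) q)) \<le> K * (\<kappa> ^ j * (r / (1 - \<kappa>)))"
      using K by (rule mult_left_mono)
    then have 1: "orbit_sum T g m' x \<le> orbit_sum T g m' q + K * (\<kappa> ^ j * (r / (1 - \<kappa>)))"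
      using orbit_sum_dist_le[OF g(1), of T m' x q] by linarith
    have 2: "orbit_sum T g n z \<le> 0" for n z unfolding orbit_sum_def using g(2) by (simp add: sum_nonpos)
    have "(\<Sum>i<n. - K * E) \<le> orbit_sum T g n ((T ^^ l) q)" for n l
      unfolding orbit_sum_def q_def funpow_add_apply by (intro sum_mono E(3))
    from this[of "m - m'" m'] have 3: "- (real (m - m') * (K * E)) \<le> orbit_sum T g (m - m') ((T ^^ m') q)" by simp
    have 4: "real (m - m') * (K * E) \<le> real j * (K * E)" using mm KE by (rule mult_right_mono)
    have "orbit_sum T g m x = orbit_sum T g m' x + orbit_sum T g (m - m') ((T ^^ m') x)"
      "orbit_sum T g m q = orbit_sum T g m' q + orbit_sum T g (m - m') ((T ^^ m') q)"
      using orbit_sum_add[of T g m' "m - m'"] m by metis+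
    then show ?thesis using 1 2[of "m - m'" "(T ^^ m') x"] 3 4 by linarith
  qed
  define \<phi> where "\<phi> = (\<lambda>x. g x + h x)"
  have \<phi>: "orbit_sum T \<phi> n z = orbit_sum T g n z + orbit_sum T h n z" for n z
    by (simp add: \<phi>_def orbit_sum_def sum.distrib)
  have pA: "real p * A = orbit_sum T \<phi> p q"
    using p(1) orbit_sum_shift_period[OF p(2), of \<phi> s] by (simp add: A \<phi>_def q_def)
  have rest: "orbit_sum T \<phi> m q - real m * A \<le> K * E + 2 * real p * \<eta>"
  proof -
    define k l where "k = m div p" and "l = m mod p"
    have m: "m = k * p + l" by (simp add: k_def l_def)
    have l: "real l \<le> real p" using p(1) by (simp add: l_def less_imp_le)
    have Tk: "(T ^^ (k * p)) q = q" by (induction k) (use qp in \<open>simp_all add: funpow_add\<close>)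
    have "orbit_sum T \<phi> m q = real k * orbit_sum T \<phi> p q + orbit_sum T \<phi> l q"
      unfolding m orbit_sum_add Tk by (simp add: orbit_sum_periods[OF qp])
    then have "orbit_sum T \<phi> m q - real m * A = orbit_sum T \<phi> l q - real l * A"
      unfolding pA[symmetric] m by (simp add: algebra_simps)
    also have "orbit_sum T \<phi> l q \<le> real l * \<eta>"
    proof -
      have "orbit_sum T g l q \<le> 0" unfolding orbit_sum_def using g(2) by (simp add: sum_nonpos)
      moreover have "\<bar>orbit_sum T h l q\<bar> \<le> real l * \<eta>" by (rule orbit_sum_abs_le[OF h(2)])
      ultimately show ?thesis unfolding \<phi> by linarith
    qed
    also have "real l * \<eta> - real l * A \<le> K * E + 2 * real p * \<eta>"
    proof -
      have "real p * A = orbit_sum T g p y + orbit_sum T h p y" using p(1) by (simp add: A \<phi>[unfolded \<phi>_def])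
      moreover have "\<bar>orbit_sum T h p y\<bar> \<le> real p * \<eta>" by (rule orbit_sum_abs_le[OF h(2)])
      ultimately have pA': "- (K * E) - real p * \<eta> \<le> real p * A" using E(2) by simp
      have "real l * (- (K * E) - real p * \<eta>) \<le> real l * (real p * A)" using pA' by (rule mult_left_mono) simp
      then have "real p * - (real l * A) \<le> real l * (K * E + real p * \<eta>)" by (simp add: algebra_simps)
      also have "\<dots> \<le> real p * (K * E + real p * \<eta>)" using l KE \<eta>0 by (intro mult_right_mono) auto
      finally have "- (real l * A) \<le> K * E + real p * \<eta>" by (rule mult_left_le_imp_le) (use p(1) in simp)
      moreover have "real l * \<eta> \<le> real p * \<eta>" using l \<eta>0 by (rule mult_right_mono)
      ultimately show ?thesis by linarith
    qed
    finally show ?thesis by simp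
  qed
  have "orbit_sum T \<phi> m x \<le> orbit_sum T \<phi> m q + \<eta> * (r / (1 - \<kappa>)) + real j * (K * E) + K * (\<kappa> ^ j * (r / (1 - \<kappa>)))"
    unfolding \<phi> using hsum gsum by linarith
  then show ?thesis using rest unfolding \<phi>_def by (simp add: algebra_simps)
qed

text \<open>Each stay in \<open>N\<close> gains at most \<open>B\<close>, and this is lost again by the step outside \<open>N\<close> that ends it.\<close>

lemma orbit_sum_bounded_by_escape:
  fixes G :: "'a \<Rightarrow> real" and B :: real
  assumes near: "\<And>m x. (\<And>i. i < m \<Longrightarrow> (T ^^ i) x \<in> N) \<Longrightarrow> orbit_sum T G m x \<le> B"
    and far: "\<And>x. x \<notin> N \<Longrightarrow> G x \<le> - B" and "0 \<le> B"
  shows "orbit_sum T G n x \<le> B"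
proof (induction n arbitrary: x rule: less_induct)
  case (less n)
  show ?case
  proof (cases "\<forall>i<n. (T ^^ i) x \<in> N")
    case False
    then obtain m where m: "m < n" "(T ^^ m) x \<notin> N" and least: "\<And>i. i < m \<Longrightarrow> (T ^^ i) x \<in> N"
      using exists_least_iff[of "\<lambda>m. m < n \<and> (T ^^ m) x \<notin> N"] by (meson less_trans)
    have n: "n = m + (1 + (n - Suc m))" using m by simp
    have "orbit_sum T G n x = orbit_sum T G m x + (G ((T ^^ m) x) + orbit_sum T G (n - Suc m) ((T ^^ 1) ((T ^^ m) x)))"
      by (subst n, subst orbit_sum_add, subst orbit_sum_add) simp
    moreover have "orbit_sum T G m x \<le> B" using least by (rule near)
    moreover have "orbit_sum T G (n - Suc m) ((T ^^ 1) ((T ^^ m) x)) \<le> B" using m by (intro less.IH) simp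
    ultimately show ?thesis using far[OF m(2)] by linarith
  qed (use near in blast)
qed

text \<open>The number \<open>j\<close> and the tightness \<open>\<tau>\<close> depend on \<open>T\<close>, \<open>g\<close> and \<open>\<epsilon>\<close> only; then the orbit is chosen, and \<open>\<eta>\<close>
  last. With a radius \<open>r\<close> proportional to the gap \<open>\<Delta>\<close> of the orbit, a stay near the orbit gains at most \<open>\<epsilon> * r / 4\<close>, and each
  step away from it loses at least as much through the term \<open>\<epsilon> * infdist\<close>.\<close>

lemma locking:
  assumes g: "K-lipschitz_on UNIV g" "\<And>x. g x \<le> 0" and z: "\<And>n. g ((T ^^ n) z) = 0" and \<epsilon>: "0 < \<epsilon>"
  shows "\<exists>y p \<eta>. 1 \<le> p \<and> (T ^^ p) y = y \<and> 0 < \<eta> \<and>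
    (\<forall>h. \<eta>-lipschitz_on UNIV h \<longrightarrow> (\<forall>x. \<bar>h x\<bar> \<le> \<eta>) \<longrightarrow>
      (\<exists>B. \<forall>n x. orbit_sum T (\<lambda>x. g x - \<epsilon> * infdist x ((\<lambda>i. (T ^^ i) y) ` {..<p}) + h x) n x
        - real n * (orbit_sum T (\<lambda>x. g x + h x) p y / real p) \<le> B))"
proof -
  define K' where "K' = max K 1"
  have K': "K'-lipschitz_on UNIV g" "1 \<le> K'" using g(1) lipschitz_on_le[of K UNIV g K'] by (auto simp: K'_def)
  define Z where "Z = {z. \<forall>n. g ((T ^^ n) z) = 0}"
  have Z: "T ` Z \<subseteq> Z" "Z \<noteq> {}"
  proof -
    have "(T ^^ n) (T z) = (T ^^ Suc n) z" for n z using funpow_add_apply[of n T 1 z] by simp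
    then show "T ` Z \<subseteq> Z" unfolding Z_def by (auto simp del: funpow.simps)
    show "Z \<noteq> {}" using z by (auto simp: Z_def)
  qed
  have gZ: "- K' * infdist x Z \<le> g x" for x
  proof -
    have "- g x / K' \<le> infdist x Z"
    proof -
      have "- g x / K' \<le> dist x w" if "w \<in> Z" for w
      proof -
        have "g w = 0" using that by (auto simp: Z_def dest: spec[of _ 0])
        then have "- g x \<le> K' * dist x w" using lipschitz_onD[OF K'(1), of x w] by (simp add: dist_real_def)
        then show ?thesis using K'(2) by (subst pos_divide_le_eq) (auto simp: mult.commute)
      qed
      then show ?thesis using Z(2) by (simp add: infdist_notempty cINF_greatest)
    qed
    then have "- g x \<le> infdist x Z * K'" using K'(2) by (subst (asm) pos_divide_le_eq) auto
    then show ?thesis by (simp add: mult.commute)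
  qed
  define c1 where "c1 = 1 / (2 * (L + 1))"
  have c1: "0 < c1" "(L + 1) * c1 = 1 / 2" "c1 \<le> 1" using L_ge_1 by (auto simp: c1_def divide_simps)
  obtain j where j: "\<kappa> ^ j < \<epsilon> * (1 - \<kappa>) / (16 * K')"
    using real_arch_pow_inv[OF _ \<kappa>_less_1, of "\<epsilon> * (1 - \<kappa>) / (16 * K')"] \<epsilon> \<kappa>_less_1 K'(2) by auto
  define \<tau> where "\<tau> = \<epsilon> * c1 / 16 / ((real j + 1) * K')"
  have \<tau>: "0 < \<tau>" using \<epsilon> c1 K'(2) by (simp add: \<tau>_def)
  obtain y p \<Delta> where y: "1 \<le> p" "(T ^^ p) y = y" "0 < \<Delta>" "\<Delta> \<le> \<delta> / 2"
    and gap: "\<And>i j. i < j \<Longrightarrow> j < p \<Longrightarrow> \<Delta> \<le> dist ((T ^^ i) y) ((T ^^ j) y)"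
    and E_le: "orbit_sum T (\<lambda>x. infdist x Z) p y \<le> \<tau> * \<Delta>"
    using tight_periodic_orbit[OF Z \<tau>, of "\<delta> / 2"] \<delta>_pos by auto
  define E where "E = orbit_sum T (\<lambda>x. infdist x Z) p y"
  define Orb where "Orb = (\<lambda>i. (T ^^ i) y) ` {..<p}"
  define r where "r = c1 * \<Delta>"
  have r0: "0 < r" using c1 y(3) by (simp add: r_def)
  have "r \<le> 1 * \<Delta>" unfolding r_def using c1 y(3) by (intro mult_right_mono) auto
  then have r\<delta>: "r < \<delta>" using y(4) \<delta>_pos by simp
  have "(L + 1) * r = ((L + 1) * c1) * \<Delta>" by (simp add: r_def)
  then have rL: "(L + 1) * r < \<Delta>" using c1(2) y(3) by simp
  have E0: "0 \<le> E" by (simp add: E_def orbit_sum_def sum_nonneg infdist_nonneg)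
  have KE: "(real j + 1) * (K' * E) \<le> \<epsilon> * r / 16"
  proof -
    have "(real j + 1) * (K' * E) \<le> (real j + 1) * (K' * (\<tau> * \<Delta>))"
      using E_le K'(2) by (intro mult_left_mono) (auto simp: E_def)
    also have "\<dots> = ((real j + 1) * K') * \<tau> * \<Delta>" by (simp add: mult_ac)
    also have "((real j + 1) * K') * \<tau> = \<epsilon> * c1 / 16"
    proof -
      have "c * (x / c) = x" if "c \<noteq> 0" for c x :: real using that by simp
      then show ?thesis unfolding \<tau>_def using K'(2) by auto
    qed
    finally show ?thesis by (simp add: r_def mult_ac)
  qed
  have KE1: "K' * E \<le> (real j + 1) * (K' * E)" using E0 K'(2) mult_right_mono[of 1 "real j + 1" "K' * E"] by simp
  have Kj: "K' * (\<kappa> ^ j * (r / (1 - \<kappa>))) \<le> \<epsilon> * r / 16"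
  proof -
    have "K' * (\<kappa> ^ j * (r / (1 - \<kappa>))) \<le> K' * (\<epsilon> * (1 - \<kappa>) / (16 * K') * (r / (1 - \<kappa>)))"
      using j K'(2) r0 \<kappa>_less_1 by (intro mult_left_mono mult_right_mono) auto
    also have "\<dots> = \<epsilon> * r / 16" using K'(2) \<kappa>_less_1 by simp
    finally show ?thesis .
  qed
  define \<eta> where "\<eta> = \<epsilon> * r / 16 / (2 * real p + r / (1 - \<kappa>))"
  have den: "2 \<le> 2 * real p + r / (1 - \<kappa>)" using y(1) r0 \<kappa>_less_1 by (simp add: add_increasing2)
  have \<eta>: "0 < \<eta>" unfolding \<eta>_def using \<epsilon> r0 den by (intro divide_pos_pos) auto
  have \<eta>_sum: "2 * real p * \<eta> + \<eta> * (r / (1 - \<kappa>)) = \<epsilon> * r / 16"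
  proof -
    have "x / c * c = x" if "2 \<le> c" for c x :: real using that by simp
    then have "\<eta> * (2 * real p + r / (1 - \<kappa>)) = \<epsilon> * r / 16" unfolding \<eta>_def using den by blast
    then show ?thesis by (simp add: algebra_simps)
  qed
  have \<eta>2: "2 * \<eta> \<le> \<epsilon> * r / 16"
  proof -
    have "2 * \<eta> \<le> 2 * real p * \<eta>" using y(1) \<eta> by simp
    moreover have "0 \<le> \<eta> * (r / (1 - \<kappa>))" using \<eta> r0 \<kappa>_less_1 by simp
    ultimately show ?thesis using \<eta>_sum by linarith
  qed
  have E_sum: "- K' * E \<le> orbit_sum T g p y"
  proof -
    have "- K' * E = (\<Sum>i<p. - K' * infdist ((T ^^ i) y) Z)" by (simp add: E_def orbit_sum_def sum_distrib_left)
    also have "\<dots> \<le> orbit_sum T g p y" unfolding orbit_sum_def by (intro sum_mono gZ)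
    finally show ?thesis .
  qed
  have E_pt: "- K' * E \<le> g ((T ^^ i) y)" for i
  proof -
    have "infdist ((T ^^ (i mod p)) y) Z \<le> E"
      unfolding E_def orbit_sum_def using y(1) by (intro member_le_sum infdist_nonneg) auto
    then have "- K' * E \<le> - K' * infdist ((T ^^ i) y) Z"
      using K'(2) periodic_mod[OF y(2), of i] by simp
    then show ?thesis using gZ[of "(T ^^ i) y"] by linarith
  qed
  have main: "\<exists>B. \<forall>n x. orbit_sum T (\<lambda>x. g x - \<epsilon> * infdist x Orb + h x) n x
        - real n * (orbit_sum T (\<lambda>x. g x + h x) p y / real p) \<le> B"
    if h: "\<eta>-lipschitz_on UNIV h" "\<And>x. \<bar>h x\<bar> \<le> \<eta>" for h
  proof -
    define A where "A = orbit_sum T (\<lambda>x. g x + h x) p y / real p"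
    define G where "G = (\<lambda>x. g x - \<epsilon> * infdist x Orb + h x - A)"
    define N where "N = {x. infdist x Orb < r}"
    have G_sum: "orbit_sum T G n x = orbit_sum T (\<lambda>x. g x - \<epsilon> * infdist x Orb + h x) n x - real n * A" for n x
      by (simp add: orbit_sum_def G_def sum_subtractf)
    have A_ge: "- (K' * E) - \<eta> \<le> A"
    proof -
      have "orbit_sum T (\<lambda>x. g x + h x) p y = orbit_sum T g p y + orbit_sum T h p y"
        by (simp add: orbit_sum_def sum.distrib)
      moreover have "\<bar>orbit_sum T h p y\<bar> \<le> real p * \<eta>" by (rule orbit_sum_abs_le[OF h(2)])
      ultimately have "- (K' * E) - real p * \<eta> \<le> orbit_sum T (\<lambda>x. g x + h x) p y" using E_sum by simp
      moreover have "K' * E \<le> real p * (K' * E)"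
        using y(1) E0 K'(2) mult_right_mono[of 1 "real p" "K' * E"] by simp
      ultimately have "real p * (- (K' * E) - \<eta>) \<le> orbit_sum T (\<lambda>x. g x + h x) p y" by (simp add: algebra_simps)
      then show ?thesis using y(1) by (simp add: A_def le_divide_eq mult.commute)
    qed
    have near: "orbit_sum T G m x \<le> \<epsilon> * r / 4" if m: "\<And>i. i < m \<Longrightarrow> (T ^^ i) x \<in> N" for m x
    proof -
      obtain s where s: "\<And>i. i < m \<Longrightarrow> dist ((T ^^ i) x) ((T ^^ i) ((T ^^ s) y)) < r"
        using follows_orbit[OF y(1,2) gap rL, of m x] m by (auto simp: N_def Orb_def)
      have "orbit_sum T G m x \<le> orbit_sum T (\<lambda>x. g x + h x) m x - real m * A"
        unfolding G_sum unfolding orbit_sum_def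
        by (intro diff_right_mono sum_mono) (use \<epsilon> in \<open>simp add: mult_nonneg_nonneg[OF less_imp_le infdist_nonneg]\<close>)
      also have "\<dots> \<le> (real j + 1) * (K' * E) + 2 * real p * \<eta> + \<eta> * (r / (1 - \<kappa>)) + K' * (\<kappa> ^ j * (r / (1 - \<kappa>)))"
        by (rule orbit_sum_near_orbit[OF K'(1) g(2) h _ y(1,2) E0 E_sum E_pt r0 r\<delta> s A_def]) (use K'(2) in auto)
      also have "\<dots> \<le> \<epsilon> * r / 4" using KE Kj \<eta>_sum mult_pos_pos[OF \<epsilon> r0] by linarith
      finally show ?thesis .
    qed
    have far: "G x \<le> - (\<epsilon> * r / 4)" if "x \<notin> N" for x
    proof -
      have "\<epsilon> * r \<le> \<epsilon> * infdist x Orb" using that \<epsilon> by (simp add: N_def)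
      then have "G x \<le> - (\<epsilon> * r) + \<eta> - A" using g(2)[of x] h(2)[of x] unfolding G_def by linarith
      then show ?thesis using A_ge KE KE1 \<eta>2 mult_pos_pos[OF \<epsilon> r0] by linarith
    qed
    have "orbit_sum T G n x \<le> \<epsilon> * r / 4" for n x
      by (rule orbit_sum_bounded_by_escape[OF near far]) (use \<epsilon> r0 in auto)
    then show ?thesis unfolding G_sum A_def by blast
  qed
  then show ?thesis using y(1,2) \<eta> unfolding Orb_def by blast
qed

end

section \<open>Entropy of finite-valued random variables\<close>

definition ent :: "'a measure \<Rightarrow> ('a \<Rightarrow> 'b) \<Rightarrow> real" where
  "ent M X = - (\<Sum>b\<in>X ` space M. measure M (X -` {b} \<inter> space M) * ln (measure M (X -` {b} \<inter> space M)))"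

lemma neg_x_ln_x_le: "- (p * ln p) \<le> 2 * sqrt p" if "0 \<le> p" for p :: real
proof (cases "p = 0")
  case False
  then have p: "0 < p" using that by simp
  have "- ln (sqrt p) = ln (1 / sqrt p)" using p by (simp add: ln_div)
  also have "\<dots> \<le> 1 / sqrt p - 1" using p by (intro ln_le_minus_one) auto
  finally have "- ln p \<le> 2 * (1 / sqrt p)" using p by (simp add: ln_sqrt)
  then have "p * - ln p \<le> p * (2 * (1 / sqrt p))" using p by (intro mult_left_mono) auto
  also have "\<dots> = 2 * (p / sqrt p)" by simp
  also have "p / sqrt p = sqrt p" using p by (simp add: real_div_sqrt)
  finally show ?thesis by simp
qed simp

context prob_space begin

lemma information_space_e: "information_space M (exp 1)"
  by unfold_locales (simp add: one_less_exp_iff)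

lemma ent_eq_entropy:
  assumes "simple_function M X"
  shows "ent M X = entropy (exp 1) (count_space (X ` space M)) X"
proof -
  interpret information_space M "exp 1" by (rule information_space_e)
  show ?thesis
    using entropy_simple_distributed[OF simple_distributedI[OF assms measure_nonneg refl]]
    by (simp add: ent_def log_ln[symmetric])
qed

lemma ent_le_card:
  assumes "simple_function M X"
  shows "ent M X \<le> ln (real (card (X ` space M)))"
proof -
  interpret information_space M "exp 1" by (rule information_space_e)
  show ?thesis
    using entropy_le_card[OF simple_distributedI[OF assms measure_nonneg refl]]
    by (simp add: ent_eq_entropy[OF assms] log_ln[symmetric])
qed

lemma ent_comp_le:
  assumes "simple_function M X"
  shows "ent M (\<lambda>x. f (X x)) \<le> ent M X"
proof -
  interpret information_space M "exp 1" by (rule information_space_e)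
  show ?thesis
    using entropy_data_processing[OF assms, of f] assms
    by (simp add: ent_eq_entropy simple_function_compose1 comp_def)
qed

lemma ent_nonneg:
  assumes "simple_function M X"
  shows "0 \<le> ent M X"
proof -
  have "ent M (\<lambda>x. ()) \<le> ent M X" by (rule ent_comp_le[OF assms])
  moreover have "ent M (\<lambda>x. ()) = 0" using not_empty by (simp add: ent_def prob_space)
  ultimately show ?thesis by simp
qed

lemma marginal_sum:
  fixes \<phi> :: "'c \<Rightarrow> real"
  assumes W: "simple_function M W"
  shows "(\<Sum>v\<in>(\<lambda>x. f (W x)) ` space M. prob ((\<lambda>x. f (W x)) -` {v} \<inter> space M) * \<phi> v) =
    (\<Sum>w\<in>W ` space M. prob (W -` {w} \<inter> space M) * \<phi> (f w))"
proof -
  have fin: "finite (W ` space M)" using W by (rule simple_functionD)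
  have p: "prob ((\<lambda>x. f (W x)) -` {v} \<inter> space M) = (\<Sum>w\<in>{w\<in>W ` space M. f w = v}. prob (W -` {w} \<inter> space M))" for v
  proof -
    have "(\<lambda>x. f (W x)) -` {v} \<inter> space M = (\<Union>w\<in>{w\<in>W ` space M. f w = v}. W -` {w} \<inter> space M)" by auto
    also have "prob \<dots> = (\<Sum>w\<in>{w\<in>W ` space M. f w = v}. prob (W -` {w} \<inter> space M))"
      using fin W by (intro finite_measure_finite_Union) (auto simp: disjoint_family_on_def simple_functionD)
    finally show ?thesis .
  qed
  have "(\<Sum>w\<in>W ` space M. prob (W -` {w} \<inter> space M) * \<phi> (f w)) =
      (\<Sum>v\<in>f ` W ` space M. \<Sum>w\<in>{w\<in>W ` space M. f w = v}. prob (W -` {w} \<inter> space M) * \<phi> (f w))"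
    by (rule sum.image_gen[OF fin])
  also have "\<dots> = (\<Sum>v\<in>f ` W ` space M. prob ((\<lambda>x. f (W x)) -` {v} \<inter> space M) * \<phi> v)"
    unfolding p sum_distrib_right by (intro sum.cong) auto
  finally show ?thesis by (simp add: image_image)
qed

lemma ent_comp_eq:
  assumes "simple_function M W"
  shows "ent M (\<lambda>x. f (W x)) =
    - (\<Sum>w\<in>W ` space M. prob (W -` {w} \<inter> space M) * ln (prob ((\<lambda>x. f (W x)) -` {f w} \<inter> space M)))"
  unfolding ent_def by (subst marginal_sum[OF assms]) simp

text \<open>This is the nonnegativity of the conditional mutual information, written with unconditional entropies.\<close>

lemma ent_strong_subadditive:
  assumes X: "simple_function M X" and Y: "simple_function M Y" and Z: "simple_function M Z"
  shows "ent M (\<lambda>x. (X x, Y x, Z x)) + ent M Z \<le> ent M (\<lambda>x. (X x, Z x)) + ent M (\<lambda>x. (Y x, Z x))"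
proof -
  interpret information_space M "exp 1" by (rule information_space_e)
  define W where "W = (\<lambda>x. (X x, Y x, Z x))"
  have W: "simple_function M W" unfolding W_def using X Y Z by simp
  define pW where "pW w = prob (W -` {w} \<inter> space M)" for w
  define pZ where "pZ w = prob (Z -` {w} \<inter> space M)" for w
  define pX where "pX w = prob ((\<lambda>x. (X x, Z x)) -` {w} \<inter> space M)" for w
  define pY where "pY w = prob ((\<lambda>x. (Y x, Z x)) -` {w} \<inter> space M)" for w
  have ents: "ent M W = - (\<Sum>(x, y, z)\<in>W ` space M. pW (x, y, z) * ln (pW (x, y, z)))"
    "ent M Z = - (\<Sum>(x, y, z)\<in>W ` space M. pW (x, y, z) * ln (pZ z))"
    "ent M (\<lambda>x. (X x, Z x)) = - (\<Sum>(x, y, z)\<in>W ` space M. pW (x, y, z) * ln (pX (x, z)))"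
    "ent M (\<lambda>x. (Y x, Z x)) = - (\<Sum>(x, y, z)\<in>W ` space M. pW (x, y, z) * ln (pY (y, z)))"
    using ent_comp_eq[OF W, of id] ent_comp_eq[OF W, of "\<lambda>(x, y, z). z"]
      ent_comp_eq[OF W, of "\<lambda>(x, y, z). (x, z)"] ent_comp_eq[OF W, of "\<lambda>(x, y, z). (y, z)"]
    unfolding pW_def pZ_def pX_def pY_def by (simp_all add: W_def case_prod_unfold)
  have "0 \<le> conditional_mutual_information (exp 1) (count_space (X ` space M)) (count_space (Y ` space M))
      (count_space (Z ` space M)) X Y Z"
    by (rule conditional_mutual_information_nonneg[OF X Y Z])
  also have "\<dots> = (\<Sum>(x, y, z)\<in>W ` space M. pW (x, y, z) * log (exp 1) (pW (x, y, z) / (pX (x, z) * (pY (y, z) / pZ z))))"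
    unfolding pW_def pZ_def pX_def pY_def W_def
    by (rule conditional_mutual_information_eq; rule simple_distributedI[OF _ measure_nonneg refl]) (use X Y Z in auto)
  also have "\<dots> = (\<Sum>(x, y, z)\<in>W ` space M. pW (x, y, z) * ln (pW (x, y, z)) + pW (x, y, z) * ln (pZ z)
      - pW (x, y, z) * ln (pX (x, z)) - pW (x, y, z) * ln (pY (y, z)))"
  proof (rule sum.cong[OF refl], clarify)
    fix x y z
    show "pW (x, y, z) * log (exp 1) (pW (x, y, z) / (pX (x, z) * (pY (y, z) / pZ z))) =
      pW (x, y, z) * ln (pW (x, y, z)) + pW (x, y, z) * ln (pZ z) - pW (x, y, z) * ln (pX (x, z)) - pW (x, y, z) * ln (pY (y, z))"
    proof (cases "pW (x, y, z) = 0")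
      case False
      then have pos: "0 < pW (x, y, z)" by (simp add: pW_def zero_less_measure_iff)
      have "pW (x, y, z) \<le> pZ z" "pW (x, y, z) \<le> pX (x, z)" "pW (x, y, z) \<le> pY (y, z)"
        unfolding pW_def pZ_def pX_def pY_def using X Y Z
        by (auto intro!: finite_measure_mono simp: W_def simple_functionD(2)[OF simple_function_Pair] simple_functionD(2))
      then have "0 < pZ z" "0 < pX (x, z)" "0 < pY (y, z)" using pos by linarith+
      then have eq: "ln (pW (x, y, z) / (pX (x, z) * (pY (y, z) / pZ z))) = ln (pW (x, y, z)) + ln (pZ z) - ln (pX (x, z)) - ln (pY (y, z))"
        using pos by (simp add: ln_div ln_mult)
      show ?thesis unfolding log_ln[symmetric] eq by (simp only: algebra_simps)
    qed simp
  qed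
  also have "\<dots> = ent M (\<lambda>x. (X x, Z x)) + ent M (\<lambda>x. (Y x, Z x)) - ent M W - ent M Z"
    unfolding ents by (simp add: case_prod_unfold sum.distrib sum_subtractf)
  finally show ?thesis by (simp add: W_def)
qed

lemma ent_subadditive:
  assumes X: "simple_function M X" and Y: "simple_function M Y"
  shows "ent M (\<lambda>x. (X x, Y x)) \<le> ent M X + ent M Y"
proof -
  have Z: "simple_function M (\<lambda>x. ())" by simp
  have "ent M (\<lambda>x. (X x, Y x, ())) + ent M (\<lambda>x. ()) \<le> ent M (\<lambda>x. (X x, ())) + ent M (\<lambda>x. (Y x, ()))"
    by (rule ent_strong_subadditive[OF X Y Z])
  moreover have "ent M (\<lambda>x. (X x, ())) \<le> ent M X" "ent M (\<lambda>x. (Y x, ())) \<le> ent M Y"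
    using ent_comp_le[OF X, of "\<lambda>x. (x, ())"] ent_comp_le[OF Y, of "\<lambda>x. (x, ())"] by auto
  moreover have "ent M (\<lambda>x. (X x, Y x)) \<le> ent M (\<lambda>x. (X x, Y x, ()))"
    using ent_comp_le[of "\<lambda>x. (X x, Y x, ())" "\<lambda>(x, y, z). (x, y)"] X Y Z by simp
  ultimately show ?thesis using ent_nonneg[OF Z] by linarith
qed

text \<open>The entropy of \<open>X\<close> given \<open>X'\<close> is written as \<open>ent M (X, X') - ent M X'\<close>. By strong subadditivity it
  can only decrease when more is given, which is used once to split \<open>X\<close> from \<open>Y\<close> and once for each of them.\<close>

lemma conditional_ent_subadditive:
  assumes s: "simple_function M X" "simple_function M Y" "simple_function M X'" "simple_function M Y'"
  shows "ent M (\<lambda>x. ((X x, Y x), (X' x, Y' x))) - ent M (\<lambda>x. (X' x, Y' x)) \<le>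
    (ent M (\<lambda>x. (X x, X' x)) - ent M X') + (ent M (\<lambda>x. (Y x, Y' x)) - ent M Y')"
proof -
  note [simp] = s
  have 1: "ent M (\<lambda>x. (X x, Y x, X' x, Y' x)) + ent M (\<lambda>x. (X' x, Y' x)) \<le>
      ent M (\<lambda>x. (X x, X' x, Y' x)) + ent M (\<lambda>x. (Y x, X' x, Y' x))"
    by (rule ent_strong_subadditive) simp_all
  have 2: "ent M (\<lambda>x. (X x, Y' x, X' x)) + ent M X' \<le> ent M (\<lambda>x. (X x, X' x)) + ent M (\<lambda>x. (Y' x, X' x))"
    by (rule ent_strong_subadditive) simp_all
  have 3: "ent M (\<lambda>x. (Y x, X' x, Y' x)) + ent M Y' \<le> ent M (\<lambda>x. (Y x, Y' x)) + ent M (\<lambda>x. (X' x, Y' x))"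
    by (rule ent_strong_subadditive) simp_all
  have 4: "ent M (\<lambda>x. ((X x, Y x), (X' x, Y' x))) \<le> ent M (\<lambda>x. (X x, Y x, X' x, Y' x))"
    using ent_comp_le[of "\<lambda>x. (X x, Y x, X' x, Y' x)" "\<lambda>(x, y, z). ((x, y), z)"] by simp
  have 5: "ent M (\<lambda>x. (X x, X' x, Y' x)) \<le> ent M (\<lambda>x. (X x, Y' x, X' x))"
    using ent_comp_le[of "\<lambda>x. (X x, Y' x, X' x)" "\<lambda>(x, y, z). (x, z, y)"] by simp
  have 6: "ent M (\<lambda>x. (Y' x, X' x)) \<le> ent M (\<lambda>x. (X' x, Y' x))"
    using ent_comp_le[of "\<lambda>x. (X' x, Y' x)" "\<lambda>(x, y). (y, x)"] by simp
  show ?thesis using 1 2 3 4 5 6 by linarith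
qed

lemma conditional_ent_coarsen:
  assumes X: "simple_function M X" and Y: "simple_function M Y"
  shows "ent M (\<lambda>x. (X x, Y x)) - ent M Y \<le> ent M (\<lambda>x. (X x, f (Y x))) - ent M (\<lambda>x. f (Y x))"
proof -
  have fY: "simple_function M (\<lambda>x. f (Y x))" using Y by (rule simple_function_compose1)
  note [simp] = X Y fY
  have "ent M (\<lambda>x. (X x, Y x, f (Y x))) + ent M (\<lambda>x. f (Y x)) \<le> ent M (\<lambda>x. (X x, f (Y x))) + ent M (\<lambda>x. (Y x, f (Y x)))"
    by (rule ent_strong_subadditive) simp_all
  moreover have "ent M (\<lambda>x. (X x, Y x)) \<le> ent M (\<lambda>x. (X x, Y x, f (Y x)))"
    using ent_comp_le[of "\<lambda>x. (X x, Y x, f (Y x))" "\<lambda>(x, y, z). (x, y)"] by simp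
  moreover have "ent M (\<lambda>x. (Y x, f (Y x))) \<le> ent M Y"
    using ent_comp_le[OF Y, of "\<lambda>y. (y, f y)"] by simp
  ultimately show ?thesis by linarith
qed

text \<open>A crude form of Fano's inequality. The terms with \<open>X = Y\<close> contribute together at most the probability of
  \<open>X \<noteq> Y\<close>, and each of the others at most \<open>- p ln p \<le> 2 sqrt p\<close> with \<open>p \<le> e\<close>.\<close>

lemma conditional_ent_small:
  assumes X: "simple_function M X" and Y: "simple_function M Y"
    and F: "finite F" "\<And>x. X x \<in> F" "\<And>x. Y x \<in> F"
    and e: "prob {x \<in> space M. X x \<noteq> Y x} \<le> e" "0 \<le> e"
  shows "ent M (\<lambda>x. (X x, Y x)) - ent M Y \<le> (real (card F))\<^sup>2 * (2 * sqrt e) + e"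
proof -
  define W where "W = (\<lambda>x. (X x, Y x))"
  have W: "simple_function M W" unfolding W_def using X Y by simp
  have finW: "finite (W ` space M)" using W by (rule simple_functionD)
  define pW where "pW w = prob (W -` {w} \<inter> space M)" for w
  define pY where "pY y = prob (Y -` {y} \<inter> space M)" for y
  have meas: "W -` A \<inter> space M \<in> events" for A using W by (rule simple_functionD)
  have "{x \<in> space M. X x \<noteq> Y x} = W -` {(a, b). a \<noteq> b} \<inter> space M" by (auto simp: W_def)
  then have ne: "{x \<in> space M. X x \<noteq> Y x} \<in> events" using meas by metis
  have "ent M W - ent M Y = (\<Sum>w\<in>W ` space M. pW w * (ln (pY (snd w)) - ln (pW w)))"
    using ent_comp_eq[OF W, of id] ent_comp_eq[OF W, of snd]
    by (simp add: W_def pW_def pY_def sum_subtractf algebra_simps)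
  also have "\<dots> \<le> (\<Sum>w\<in>W ` space M. 2 * sqrt e + (if fst w = snd w then pY (snd w) - pW w else 0))"
  proof (rule sum_mono)
    fix w assume "w \<in> W ` space M"
    obtain a b where w: "w = (a, b)" by (cases w)
    have le: "pW w \<le> pY b"
      unfolding pW_def pY_def w using Y by (intro finite_measure_mono simple_functionD(2)) (auto simp: W_def)
    show "pW w * (ln (pY (snd w)) - ln (pW w)) \<le> 2 * sqrt e + (if fst w = snd w then pY (snd w) - pW w else 0)"
    proof (cases "pW w = 0")
      case True
      then show ?thesis using real_sqrt_ge_zero[OF e(2)] le w by auto
    next
      case False
      then have pos: "0 < pW w" by (simp add: pW_def zero_less_measure_iff)
      then have posY: "0 < pY b" using le by linarith
      show ?thesis
      proof (cases "a = b")
        case True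
        have "ln (pY b) - ln (pW w) = ln (pY b / pW w)" using pos posY by (simp add: ln_div)
        also have "\<dots> \<le> pY b / pW w - 1" using pos posY by (intro ln_le_minus_one) auto
        finally have "pW w * (ln (pY b) - ln (pW w)) \<le> pW w * (pY b / pW w - 1)" using pos by (intro mult_left_mono) auto
        also have "\<dots> = pY b - pW w" using pos by (simp add: algebra_simps)
        finally show ?thesis using True w real_sqrt_ge_zero[OF e(2)] by (auto intro!: add_increasing)
      next
        case False
        have "ln (pY b) \<le> 0" using posY by (simp add: pY_def)
        then have "pW w * (ln (pY b) - ln (pW w)) \<le> pW w * (- ln (pW w))" using pos by (intro mult_left_mono) auto
        also have "\<dots> \<le> 2 * sqrt (pW w)" using neg_x_ln_x_le[of "pW w"] pos by simp
        also have "\<dots> \<le> 2 * sqrt e"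
        proof -
          have "pW w \<le> prob {x \<in> space M. X x \<noteq> Y x}"
            unfolding pW_def w by (rule finite_measure_mono[OF _ ne]) (use False in \<open>auto simp: W_def\<close>)
          then show ?thesis using e(1) by simp
        qed
        finally show ?thesis using False w by simp
      qed
    qed
  qed
  also have "\<dots> = real (card (W ` space M)) * (2 * sqrt e) + (\<Sum>w\<in>W ` space M. if fst w = snd w then pY (snd w) - pW w else 0)"
    by (simp add: sum.distrib)
  also have "\<dots> \<le> (real (card F))\<^sup>2 * (2 * sqrt e) + e"
  proof (rule add_mono)
    have "card (W ` space M) \<le> card (F \<times> F)" using F by (intro card_mono) (auto simp: W_def)
    then have "real (card (W ` space M)) \<le> (real (card F))\<^sup>2"
      by (metis card_cartesian_product of_nat_le_iff of_nat_mult power2_eq_square)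
    then show "real (card (W ` space M)) * (2 * sqrt e) \<le> (real (card F))\<^sup>2 * (2 * sqrt e)"
      using e(2) by (intro mult_right_mono) auto
    define D where "D = {w \<in> W ` space M. fst w = snd w}"
    have finD: "finite D" using finW by (simp add: D_def)
    have "(\<Sum>w\<in>W ` space M. if fst w = snd w then pY (snd w) - pW w else 0) = (\<Sum>w\<in>D. pY (snd w) - pW w)"
      unfolding D_def using finW by (subst sum.inter_filter) auto
    also have "\<dots> = (\<Sum>w\<in>D. prob (W -` {(a, b). b = snd w \<and> a \<noteq> b} \<inter> space M))"
    proof (rule sum.cong[OF refl])
      fix w assume "w \<in> D"
      then obtain b where w: "w = (b, b)" by (cases w) (auto simp: D_def)
      have "Y -` {b} \<inter> space M = (W -` {(b, b)} \<inter> space M) \<union> (W -` {(a, b'). b' = b \<and> a \<noteq> b'} \<inter> space M)"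
        by (auto simp: W_def)
      then have "pY b = prob ((W -` {(b, b)} \<inter> space M) \<union> (W -` {(a, b'). b' = b \<and> a \<noteq> b'} \<inter> space M))"
        by (simp add: pY_def)
      also have "\<dots> = pW (b, b) + prob (W -` {(a, b'). b' = b \<and> a \<noteq> b'} \<inter> space M)"
        unfolding pW_def by (rule finite_measure_Union[OF meas meas]) auto
      finally show "pY (snd w) - pW w = prob (W -` {(a, b). b = snd w \<and> a \<noteq> b} \<inter> space M)" by (simp add: w)
    qed
    also have "\<dots> = prob (\<Union>w\<in>D. W -` {(a, b). b = snd w \<and> a \<noteq> b} \<inter> space M)"
    proof (rule finite_measure_finite_Union[symmetric, OF finD])
      show "disjoint_family_on (\<lambda>w. W -` {(a, b). b = snd w \<and> a \<noteq> b} \<inter> space M) D"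
        by (auto simp: disjoint_family_on_def D_def)
    next
      show "(\<lambda>w. W -` {(a, b). b = snd w \<and> a \<noteq> b} \<inter> space M) ` D \<subseteq> events" using meas by blast
    qed
    also have "\<dots> \<le> prob {x \<in> space M. X x \<noteq> Y x}"
      by (rule finite_measure_mono[OF _ ne]) (auto simp: W_def)
    finally show "(\<Sum>w\<in>W ` space M. if fst w = snd w then pY (snd w) - pW w else 0) \<le> e" using e(1) by simp
  qed
  finally show ?thesis by (simp add: W_def)
qed

end

section \<open>Generators and the Kolmogorov-Sinai entropy\<close>

text \<open>Partitions are described as the fibres of functions. The entropy of a dynamical join then becomes the
  entropy of itineraries.\<close>

lemma dynamical_join_fibres:
  "dynamical_join T (range (\<lambda>x. X -` {X x})) n =
    range (\<lambda>x. itinerary T X n -` {itinerary T X n x})"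
proof -
  define P where "P = range (\<lambda>x. X -` {X x})"
  define Q where "Q i = (\<lambda>A. (T ^^ i) -` A) ` P" for i
  have cell: "itinerary T X n y = itinerary T X n x \<longleftrightarrow> (\<forall>i<n. X ((T ^^ i) y) = X ((T ^^ i) x))" for x y
    by (auto simp: itinerary_def)
  have unique: "A = (T ^^ i) -` (X -` {X ((T ^^ i) x)})" if "A \<in> Q i" "x \<in> A" for A i x
    using that by (auto simp: Q_def P_def)
  have "dynamical_join T P n = (\<Union>f\<in>(\<Pi> R\<in>Q ` {..<n}. R). {\<Inter> (f ` Q ` {..<n})}) - {{}}"
    unfolding dynamical_join_def Q_def[abs_def, symmetric] by (rule common_refinement)
  also have "\<dots> = range (\<lambda>x. itinerary T X n -` {itinerary T X n x})"
  proof (intro set_eqI iffI)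
    fix R assume "R \<in> (\<Union>f\<in>(\<Pi> R\<in>Q ` {..<n}. R). {\<Inter> (f ` Q ` {..<n})}) - {{}}"
    then obtain f x where f: "f \<in> (\<Pi> R\<in>Q ` {..<n}. R)" "R = \<Inter> (f ` Q ` {..<n})" "x \<in> R" by blast
    have "f (Q i) = (T ^^ i) -` (X -` {X ((T ^^ i) x)})" if "i < n" for i
      using f that by (intro unique) auto
    then have "R = itinerary T X n -` {itinerary T X n x}" using f(2) by (auto simp: cell)
    then show "R \<in> range (\<lambda>x. itinerary T X n -` {itinerary T X n x})" by blast
  next
    fix R assume "R \<in> range (\<lambda>x. itinerary T X n -` {itinerary T X n x})"
    then obtain x where R: "R = itinerary T X n -` {itinerary T X n x}" by blast
    define f where "f = (\<lambda>R. SOME A. A \<in> R \<and> x \<in> A)"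
    have f: "f (Q i) \<in> Q i \<and> x \<in> f (Q i)" for i
      unfolding f_def by (rule someI_ex) (auto simp: Q_def P_def)
    have "f (Q i) = (T ^^ i) -` (X -` {X ((T ^^ i) x)})" for i using f by (intro unique) auto
    then have "R = \<Inter> (f ` Q ` {..<n})" unfolding R by (auto simp: cell)
    moreover have "f \<in> (\<Pi> R\<in>Q ` {..<n}. R)" using f by auto
    moreover have "R \<noteq> {}" using R by auto
    ultimately show "R \<in> (\<Union>f\<in>(\<Pi> R\<in>Q ` {..<n}. R). {\<Inter> (f ` Q ` {..<n})}) - {{}}" by blast
  qed
  finally show ?thesis by (simp add: P_def)
qed

lemma partition_entropy_fibres:
  assumes "space M = UNIV"
  shows "partition_entropy M (range (\<lambda>x. Y -` {Y x})) = ent M Y"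
proof -
  have "range (\<lambda>x. Y -` {Y x}) = (\<lambda>b. Y -` {b}) ` range Y" by auto
  moreover have "inj_on (\<lambda>b. Y -` {b}) (range Y)" by (auto simp: inj_on_def)
  ultimately show ?thesis
    unfolding partition_entropy_def ent_def assms by (simp only: sum.reindex) simp
qed

locale expanding_measure = expanding_system T L \<kappa> \<delta>
    for T :: "'a::metric_space \<Rightarrow> 'a" and L \<kappa> \<delta> +
  fixes \<mu> :: "'a measure"
  assumes invariant: "\<mu> \<in> invariant_measures T"
begin

sublocale prob_space \<mu>
  using invariant by (simp add: invariant_measures_def)

lemma sets_\<mu> [simp]: "sets \<mu> = sets borel"
  using invariant by (simp add: invariant_measures_def)

lemma space_\<mu> [simp]: "space \<mu> = UNIV"
  using sets_eq_imp_space_eq[OF sets_\<mu>] by simp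

lemma T_iterate_measurable: "(T ^^ n) \<in> borel_measurable borel"
  using continuous_T_iterate by (rule borel_measurable_continuous_onI)

lemma vimage_T_iterate: "A \<in> sets borel \<Longrightarrow> (T ^^ n) -` A \<in> sets borel"
  using measurable_sets[OF T_iterate_measurable, of A n] by simp

lemma measure_vimage_T: "A \<in> sets borel \<Longrightarrow> measure \<mu> (T -` A) = measure \<mu> A"
proof -
  assume A: "A \<in> sets borel"
  have "distr \<mu> borel T = \<mu>" using invariant by (simp add: invariant_measures_def)
  moreover have "T \<in> measurable \<mu> borel"
    using T_iterate_measurable[of 1] by (simp cong: measurable_cong_sets)
  ultimately show ?thesis using measure_distr[of T \<mu> borel A] A by simp
qed

lemma measure_vimage_T_iterate: "A \<in> sets borel \<Longrightarrow> measure \<mu> ((T ^^ n) -` A) = measure \<mu> A"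
proof (induction n)
  case (Suc n)
  have eq: "(T ^^ Suc n) -` A = T -` ((T ^^ n) -` A)" by (auto simp: funpow_swap1)
  show ?case unfolding eq using Suc measure_vimage_T[OF vimage_T_iterate[OF Suc.prems]] by simp
qed simp

lemma simple_function_T:
  assumes "simple_function \<mu> X"
  shows "simple_function \<mu> (\<lambda>x. X ((T ^^ n) x))"
  unfolding simple_function_def
proof
  have "range (\<lambda>x. X ((T ^^ n) x)) \<subseteq> range X" by auto
  then show "finite ((\<lambda>x. X ((T ^^ n) x)) ` space \<mu>)"
    using simple_functionD(1)[OF assms] finite_subset by auto
  have "(\<lambda>x. X ((T ^^ n) x)) -` {b} = (T ^^ n) -` (X -` {b})" for b by auto
  then show "\<forall>x\<in>(\<lambda>x. X ((T ^^ n) x)) ` space \<mu>. (\<lambda>x. X ((T ^^ n) x)) -` {x} \<inter> space \<mu> \<in> sets \<mu>"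
    using simple_functionD(2)[OF assms] vimage_T_iterate by simp
qed

lemma ent_T_invariant:
  assumes "simple_function \<mu> X"
  shows "ent \<mu> (\<lambda>x. X ((T ^^ n) x)) = ent \<mu> X"
proof -
  have fib: "(\<lambda>x. X ((T ^^ n) x)) -` {b} = (T ^^ n) -` (X -` {b})" for b by auto
  have "X -` {b} \<in> sets borel" for b using simple_functionD(2)[OF assms, of "{b}"] by simp
  then have eq: "measure \<mu> ((\<lambda>x. X ((T ^^ n) x)) -` {b}) = measure \<mu> (X -` {b})" for b
    unfolding fib by (rule measure_vimage_T_iterate)
  have "(\<Sum>b\<in>range (\<lambda>x. X ((T ^^ n) x)). measure \<mu> (X -` {b}) * ln (measure \<mu> (X -` {b}))) =
      (\<Sum>b\<in>range X. measure \<mu> (X -` {b}) * ln (measure \<mu> (X -` {b})))"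
  proof (rule sum.mono_neutral_left)
    show "finite (range X)" using simple_functionD(1)[OF assms] by simp
    show "\<forall>b\<in>range X - range (\<lambda>x. X ((T ^^ n) x)). measure \<mu> (X -` {b}) * ln (measure \<mu> (X -` {b})) = 0"
    proof
      fix b assume "b \<in> range X - range (\<lambda>x. X ((T ^^ n) x))"
      then have "X ((T ^^ n) x) \<noteq> b" for x by blast
      then have "(\<lambda>x. X ((T ^^ n) x)) -` {b} = {}" by blast
      then show "measure \<mu> (X -` {b}) * ln (measure \<mu> (X -` {b})) = 0" using eq[of b] by simp
    qed
  qed auto
  then show ?thesis by (simp add: ent_def eq)
qed

lemma itinerary_Suc: "itinerary T X (Suc n) x = itinerary T X n x @ [X ((T ^^ n) x)]"
  by (simp add: itinerary_def)

lemma simple_function_itinerary: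
  assumes "simple_function \<mu> X"
  shows "simple_function \<mu> (itinerary T X n)"
proof (induction n)
  case 0
  have "itinerary T X 0 = (\<lambda>x. [])" by (simp add: itinerary_def fun_eq_iff)
  then show ?case by simp
next
  case (Suc n)
  have "itinerary T X (Suc n) = (\<lambda>x. itinerary T X n x @ [X ((T ^^ n) x)])"
    by (simp add: itinerary_Suc fun_eq_iff)
  then show ?case
    using simple_function_compose2[OF Suc simple_function_T[OF assms, of n], of "\<lambda>u b. u @ [b]"] by simp
qed

lemma ent_itinerary_subadditive:
  assumes X: "simple_function \<mu> X"
  shows "ent \<mu> (itinerary T X (m + n)) \<le> ent \<mu> (itinerary T X m) + ent \<mu> (itinerary T X n)"
proof -
  note s = simple_function_itinerary[OF X]
  have s': "simple_function \<mu> (\<lambda>x. itinerary T X n ((T ^^ m) x))" by (rule simple_function_T[OF s])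
  have "itinerary T X (m + n) = (\<lambda>x. (\<lambda>(u, v). u @ v) (itinerary T X m x, itinerary T X n ((T ^^ m) x)))"
    by (simp add: itinerary_add fun_eq_iff)
  then have "ent \<mu> (itinerary T X (m + n)) \<le> ent \<mu> (\<lambda>x. (itinerary T X m x, itinerary T X n ((T ^^ m) x)))"
    using ent_comp_le[OF simple_function_Pair[OF s[of m] s'], of "\<lambda>(u, v). u @ v"] by simp
  also have "\<dots> \<le> ent \<mu> (itinerary T X m) + ent \<mu> (\<lambda>x. itinerary T X n ((T ^^ m) x))"
    by (rule ent_subadditive[OF s s'])
  finally show ?thesis by (simp add: ent_T_invariant[OF s])
qed

text \<open>The entropy of \<open>T\<close> with respect to the partition into the fibres of \<open>X\<close>.\<close>

definition rate :: "('a \<Rightarrow> 'b) \<Rightarrow> real" where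
  "rate X = lim (\<lambda>n. ent \<mu> (itinerary T X n) / real n)"

lemma rate:
  assumes X: "simple_function \<mu> X"
  shows "(\<lambda>n. ent \<mu> (itinerary T X n) / real n) \<longlonglongrightarrow> rate X"
    and "real n * rate X \<le> ent \<mu> (itinerary T X n)"
proof -
  obtain h where h: "(\<lambda>n. ent \<mu> (itinerary T X n) / real n) \<longlonglongrightarrow> h"
    "\<And>n. real n * h \<le> ent \<mu> (itinerary T X n)"
    using fekete[of "\<lambda>n. ent \<mu> (itinerary T X n)"] ent_itinerary_subadditive[OF X]
      ent_nonneg[OF simple_function_itinerary[OF X]] by blast
  have "rate X = h" unfolding rate_def using h(1) by (rule limI)
  then show "(\<lambda>n. ent \<mu> (itinerary T X n) / real n) \<longlonglongrightarrow> rate X"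
    "real n * rate X \<le> ent \<mu> (itinerary T X n)" using h by auto
qed

lemma entropy_of_fibres:
  "entropy_of_partition T \<mu> (range (\<lambda>x. X -` {X x})) = rate X"
  unfolding entropy_of_partition_def dynamical_join_fibres partition_entropy_fibres[OF space_\<mu>] rate_def ..

lemma partition_is_fibres:
  assumes "finite P" "P \<subseteq> sets borel" "partition_on UNIV P"
  shows "\<exists>X :: 'a \<Rightarrow> 'a set. simple_function \<mu> X \<and> P = range (\<lambda>x. X -` {X x})"
proof -
  have "\<exists>A\<in>P. x \<in> A" for x using assms(3) by (auto simp: partition_on_def)
  then obtain X where X: "\<And>x. X x \<in> P" "\<And>x. x \<in> X x" by metis
  have eq: "X y = A \<longleftrightarrow> y \<in> A" if "A \<in> P" for A y
  proof
    assume "y \<in> A"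
    then have "X y \<inter> A \<noteq> {}" using X(2)[of y] by blast
    then show "X y = A" using partition_onD2[OF assms(3)] X(1)[of y] that by (auto simp: disjoint_def)
  qed (use X(2) in auto)
  then have fib: "X -` {A} = A" if "A \<in> P" for A using that by auto
  have "P = range X"
  proof
    show "P \<subseteq> range X"
    proof
      fix A assume A: "A \<in> P"
      then have "A \<noteq> {}" using partition_onD3[OF assms(3)] by blast
      then show "A \<in> range X" using eq[OF A] by blast
    qed
  qed (use X(1) in auto)
  moreover have "simple_function \<mu> X"
    using assms(1,2) X(1) fib \<open>P = range X\<close> by (auto simp: simple_function_def)
  ultimately show ?thesis using fib[OF X(1)] by (intro exI[of _ X]) auto
qed

lemma fibres_is_partition:
  assumes X: "simple_function \<mu> X"
  shows "range (\<lambda>x. X -` {X x}) \<in> {P. finite P \<and> P \<subseteq> sets borel \<and> partition_on UNIV P}"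
proof -
  have "range (\<lambda>x. X -` {X x}) = (\<lambda>b. X -` {b}) ` range X" by auto
  moreover have "finite (range X)" using simple_functionD(1)[OF X] by simp
  ultimately have "finite (range (\<lambda>x. X -` {X x}))" by simp
  moreover have "range (\<lambda>x. X -` {X x}) \<subseteq> sets borel" using simple_functionD(2)[OF X] by auto
  moreover have "partition_on UNIV (range (\<lambda>x. X -` {X x}))"
    by (auto simp: partition_on_def disjoint_def)
  ultimately show ?thesis by blast
qed

lemma conditional_ent_itinerary:
  assumes X: "simple_function \<mu> X" and Y: "simple_function \<mu> Y"
  shows "ent \<mu> (\<lambda>x. (itinerary T X n x, itinerary T Y n x)) - ent \<mu> (itinerary T Y n) \<le>
    real n * (ent \<mu> (\<lambda>x. (X x, Y x)) - ent \<mu> Y)"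
proof (induction n)
  case 0
  have "(\<lambda>x. (itinerary T X 0 x, itinerary T Y 0 x)) = (\<lambda>x. ([], itinerary T Y 0 x))"
    by (simp add: itinerary_def)
  then show ?case
    using ent_comp_le[OF simple_function_itinerary[OF Y, of 0], of "\<lambda>v. ([] :: 'b list, v)"] by simp
next
  case (Suc n)
  define c where "c = ent \<mu> (\<lambda>x. (X x, Y x)) - ent \<mu> Y"
  define X' Y' where "X' = (\<lambda>x. X ((T ^^ n) x))" and "Y' = (\<lambda>x. Y ((T ^^ n) x))"
  have s: "simple_function \<mu> X'" "simple_function \<mu> Y'" "simple_function \<mu> (itinerary T X n)" "simple_function \<mu> (itinerary T Y n)"
    "simple_function \<mu> (itinerary T Y (Suc n))"
    unfolding X'_def Y'_def using X Y by (auto intro: simple_function_T simple_function_itinerary)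
  have XY: "simple_function \<mu> (\<lambda>x. (X x, Y x))" using X Y by simp
  have 1: "ent \<mu> (\<lambda>x. (itinerary T X (Suc n) x, itinerary T Y (Suc n) x)) \<le>
      ent \<mu> (\<lambda>x. ((itinerary T X n x, X' x), (itinerary T Y n x, Y' x)))"
    using ent_comp_le[of "\<lambda>x. ((itinerary T X n x, X' x), (itinerary T Y n x, Y' x))" "\<lambda>((u, a), (v, b)). (u @ [a], v @ [b])"] s
    by (simp add: itinerary_Suc X'_def Y'_def)
  have 2: "ent \<mu> (\<lambda>x. (itinerary T Y n x, Y' x)) \<le> ent \<mu> (itinerary T Y (Suc n))"
    using ent_comp_le[OF s(5), of "\<lambda>v. (butlast v, last v)"] by (simp add: itinerary_Suc Y'_def)
  have 3: "ent \<mu> (\<lambda>x. (X' x, Y' x)) - ent \<mu> Y' = c"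
    using ent_T_invariant[OF XY, of n] ent_T_invariant[OF Y, of n] by (simp add: X'_def Y'_def c_def)
  have 4: "ent \<mu> (\<lambda>x. ((itinerary T X n x, X' x), (itinerary T Y n x, Y' x))) - ent \<mu> (\<lambda>x. (itinerary T Y n x, Y' x)) \<le>
      (ent \<mu> (\<lambda>x. (itinerary T X n x, itinerary T Y n x)) - ent \<mu> (itinerary T Y n)) + (ent \<mu> (\<lambda>x. (X' x, Y' x)) - ent \<mu> Y')"
    by (rule conditional_ent_subadditive) (use s in auto)
  have "real (Suc n) * c = real n * c + c" by (simp add: algebra_simps)
  then show ?case using 1 2 3 4 Suc unfolding c_def[symmetric] by linarith
qed

text \<open>Knowing the \<open>d\<close>-itinerary of length \<open>n + k\<close> means knowing the words of length \<open>k\<close> at all times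
  below \<open>n\<close>, and given these each value of \<open>X\<close> costs at most the conditional entropy.\<close>

lemma rate_le_conditional:
  assumes X: "simple_function \<mu> X" and d: "simple_function \<mu> d"
  shows "rate X \<le> rate d + (ent \<mu> (\<lambda>x. (X x, itinerary T d k x)) - ent \<mu> (itinerary T d k))"
proof -
  define c where "c = ent \<mu> (\<lambda>x. (X x, itinerary T d k x)) - ent \<mu> (itinerary T d k)"
  define Y where "Y = itinerary T d k"
  have Y: "simple_function \<mu> Y" unfolding Y_def by (rule simple_function_itinerary[OF d])
  note s = simple_function_itinerary
  have le: "ent \<mu> (itinerary T X n) \<le> ent \<mu> (itinerary T d n) + ent \<mu> (itinerary T d k) + real n * c" for n
  proof -
    have 1: "ent \<mu> (itinerary T X n) \<le> ent \<mu> (\<lambda>x. (itinerary T X n x, itinerary T Y n x))"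
      using ent_comp_le[of "\<lambda>x. (itinerary T X n x, itinerary T Y n x)" fst] s[OF X, of n] s[OF Y, of n] by simp
    have "itinerary T Y n = (\<lambda>x. (\<lambda>u. map (\<lambda>i. take k (drop i u)) [0..<n]) (itinerary T d (n + k) x))"
    proof (rule ext, rule nth_equalityI)
      fix x i assume "i < length (itinerary T Y n x)"
      then have i: "i < n" by simp
      have "take k (drop i (itinerary T d (n + k) x)) = itinerary T d k ((T ^^ i) x)"
        using i by (intro nth_equalityI) (auto simp: itinerary_def funpow_add_apply)
      then show "itinerary T Y n x ! i = map (\<lambda>i. take k (drop i (itinerary T d (n + k) x))) [0..<n] ! i"
        using i by (simp add: Y_def itinerary_def[of T "itinerary T d k"])
    qed simp
    then have "ent \<mu> (itinerary T Y n) \<le> ent \<mu> (itinerary T d (n + k))"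
      using ent_comp_le[OF s[OF d, of "n + k"], of "\<lambda>u. map (\<lambda>i. take k (drop i u)) [0..<n]"] by simp
    then show ?thesis
      using 1 conditional_ent_itinerary[OF X Y, of n] ent_itinerary_subadditive[OF d, of n k]
      by (simp add: c_def Y_def)
  qed
  have "rate X \<le> rate d + 0 + c"
  proof (rule tendsto_le[OF sequentially_bot])
    show "(\<lambda>n. ent \<mu> (itinerary T X n) / real n) \<longlonglongrightarrow> rate X" by (rule rate(1)[OF X])
    show "(\<lambda>n. ent \<mu> (itinerary T d n) / real n + ent \<mu> (itinerary T d k) / real n + c) \<longlonglongrightarrow> rate d + 0 + c"
      by (intro tendsto_add rate(1)[OF d] tendsto_const lim_const_over_n)
    show "\<forall>\<^sub>F n in sequentially. ent \<mu> (itinerary T X n) / real n \<le> ent \<mu> (itinerary T d n) / real n + ent \<mu> (itinerary T d k) / real n + c"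
      using eventually_gt_at_top[of 0]
    proof eventually_elim
      case (elim n)
      have "ent \<mu> (itinerary T X n) / real n \<le> (ent \<mu> (itinerary T d n) + ent \<mu> (itinerary T d k) + real n * c) / real n"
        using le by (rule divide_right_mono) simp
      also have "\<dots> = ent \<mu> (itinerary T d n) / real n + ent \<mu> (itinerary T d k) / real n + c"
        using elim by (simp add: add_divide_distrib)
      finally show ?case .
    qed
  qed
  then show ?thesis by (simp add: c_def)
qed

lemma take_itinerary: "k \<le> m \<Longrightarrow> take k (itinerary T d m x) = itinerary T d k x"
  by (simp add: itinerary_def take_map)

text \<open>Since points with the same long itinerary are close, finite itineraries approximate every
  open set from inside, and hence every Borel set in measure.\<close>

lemma approximate_by_itineraries:
  assumes d: "simple_function \<mu> d" "\<And>x y. d x = d y \<Longrightarrow> dist x y < \<delta>"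
    and A: "A \<in> sets borel" and e: "0 < e"
  shows "\<exists>k U. prob ((A - itinerary T d k -` U) \<union> (itinerary T d k -` U - A)) < e"
proof -
  have meas: "itinerary T d k -` U \<in> sets borel" for k U
    using simple_functionD(2)[OF simple_function_itinerary[OF d(1)], of k U] by simp
  have "A \<in> sigma_sets UNIV (Collect open)" using A by (simp add: borel_def)
  then show ?thesis using e
  proof (induction arbitrary: e rule: sigma_sets.induct)
    case (Basic A)
    then have op: "open A" by simp
    define U where "U k = {itinerary T d k x |x. \<forall>y. itinerary T d k y = itinerary T d k x \<longrightarrow> y \<in> A}" for k
    define B where "B k = itinerary T d k -` U k" for k
    have B: "B k = {x. \<forall>y. itinerary T d k y = itinerary T d k x \<longrightarrow> y \<in> A}" for k
      by (auto simp: B_def U_def)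
    have sub: "B k \<subseteq> A" for k by (auto simp: B)
    have "incseq B"
    proof (rule incseq_SucI)
      show "B k \<subseteq> B (Suc k)" for k by (auto simp: B itinerary_Suc)
    qed
    moreover have "(\<Union>k. B k) = A"
    proof
      show "A \<subseteq> (\<Union>k. B k)"
      proof
        fix x assume "x \<in> A"
        then obtain r where r: "0 < r" "ball x r \<subseteq> A" using op open_contains_ball by blast
        have "(\<lambda>k. \<kappa> ^ k * \<delta>) \<longlonglongrightarrow> 0 * \<delta>"
          using \<kappa>_pos \<kappa>_less_1 by (intro tendsto_intros LIMSEQ_power_zero) auto
        then have "\<forall>\<^sub>F k in sequentially. \<kappa> ^ k * \<delta> < r" using r(1) by (intro order_tendstoD(2)) auto
        then obtain k where k: "\<kappa> ^ k * \<delta> < r" by (auto simp: eventually_sequentially)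
        have "y \<in> A" if "itinerary T d (Suc k) y = itinerary T d (Suc k) x" for y
        proof -
          have "dist x y \<le> \<kappa> ^ k * \<delta>" using itinerary_eq_imp_close[OF d(2) _ that[symmetric]] by simp
          then show ?thesis using k r(2) by auto
        qed
        then show "x \<in> (\<Union>k. B k)" by (auto simp: B)
      qed
    qed (use sub in blast)
    ultimately have "(\<lambda>k. prob (B k)) \<longlonglongrightarrow> prob A"
      using finite_Lim_measure_incseq[of B] meas by (auto simp: B_def)
    then have "\<forall>\<^sub>F k in sequentially. prob A - e < prob (B k)" using Basic(2) by (intro order_tendstoD(1)) auto
    then obtain k where k: "prob A - e < prob (B k)" by (auto simp: eventually_sequentially)
    have "prob (A - B k) = prob A - prob (B k)"
      using sub meas op by (intro finite_measure_Diff) (auto simp: B_def)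
    moreover have "(A - B k) \<union> (B k - A) = A - B k" using sub by blast
    ultimately show ?case using k unfolding B_def by (intro exI[of _ k] exI[of _ "U k"]) simp
  next
    case Empty
    then show ?case by (intro exI[of _ 0] exI[of _ "{}"]) simp
  next
    case (Compl A)
    then obtain k U where *: "prob ((A - itinerary T d k -` U) \<union> (itinerary T d k -` U - A)) < e" by blast
    have "((UNIV - A) - itinerary T d k -` (- U)) \<union> (itinerary T d k -` (- U) - (UNIV - A)) =
        (A - itinerary T d k -` U) \<union> (itinerary T d k -` U - A)" by auto
    then show ?case using * by metis
  next
    case (Union A)
    have Am: "A i \<in> sets borel" for i using Union(1) by (simp add: borel_def)
    have "(\<lambda>n. prob (\<Union>i<n. A i)) \<longlonglongrightarrow> prob (\<Union>n. \<Union>i<n. A i)"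
      using Am by (intro finite_Lim_measure_incseq) (force simp: incseq_def)+
    moreover have "(\<Union>n. \<Union>i<n. A i) = (\<Union>i. A i)" by auto
    ultimately have "\<forall>\<^sub>F n in sequentially. prob (\<Union>i. A i) - e / 2 < prob (\<Union>i<n. A i)"
      using Union(3) by (intro order_tendstoD(1)) auto
    then obtain n where n: "prob (\<Union>i. A i) - e / 2 < prob (\<Union>i<n. A i)" by (auto simp: eventually_sequentially)
    have "\<exists>k U. prob ((A i - itinerary T d k -` U) \<union> (itinerary T d k -` U - A i)) < e / (2 * real (Suc n))" for i
      using Union(3) by (intro Union(2)) simp
    then obtain k U where kU: "\<And>i. prob ((A i - itinerary T d (k i) -` U i) \<union> (itinerary T d (k i) -` U i - A i)) < e / (2 * real (Suc n))"
      by metis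
    define m where "m = Max (insert 0 (k ` {..<n}))"
    have m: "k i \<le> m" if "i < n" for i unfolding m_def using that by (intro Max_ge) auto
    define V where "V = (\<Union>i<n. {u. take (k i) u \<in> U i})"
    have V: "itinerary T d m -` V = (\<Union>i<n. itinerary T d (k i) -` U i)"
      using m by (auto simp: V_def take_itinerary)
    define D where "D i = (A i - itinerary T d (k i) -` U i) \<union> (itinerary T d (k i) -` U i - A i)" for i
    have Dm: "D i \<in> sets borel" for i using Am meas by (auto simp: D_def)
    have "((\<Union>i. A i) - itinerary T d m -` V) \<union> (itinerary T d m -` V - (\<Union>i. A i)) \<subseteq>
        ((\<Union>i. A i) - (\<Union>i<n. A i)) \<union> (\<Union>i<n. D i)"
      unfolding V D_def by blast
    then have "prob (((\<Union>i. A i) - itinerary T d m -` V) \<union> (itinerary T d m -` V - (\<Union>i. A i))) \<le>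
        prob (((\<Union>i. A i) - (\<Union>i<n. A i)) \<union> (\<Union>i<n. D i))"
      using Am Dm by (intro finite_measure_mono) auto
    also have "\<dots> \<le> prob ((\<Union>i. A i) - (\<Union>i<n. A i)) + prob (\<Union>i<n. D i)"
      using Am Dm by (intro measure_Un_le) auto
    also have "prob ((\<Union>i. A i) - (\<Union>i<n. A i)) = prob (\<Union>i. A i) - prob (\<Union>i<n. A i)"
      using Am by (intro finite_measure_Diff) auto
    also have "prob (\<Union>i<n. D i) \<le> (\<Sum>i<n. prob (D i))"
      using Dm by (intro finite_measure_subadditive_finite) auto
    also have "(\<Sum>i<n. prob (D i)) \<le> (\<Sum>i<n. e / (2 * real (Suc n)))"
      using kU by (intro sum_mono) (auto simp: D_def less_imp_le)
    also have "(\<Sum>i<n. e / (2 * real (Suc n))) \<le> e / 2"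
      using Union(3) by (simp add: divide_simps)
    finally show ?case using n by (intro exI[of _ m] exI[of _ V]) linarith
  qed
qed

text \<open>The sets \<open>V a\<close> of itineraries approximate the fibres of \<open>X\<close>, so the function \<open>f\<close> guesses the value of \<open>X\<close>
  from the itinerary and is rarely wrong.\<close>

lemma conditional_ent_tends_to_0:
  assumes X: "simple_function \<mu> X" and d: "simple_function \<mu> d" "\<And>x y. d x = d y \<Longrightarrow> dist x y < \<delta>"
    and e: "0 < e"
  shows "\<exists>k. ent \<mu> (\<lambda>x. (X x, itinerary T d k x)) - ent \<mu> (itinerary T d k) \<le> e"
proof -
  define F where "F = range X"
  have F: "finite F" "F \<noteq> {}" using simple_functionD(1)[OF X] by (auto simp: F_def)
  define N where "N = real (card F)"
  have N: "1 \<le> N" using F by (simp add: N_def Suc_le_eq card_gt_0_iff)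
  have "((\<lambda>t. N\<^sup>2 * (2 * sqrt t) + t) \<longlongrightarrow> N\<^sup>2 * (2 * sqrt 0) + 0) (at_right 0)"
    by (intro tendsto_intros)
  then have "\<forall>\<^sub>F t in at_right 0. N\<^sup>2 * (2 * sqrt t) + t < e" using e by (intro order_tendstoD(2)) auto
  then obtain t where t: "0 < t" "N\<^sup>2 * (2 * sqrt t) + t < e"
    unfolding eventually_at_right_field by (metis dense)
  have Xm: "X -` {a} \<in> sets borel" for a using simple_functionD(2)[OF X, of "{a}"] by simp
  have "\<exists>k U. prob ((X -` {a} - itinerary T d k -` U) \<union> (itinerary T d k -` U - X -` {a})) < t / N" for a
    using t(1) N by (intro approximate_by_itineraries[OF d Xm]) auto
  then obtain k U where kU: "\<And>a. prob ((X -` {a} - itinerary T d (k a) -` U a) \<union> (itinerary T d (k a) -` U a - X -` {a})) < t / N"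
    by metis
  define m where "m = Max (k ` F)"
  have m: "k a \<le> m" if "a \<in> F" for a unfolding m_def using that F by (intro Max_ge) auto
  define V where "V a = {u. take (k a) u \<in> U a}" for a
  have V: "itinerary T d m -` V a = itinerary T d (k a) -` U a" if "a \<in> F" for a
    using m[OF that] by (auto simp: V_def take_itinerary)
  define f where "f u = (if \<exists>a\<in>F. u \<in> V a then SOME a. a \<in> F \<and> u \<in> V a else X undefined)" for u
  have f: "f u \<in> F" for u
  proof (cases "\<exists>a\<in>F. u \<in> V a")
    case True
    then have "\<exists>a. a \<in> F \<and> u \<in> V a" by blast
    from someI_ex[OF this] show ?thesis using True by (simp add: f_def)
  qed (simp add: f_def F_def)
  define Y where "Y = itinerary T d m"
  have Y: "simple_function \<mu> Y" unfolding Y_def by (rule simple_function_itinerary[OF d(1)])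
  have fY: "simple_function \<mu> (\<lambda>x. f (Y x))" using Y by (rule simple_function_compose1)
  define D where "D a = (X -` {a} - Y -` V a) \<union> (Y -` V a - X -` {a})" for a
  have Dm: "D a \<in> sets borel" for a
    using Xm simple_functionD(2)[OF Y, of "V a"] by (auto simp: D_def)
  have "{x \<in> space \<mu>. X x \<noteq> f (Y x)} \<subseteq> (\<Union>a\<in>F. D a)"
  proof
    fix x assume x: "x \<in> {x \<in> space \<mu>. X x \<noteq> f (Y x)}"
    show "x \<in> (\<Union>a\<in>F. D a)"
    proof (rule ccontr)
      assume notin: "x \<notin> (\<Union>a\<in>F. D a)"
      have iff: "X x = a \<longleftrightarrow> Y x \<in> V a" if "a \<in> F" for a
      proof -
        have "x \<notin> D a" using notin that by blast
        then show ?thesis unfolding D_def by blast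
      qed
      have "X x \<in> F" by (simp add: F_def)
      then have "Y x \<in> V (X x)" using iff by blast
      then have ex: "\<exists>a\<in>F. Y x \<in> V a" using \<open>X x \<in> F\<close> by blast
      then have "\<exists>a. a \<in> F \<and> Y x \<in> V a" by blast
      from someI_ex[OF this] have "f (Y x) \<in> F \<and> Y x \<in> V (f (Y x))" using ex by (simp add: f_def)
      then have "X x = f (Y x)" using iff by blast
      then show False using x by simp
    qed
  qed
  then have "prob {x \<in> space \<mu>. X x \<noteq> f (Y x)} \<le> prob (\<Union>a\<in>F. D a)"
    using Dm F by (intro finite_measure_mono) auto
  also have "\<dots> \<le> (\<Sum>a\<in>F. prob (D a))" using Dm F by (intro finite_measure_subadditive_finite) auto
  also have "\<dots> \<le> (\<Sum>a\<in>F. t / N)"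
    using kU V by (intro sum_mono less_imp_le) (auto simp: D_def Y_def)
  also have "\<dots> = t" using N by (simp add: N_def)
  finally have "ent \<mu> (\<lambda>x. (X x, f (Y x))) - ent \<mu> (\<lambda>x. f (Y x)) \<le> N\<^sup>2 * (2 * sqrt t) + t"
    unfolding N_def using t(1) f by (intro conditional_ent_small[OF X fY F(1)]) (auto simp: F_def)
  then have "ent \<mu> (\<lambda>x. (X x, Y x)) - ent \<mu> Y \<le> e"
    using conditional_ent_coarsen[OF X Y, of f] t(2) by linarith
  then show ?thesis unfolding Y_def by blast
qed

lemma rate_le_generator:
  assumes X: "simple_function \<mu> X" and d: "simple_function \<mu> d" "\<And>x y. d x = d y \<Longrightarrow> dist x y < \<delta>"
  shows "rate X \<le> rate d"
proof (rule field_le_epsilon)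
  fix e :: real assume "0 < e"
  from conditional_ent_tends_to_0[OF X d this] obtain k where
    "ent \<mu> (\<lambda>x. (X x, itinerary T d k x)) - ent \<mu> (itinerary T d k) \<le> e" by blast
  then show "rate X \<le> rate d + e" using rate_le_conditional[OF X d(1), of k] by linarith
qed

theorem KS_entropy_generator:
  assumes d: "simple_function \<mu> d" "\<And>x y. d x = d y \<Longrightarrow> dist x y < \<delta>"
  shows "KS_entropy T \<mu> = ereal (rate d)"
  unfolding KS_entropy_def
proof (rule antisym)
  show "(SUP P\<in>{P. finite P \<and> P \<subseteq> sets borel \<and> partition_on UNIV P}. ereal (entropy_of_partition T \<mu> P)) \<le> ereal (rate d)"
  proof (rule SUP_least)
    fix P :: "'a set set" assume "P \<in> {P. finite P \<and> P \<subseteq> sets borel \<and> partition_on UNIV P}"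
    then have P: "finite P" "P \<subseteq> sets borel" "partition_on UNIV P" by auto
    obtain X :: "'a \<Rightarrow> 'a set" where X: "simple_function \<mu> X" "P = range (\<lambda>x. X -` {X x})"
      using partition_is_fibres[OF P] by blast
    show "ereal (entropy_of_partition T \<mu> P) \<le> ereal (rate d)"
      unfolding X(2) entropy_of_fibres using rate_le_generator[OF X(1) d] by simp
  qed
  show "ereal (rate d) \<le> (SUP P\<in>{P. finite P \<and> P \<subseteq> sets borel \<and> partition_on UNIV P}. ereal (entropy_of_partition T \<mu> P))"
    by (rule SUP_upper2[OF fibres_is_partition[OF d(1)]]) (simp add: entropy_of_fibres)
qed

lemma rate_nonneg:
  assumes "simple_function \<mu> X"
  shows "0 \<le> rate X"
proof (rule LIMSEQ_le_const[OF rate(1)[OF assms]])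
  have "0 \<le> ent \<mu> (itinerary T X n) / real n" for n
    using ent_nonneg[OF simple_function_itinerary[OF assms]] by simp
  then show "\<exists>N. \<forall>n\<ge>N. 0 \<le> ent \<mu> (itinerary T X n) / real n" by blast
qed

end

section \<open>Weak* compactness\<close>

text \<open>The digits \<open>0\<close> and \<open>2\<close> in base \<open>3\<close> parametrize the Cantor set. Because of its gaps, the first digits
  are determined by an approximate value.\<close>

definition binary_code :: "(nat \<Rightarrow> bool) \<Rightarrow> real" where
  "binary_code b = (\<Sum>i. 2 * of_bool (b i) / 3 ^ Suc i)"

lemma binary_code_summable: "summable (\<lambda>i. 2 * of_bool (b i) / 3 ^ Suc i :: real)"
proof (rule summable_comparison_test')
  show "summable (\<lambda>i. (2 / 3) * (1 / 3) ^ i :: real)" by (intro summable_mult summable_geometric) simp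
  show "norm (2 * of_bool (b i) / 3 ^ Suc i :: real) \<le> (2 / 3) * (1 / 3) ^ i" if "0 \<le> i" for i
    by (simp add: power_divide)
qed

lemma binary_code_range: "0 \<le> binary_code b" "binary_code b \<le> 1"
proof -
  show "0 \<le> binary_code b" unfolding binary_code_def by (intro suminf_nonneg binary_code_summable) simp
  have "binary_code b \<le> (\<Sum>i. (2 / 3) * (1 / 3) ^ i)"
    unfolding binary_code_def
    by (intro suminf_le binary_code_summable summable_mult summable_geometric) (simp_all add: power_divide)
  also have "\<dots> = 1" by (subst suminf_mult) (simp_all add: suminf_geometric)
  finally show "binary_code b \<le> 1" .
qed

lemma binary_code_shift: "3 * binary_code b = 2 * of_bool (b 0) + binary_code (\<lambda>i. b (Suc i))"
proof -
  have "binary_code b = (\<Sum>i. 2 * of_bool (b (Suc i)) / 3 ^ Suc (Suc i)) + 2 * of_bool (b 0) / 3"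
    unfolding binary_code_def using suminf_split_head[OF binary_code_summable[of b]] by simp
  also have "(\<Sum>i. 2 * of_bool (b (Suc i)) / 3 ^ Suc (Suc i) :: real) = (\<Sum>i. (1 / 3) * (2 * of_bool (b (Suc i)) / 3 ^ Suc i))"
    by simp
  also have "\<dots> = (1 / 3) * binary_code (\<lambda>i. b (Suc i))"
    unfolding binary_code_def by (rule suminf_mult[OF binary_code_summable])
  finally show ?thesis by simp
qed

lemma binary_code_close_imp_agree:
  "\<bar>binary_code b - binary_code b'\<bar> < 1 / 3 ^ N \<Longrightarrow> i < N \<Longrightarrow> b i = b' i"
proof (induction N arbitrary: b b' i)
  case (Suc N)
  have "1 / 3 ^ Suc N \<le> (1 / 3 :: real)" by (simp add: divide_simps)
  then have lt: "\<bar>binary_code b - binary_code b'\<bar> < 1 / 3" using Suc.prems(1) by linarith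
  have b0: "b 0 = b' 0"
  proof (rule ccontr)
    assume "b 0 \<noteq> b' 0"
    then show False
      using lt binary_code_shift[of b] binary_code_shift[of b'] binary_code_range[of "\<lambda>i. b (Suc i)"]
        binary_code_range[of "\<lambda>i. b' (Suc i)"]
      by (cases "b 0"; cases "b' 0") (auto simp: abs_less_iff)
  qed
  show ?case
  proof (cases i)
    case (Suc j)
    have "3 * \<bar>binary_code b - binary_code b'\<bar> < 3 * (1 / 3 ^ Suc N)" using Suc.prems(1) by simp
    moreover have "3 * (binary_code b - binary_code b') = binary_code (\<lambda>i. b (Suc i)) - binary_code (\<lambda>i. b' (Suc i))"
      using binary_code_shift[of b] binary_code_shift[of b'] b0 by simp
    moreover have "\<bar>3 * (binary_code b - binary_code b')\<bar> = 3 * \<bar>binary_code b - binary_code b'\<bar>"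
      by (simp only: abs_mult abs_numeral)
    ultimately have "\<bar>binary_code (\<lambda>i. b (Suc i)) - binary_code (\<lambda>i. b' (Suc i))\<bar> < 1 / 3 ^ N" by simp
    then show ?thesis using Suc.IH[of "\<lambda>i. b (Suc i)" "\<lambda>i. b' (Suc i)" j] Suc.prems(2) Suc by simp
  qed (use b0 in simp)
qed simp

lemma separating_open_sets:
  assumes "compact (UNIV :: 'a::metric_space set)"
  shows "\<exists>B :: nat \<Rightarrow> 'a set. (\<forall>i. open (B i)) \<and>
    (\<forall>e>0. \<exists>N. \<forall>x y. (\<forall>i<N. x \<in> B i \<longleftrightarrow> y \<in> B i) \<longrightarrow> dist x y < e)"
proof -
  have "\<exists>F::'a set. finite F \<and> (\<forall>x. \<exists>c\<in>F. dist c x < 1 / real (Suc n))" for n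
    using assms unfolding compact_eq_totally_bounded by (auto simp: subset_eq dest!: spec[of _ "1 / real (Suc n)"])
  then obtain F :: "nat \<Rightarrow> 'a set" where F: "\<And>n. finite (F n)" "\<And>n x. \<exists>c\<in>F n. dist c x < 1 / real (Suc n)"
    by metis
  define Bs where "Bs = (\<Union>n. (\<lambda>c. ball c (1 / real (Suc n))) ` F n)"
  have cnt: "countable Bs" unfolding Bs_def by (intro countable_UN countable_image) (auto intro: countable_finite F)
  have "\<exists>c\<in>F 0. dist c undefined < 1 / real (Suc 0)" by (rule F(2))
  then have ne: "Bs \<noteq> {}" by (auto simp: Bs_def)
  define B where "B = from_nat_into Bs"
  have range: "range B = Bs" unfolding B_def by (rule range_from_nat_into[OF ne cnt])
  have op: "open (B i)" for i
  proof -
    have "B i \<in> Bs" using range by blast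
    then show ?thesis by (auto simp: Bs_def)
  qed
  have "\<exists>N. \<forall>x y. (\<forall>i<N. x \<in> B i \<longleftrightarrow> y \<in> B i) \<longrightarrow> dist x y < e" if e: "0 < e" for e
  proof -
    obtain n where n: "1 / real (Suc n) < e / 2" by (rule nat_approx_posE[of "e / 2"]) (use e in auto)
    have "\<forall>c\<in>F n. \<exists>i. B i = ball c (1 / real (Suc n))"
    proof
      fix c assume "c \<in> F n"
      then have "ball c (1 / real (Suc n)) \<in> range B" unfolding range Bs_def by blast
      then show "\<exists>i. B i = ball c (1 / real (Suc n))" by (metis imageE)
    qed
    then obtain k where k: "\<And>c. c \<in> F n \<Longrightarrow> B (k c) = ball c (1 / real (Suc n))" by metis
    define N where "N = Suc (Max (k ` F n))"
    have "dist x y < e" if agree: "\<forall>i<N. x \<in> B i \<longleftrightarrow> y \<in> B i" for x y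
    proof -
      obtain c where c: "c \<in> F n" "dist c x < 1 / real (Suc n)" using F(2) by blast
      have "k c < N" unfolding N_def less_Suc_eq_le using c F(1) by (intro Max_ge) auto
      then have "y \<in> B (k c)" using agree c k[OF c(1)] by auto
      then have "dist c y < 1 / real (Suc n)" using k[OF c(1)] by simp
      then show ?thesis using dist_triangle3[of x y c] c(2) n by linarith
    qed
    then show ?thesis by blast
  qed
  then show ?thesis using op by blast
qed

lemma compact_metric_code:
  assumes "compact (UNIV :: 'a::metric_space set)"
  shows "\<exists>c :: 'a \<Rightarrow> real. c \<in> borel_measurable borel \<and> (\<forall>x. 0 \<le> c x \<and> c x \<le> 1) \<and>
    (\<forall>e>0. \<exists>d>0. \<forall>x y. \<bar>c x - c y\<bar> < d \<longrightarrow> dist x y < e)"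
proof -
  obtain B :: "nat \<Rightarrow> 'a set" where B: "\<And>i. open (B i)"
    "\<And>e. 0 < e \<Longrightarrow> \<exists>N. \<forall>x y. (\<forall>i<N. x \<in> B i \<longleftrightarrow> y \<in> B i) \<longrightarrow> dist x y < e"
    using separating_open_sets[OF assms] by blast
  define c where "c x = binary_code (\<lambda>i. x \<in> B i)" for x
  have "c \<in> borel_measurable borel"
  proof -
    have "(\<lambda>x. \<Sum>i. 2 * indicator (B i) x / 3 ^ Suc i :: real) \<in> borel_measurable borel"
      using B(1) by (intro borel_measurable_suminf borel_measurable_divide borel_measurable_times
          borel_measurable_const borel_measurable_indicator borel_open)
    moreover have "c = (\<lambda>x. \<Sum>i. 2 * indicator (B i) x / 3 ^ Suc i)"
      by (simp add: c_def binary_code_def fun_eq_iff indicator_def of_bool_def)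
    ultimately show ?thesis by simp
  qed
  moreover have "\<exists>d>0. \<forall>x y. \<bar>c x - c y\<bar> < d \<longrightarrow> dist x y < e" if e: "0 < e" for e
  proof -
    obtain N where N: "\<And>x y. (\<forall>i<N. x \<in> B i \<longleftrightarrow> y \<in> B i) \<Longrightarrow> dist x y < e" using B(2)[OF e] by blast
    have "dist x y < e" if "\<bar>c x - c y\<bar> < 1 / 3 ^ N" for x y
    proof (rule N, intro allI impI)
      fix i assume "i < N"
      then show "x \<in> B i \<longleftrightarrow> y \<in> B i"
        by (rule binary_code_close_imp_agree[OF that[unfolded c_def]])
    qed
    moreover have "0 < 1 / (3 :: real) ^ N" by simp
    ultimately show ?thesis by blast
  qed
  moreover have "\<forall>x. 0 \<le> c x \<and> c x \<le> 1" using binary_code_range by (simp add: c_def)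
  ultimately show ?thesis by blast
qed

text \<open>A point of the closure is a limit of codes \<open>c (s n)\<close>, and by compactness the sequence \<open>s\<close> may be taken
  convergent; its limit is the decoded point.\<close>

lemma code_inverse:
  fixes c :: "'a::metric_space \<Rightarrow> real"
  assumes cpt: "compact (UNIV :: 'a set)"
    and close: "\<And>e. 0 < e \<Longrightarrow> \<exists>d>0. \<forall>x y. \<bar>c x - c y\<bar> < d \<longrightarrow> dist x y < e"
  shows "\<exists>\<pi>. continuous_on (closure (range c)) \<pi> \<and> (\<forall>x. \<pi> (c x) = x)"
proof -
  have "\<exists>x s. s \<longlonglongrightarrow> x \<and> (\<lambda>n. c (s n)) \<longlonglongrightarrow> t" if t: "t \<in> closure (range c)" for t
  proof -
    obtain u where u: "(\<forall>n. u n \<in> range c) \<and> u \<longlonglongrightarrow> t"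
      using iffD1[OF closure_sequential t] by (rule exE)
    then have "\<exists>x. u n = c x" for n by auto
    then obtain s where s: "\<And>n. u n = c (s n)" by metis
    obtain x r where r: "strict_mono r" "(s \<circ> r) \<longlonglongrightarrow> x" using cpt unfolding compact_def by blast
    have "(u \<circ> r) \<longlonglongrightarrow> t" using conjunct2[OF u] r(1) by (rule LIMSEQ_subseq_LIMSEQ)
    then show ?thesis using r(2) s by (intro exI[of _ x] exI[of _ "s \<circ> r"]) (simp add: comp_def)
  qed
  then obtain \<pi> s where \<pi>: "\<And>t. t \<in> closure (range c) \<Longrightarrow> s t \<longlonglongrightarrow> \<pi> t"
    "\<And>t. t \<in> closure (range c) \<Longrightarrow> (\<lambda>n. c (s t n)) \<longlonglongrightarrow> t"
    by metis
  have unif: "dist (\<pi> t) (\<pi> u) \<le> e"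
    if tu: "t \<in> closure (range c)" "u \<in> closure (range c)" "\<bar>t - u\<bar> < d" and d: "\<And>x y. \<bar>c x - c y\<bar> < d \<Longrightarrow> dist x y < e" for t u d e
  proof (rule tendsto_upperbound)
    show "(\<lambda>n. dist (s t n) (s u n)) \<longlonglongrightarrow> dist (\<pi> t) (\<pi> u)" by (intro tendsto_dist \<pi>(1) tu)
    have "(\<lambda>n. \<bar>c (s t n) - c (s u n)\<bar>) \<longlonglongrightarrow> \<bar>t - u\<bar>" by (intro tendsto_intros \<pi>(2) tu)
    then have "\<forall>\<^sub>F n in sequentially. \<bar>c (s t n) - c (s u n)\<bar> < d" using tu(3) by (rule order_tendstoD)
    then show "\<forall>\<^sub>F n in sequentially. dist (s t n) (s u n) \<le> e" by eventually_elim (use d in \<open>auto intro: less_imp_le\<close>)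
  qed simp
  have "continuous_on (closure (range c)) \<pi>"
    unfolding continuous_on_iff
  proof (intro ballI allI impI)
    fix t and e :: real assume t: "t \<in> closure (range c)" and e: "0 < e"
    obtain d where d: "0 < d" "\<And>x y. \<bar>c x - c y\<bar> < d \<Longrightarrow> dist x y < e / 2" using close[of "e / 2"] e by auto
    show "\<exists>d>0. \<forall>u\<in>closure (range c). dist u t < d \<longrightarrow> dist (\<pi> u) (\<pi> t) < e"
    proof (intro exI[of _ d] conjI ballI impI)
      fix u assume "u \<in> closure (range c)" "dist u t < d"
      then have "dist (\<pi> u) (\<pi> t) \<le> e / 2" using t d(2) by (intro unif[of u t d]) (auto simp: dist_real_def)
      then show "dist (\<pi> u) (\<pi> t) < e" using e by linarith
    qed (rule d(1))
  qed
  moreover have "\<pi> (c x) = x" for x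
  proof -
    have cx: "c x \<in> closure (range c)" by (rule subsetD[OF closure_subset rangeI])
    have "s (c x) \<longlonglongrightarrow> x"
    proof (rule tendstoI)
      fix e :: real assume "0 < e"
      then obtain d where d: "0 < d" "\<And>x y. \<bar>c x - c y\<bar> < d \<Longrightarrow> dist x y < e" using close by blast
      have "\<forall>\<^sub>F n in sequentially. dist (c (s (c x) n)) (c x) < d" using \<pi>(2)[OF cx] d(1) by (rule tendstoD)
      then show "\<forall>\<^sub>F n in sequentially. dist (s (c x) n) x < e"
        by eventually_elim (use d(2) in \<open>auto simp: dist_real_def\<close>)
    qed
    then show ?thesis using \<pi>(1)[OF cx] LIMSEQ_unique by blast
  qed
  ultimately show ?thesis by blast
qed

text \<open>A Borel code \<open>c\<close> with uniformly continuous inverse transports the measures to the real line, where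
  Helly's selection theorem applies. As \<open>c\<close> need not be continuous, the limit lives only on the closure \<open>K\<close> of the
  set of codes, from where the extended inverse \<open>\<pi>\<close> carries it back.\<close>

lemma weak_star_sequentially_compact:
  fixes m :: "nat \<Rightarrow> 'a::metric_space measure"
  assumes cpt: "compact (UNIV :: 'a set)"
    and m: "\<And>k. prob_space (m k)" "\<And>k. sets (m k) = sets borel"
  shows "\<exists>r \<mu>. strict_mono (r :: nat \<Rightarrow> nat) \<and> prob_space \<mu> \<and> sets \<mu> = sets borel \<and>
    weak_star_tendsto (\<lambda>k. m (r k)) \<mu> sequentially"
proof -
  obtain c :: "'a \<Rightarrow> real" where c: "c \<in> borel_measurable borel" "\<And>x. 0 \<le> c x" "\<And>x. c x \<le> 1"
    and close: "\<And>e. 0 < e \<Longrightarrow> \<exists>d>0. \<forall>x y. \<bar>c x - c y\<bar> < d \<longrightarrow> dist x y < e"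
    using compact_metric_code[OF cpt] by blast
  define K where "K = closure (range c)"
  obtain \<pi> where \<pi>: "continuous_on K \<pi>" "\<And>x. \<pi> (c x) = x"
    using code_inverse[OF cpt close] unfolding K_def by blast
  have cK: "c x \<in> K" for x unfolding K_def by (rule subsetD[OF closure_subset rangeI])
  have K_closed: "closed K" by (simp add: K_def)
  have cm: "c \<in> measurable (m k) borel" for k
    using c(1) measurable_cong_sets[OF m(2)[of k] refl, of borel] by blast
  define \<nu> where "\<nu> k = distr (m k) borel c" for k
  have \<nu>: "real_distribution (\<nu> k)" for k
    unfolding \<nu>_def by (rule prob_space.real_distribution_distr[OF m(1) cm])
  have "tight \<nu>"
    unfolding tight_def
  proof (intro conjI allI impI)
    fix e :: real assume "0 < e"
    have "measure (\<nu> k) {-1<..1} = 1" for k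
    proof -
      interpret prob_space "m k" by (rule m(1))
      have "- 1 < c x" for x using c(2)[of x] by linarith
      then have "c -` {-1<..1} \<inter> space (m k) = space (m k)" using c(3) by auto
      then show ?thesis unfolding \<nu>_def by (subst measure_distr[OF cm]) (auto simp: prob_space)
    qed
    then show "\<exists>a b. a < b \<and> (\<forall>n. 1 - e < measure (\<nu> n) {a<..b})"
      using \<open>0 < e\<close> by (intro exI[of _ "-1"] exI[of _ 1]) auto
  qed (rule \<nu>)
  from tight_imp_convergent_subsubsequence[OF this strict_mono_id]
  obtain r N where r: "strict_mono (r :: nat \<Rightarrow> nat)" and N: "real_distribution N" "weak_conv_m (\<nu> \<circ> id \<circ> r) N"
    by blast
  interpret N: real_distribution N by (rule N(1))
  have wc: "weak_conv_m (\<lambda>k. \<nu> (r k)) N" using N(2) by (simp only: comp_def id_def)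
  have conv: "(\<lambda>k. \<integral>x. f (c x) \<partial>m (r k)) \<longlonglongrightarrow> (\<integral>t. f t \<partial>N)"
    if f: "continuous_on UNIV f" "\<And>t. norm (f t) \<le> B" for f :: "real \<Rightarrow> real" and B
  proof -
    have "isCont f t" for t using f(1) by (simp add: continuous_on_eq_continuous_at)
    from weak_conv_imp_integral_bdd_continuous_conv[OF \<nu> N(1) wc this f(2)]
    have "(\<lambda>k. integral\<^sup>L (\<nu> (r k)) f) \<longlonglongrightarrow> integral\<^sup>L N f" .
    moreover have "integral\<^sup>L (\<nu> (r k)) f = (\<integral>x. f (c x) \<partial>m (r k))" for k
      unfolding \<nu>_def by (rule integral_distr[OF cm borel_measurable_continuous_onI[OF f(1)]])
    ultimately show ?thesis by simp
  qed
  have AE_K: "AE t in N. t \<in> K"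
  proof -
    define f where "f t = min 1 (infdist t K)" for t
    have f: "continuous_on UNIV f" unfolding f_def by (intro continuous_intros)
    have f01: "0 \<le> f t" "f t \<le> 1" for t by (auto simp: f_def infdist_nonneg)
    have "(\<lambda>k. \<integral>x. f (c x) \<partial>m (r k)) \<longlonglongrightarrow> (\<integral>t. f t \<partial>N)"
      using f01 by (intro conv[OF f, of 1]) auto
    moreover have "f (c x) = 0" for x using cK by (simp add: f_def)
    ultimately have "(\<integral>t. f t \<partial>N) = 0" by (simp add: LIMSEQ_const_iff)
    moreover have "integrable N f"
      using f01 borel_measurable_continuous_onI[OF f] by (intro N.integrable_const_bound[of _ 1]) auto
    ultimately have "AE t in N. f t = 0"
      using integral_nonneg_eq_0_iff_AE[of N f] f01 by auto
    then show ?thesis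
    proof eventually_elim
      case (elim t)
      then have "infdist t K = 0" by (auto simp: f_def min_def split: if_splits)
      then show ?case using in_closed_iff_infdist_zero[OF K_closed] cK by auto
    qed
  qed
  define p where "p t = (if t \<in> K then \<pi> t else undefined)" for t
  have p: "p \<in> borel_measurable borel"
    unfolding p_def using K_closed \<pi>(1) by (intro borel_measurable_continuous_on_if) auto
  then have pN: "p \<in> measurable N borel" using measurable_cong_sets[OF N.events_eq_borel refl] by blast
  define \<mu> where "\<mu> = distr N borel p"
  have "(\<lambda>k. \<integral>x. g x \<partial>m (r k)) \<longlonglongrightarrow> (\<integral>x. g x \<partial>\<mu>)" if g: "continuous_on UNIV g" for g :: "'a \<Rightarrow> real"
  proof -
    have "compact (range g)" using g cpt by (rule compact_continuous_image)
    then obtain B where B: "\<And>x. norm (g x) \<le> B" using compact_imp_bounded[of "range g"] by (auto simp: bounded_iff)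
    have "0 \<le> B" using B[of undefined] norm_ge_zero order_trans by blast
    have "continuous_on K (\<lambda>t. g (\<pi> t))"
      by (rule continuous_on_compose2[OF g \<pi>(1)]) simp
    then obtain h where h: "continuous_on UNIV h" "\<And>t. t \<in> K \<Longrightarrow> h t = g (\<pi> t)" "\<And>t. norm (h t) \<le> B"
      using Tietze[of K "\<lambda>t. g (\<pi> t)" UNIV B] K_closed \<open>0 \<le> B\<close> B by auto
    have "(\<lambda>k. \<integral>x. h (c x) \<partial>m (r k)) \<longlonglongrightarrow> (\<integral>t. h t \<partial>N)" by (rule conv[OF h(1,3)])
    moreover have "h (c x) = g x" for x using h(2)[OF cK] \<pi>(2) by simp
    moreover have "(\<integral>x. g x \<partial>\<mu>) = (\<integral>t. g (p t) \<partial>N)"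
      unfolding \<mu>_def by (rule integral_distr[OF pN borel_measurable_continuous_onI[OF g]])
    moreover have "(\<integral>t. g (p t) \<partial>N) = (\<integral>t. h t \<partial>N)"
    proof (rule integral_cong_AE)
      show "AE t in N. g (p t) = h t" using AE_K by eventually_elim (simp add: p_def h(2))
      show "(\<lambda>t. g (p t)) \<in> borel_measurable N" by (rule borel_measurable_continuous_on[OF g pN])
      show "h \<in> borel_measurable N"
        using borel_measurable_continuous_onI[OF h(1)] measurable_cong_sets[OF N.events_eq_borel refl] by blast
    qed
    ultimately show ?thesis by simp
  qed
  moreover have "prob_space \<mu>" unfolding \<mu>_def by (rule N.prob_space_distr[OF pN])
  ultimately show ?thesis using r by (intro exI[of _ r] exI[of _ \<mu>]) (simp add: weak_star_tendsto_def \<mu>_def)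
qed

lemma infdist_cutoff_tendsto:
  assumes C: "closed C" "C \<noteq> {}"
  shows "(\<lambda>n. max 0 (1 - real n * infdist x C)) \<longlonglongrightarrow> indicator C x"
proof (cases "x \<in> C")
  case True
  then have "infdist x C = 0" by (rule infdist_zero)
  then have "(\<lambda>n. max 0 (1 - real n * infdist x C)) = (\<lambda>n. 1)" by (simp only: mult_zero_right diff_zero) simp
  then show ?thesis using True by (simp only: indicator_simps tendsto_const)
next
  case False
  then have "0 < infdist x C" using C in_closed_iff_infdist_zero[OF C, of x] infdist_nonneg[of x C] by linarith
  then obtain n0 where n0: "1 < real n0 * infdist x C" using reals_Archimedean3 by blast
  have "\<forall>\<^sub>F n in sequentially. max 0 (1 - real n * infdist x C) = indicator C x"
    using eventually_ge_at_top[of n0]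
  proof eventually_elim
    case (elim n)
    have "real n0 * infdist x C \<le> real n * infdist x C" using elim by (intro mult_right_mono infdist_nonneg) auto
    then show ?case using n0 False by simp
  qed
  then show ?thesis by (rule tendsto_eventually)
qed

lemma measure_eq_by_continuous_integrals:
  fixes \<mu> \<nu> :: "'a::metric_space measure"
  assumes \<mu>: "prob_space \<mu>" "sets \<mu> = sets borel" and \<nu>: "prob_space \<nu>" "sets \<nu> = sets borel"
    and eq: "\<And>g :: 'a \<Rightarrow> real. continuous_on UNIV g \<Longrightarrow> (\<integral>x. g x \<partial>\<mu>) = (\<integral>x. g x \<partial>\<nu>)"
  shows "\<mu> = \<nu>"
proof -
  have lim: "(\<lambda>n. \<integral>x. max 0 (1 - real n * infdist x C) \<partial>M) \<longlonglongrightarrow> measure M C"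
    if M: "prob_space M" "sets M = sets borel" and C: "closed C" "C \<noteq> {}" for M :: "'a measure" and C
  proof -
    interpret prob_space M by (rule M(1))
    have meas: "f \<in> borel_measurable M" if "f \<in> borel_measurable borel" for f :: "'a \<Rightarrow> real"
      using that measurable_cong_sets[OF M(2) refl] by blast
    have "(\<lambda>n. \<integral>x. max 0 (1 - real n * infdist x C) \<partial>M) \<longlonglongrightarrow> (\<integral>x. indicator C x \<partial>M)"
    proof (rule integral_dominated_convergence[where w = "\<lambda>x. 1"])
      show "AE x in M. (\<lambda>n. max 0 (1 - real n * infdist x C)) \<longlonglongrightarrow> indicator C x"
        using infdist_cutoff_tendsto[OF C] by simp
      show "AE x in M. norm (max 0 (1 - real n * infdist x C)) \<le> 1" for n
        by (simp add: infdist_nonneg)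
      show "(\<lambda>x. max 0 (1 - real n * infdist x C)) \<in> borel_measurable M" for n
        by (intro meas borel_measurable_continuous_onI continuous_intros)
      show "(\<lambda>x. indicator C x :: real) \<in> borel_measurable M"
        using C(1) by (intro meas borel_measurable_indicator borel_closed)
    qed simp
    moreover have "C \<in> sets M" using C(1) M(2) by simp
    ultimately show ?thesis using sets.sets_into_space[of C M] by (simp add: Int_absorb2)
  qed
  have "measure \<mu> C = measure \<nu> C" if C: "closed C" for C
  proof (cases "C = {}")
    case False
    have "(\<integral>x. max 0 (1 - real n * infdist x C) \<partial>\<mu>) = (\<integral>x. max 0 (1 - real n * infdist x C) \<partial>\<nu>)" for n
      by (intro eq continuous_intros)
    then show ?thesis using lim[OF \<mu> C False] lim[OF \<nu> C False] LIMSEQ_unique by simp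
  qed simp
  then have em: "emeasure \<mu> C = emeasure \<nu> C" if "closed C" for C
    using that prob_space.axioms(1)[OF \<mu>(1)] prob_space.axioms(1)[OF \<nu>(1)]
    by (simp add: finite_measure.emeasure_eq_measure)
  show ?thesis
  proof (rule measure_eqI_generator_eq[where E = "Collect closed" and \<Omega> = UNIV and A = "\<lambda>_. UNIV"])
    show "Int_stable (Collect closed)" by (auto simp: Int_stable_def)
    have "sets (borel :: 'a measure) = sigma_sets UNIV (Collect closed)"
      by (subst borel_eq_closed) simp
    then show "sets \<mu> = sigma_sets UNIV (Collect closed)" "sets \<nu> = sigma_sets UNIV (Collect closed)"
      by (simp_all only: \<mu>(2) \<nu>(2))
    show "emeasure \<mu> UNIV \<noteq> \<infinity>"
      using finite_measure.emeasure_finite[OF prob_space.axioms(1)[OF \<mu>(1)], of UNIV]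
      by (simp only: infinity_ennreal_def not_False_eq_True)
    show "emeasure \<mu> C = emeasure \<nu> C" if "C \<in> Collect closed" for C using em that by simp
    show "(\<Union>i::nat. UNIV) = (UNIV :: 'a set)" by simp
    show "range (\<lambda>_::nat. UNIV) \<subseteq> Collect (closed :: 'a set \<Rightarrow> bool)" by auto
  qed simp
qed

section \<open>Upper semicontinuity of the entropy\<close>

definition borel_prob :: "'a::metric_space measure \<Rightarrow> bool" where
  "borel_prob \<mu> \<longleftrightarrow> prob_space \<mu> \<and> sets \<mu> = sets borel"

lemma invariant_imp_borel_prob: "\<mu> \<in> invariant_measures T \<Longrightarrow> borel_prob \<mu>"
  by (simp add: invariant_measures_def borel_prob_def)

lemma borel_prob_space: "borel_prob \<mu> \<Longrightarrow> space \<mu> = UNIV"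
  unfolding borel_prob_def using sets_eq_imp_space_eq[of \<mu> borel] by simp

lemma borel_prob_measurable:
  "borel_prob \<mu> \<Longrightarrow> f \<in> measurable borel N \<Longrightarrow> f \<in> measurable \<mu> N"
  unfolding borel_prob_def using measurable_cong_sets[of \<mu> borel N N] by blast

lemma borel_prob_integral_indicator:
  assumes "borel_prob \<mu>" "A \<in> sets borel"
  shows "(\<integral>x. indicator A x \<partial>\<mu>) = measure \<mu> A"
  using borel_prob_space[OF assms(1)] by simp

text \<open>The sets whose indicator is Riemann integrable with respect to \<open>\<mu>\<close>; equivalently, the topological
  boundary is a null set. In this form the stability under intersections and preimages is immediate, and
  weak* convergence to \<open>\<mu>\<close> implies convergence of the measures of the set.\<close>

definition jordan_set :: "'a::metric_space measure \<Rightarrow> 'a set \<Rightarrow> bool" where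
  "jordan_set \<mu> A \<longleftrightarrow> A \<in> sets borel \<and>
    (\<forall>e>0. \<exists>f h :: 'a \<Rightarrow> real. continuous_on UNIV f \<and> continuous_on UNIV h \<and>
      (\<forall>x. f x \<le> indicator A x \<and> indicator A x \<le> h x) \<and> (\<integral>x. h x - f x \<partial>\<mu>) < e)"

lemma jordan_setD:
  assumes "jordan_set \<mu> A" "0 < e"
  obtains f h :: "'a::metric_space \<Rightarrow> real" where "continuous_on UNIV f" "continuous_on UNIV h"
    "\<And>x. f x \<le> indicator A x" "\<And>x. indicator A x \<le> h x" "(\<integral>x. h x - f x \<partial>\<mu>) < e"
  using assms unfolding jordan_set_def by blast

lemma jordan_set_empty: "jordan_set \<mu> {}"
  unfolding jordan_set_def by (auto intro!: exI[of _ "\<lambda>_. 0"])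

lemma jordan_set_UNIV: "jordan_set \<mu> UNIV"
  unfolding jordan_set_def by (auto intro!: exI[of _ "\<lambda>_. 1"])

lemma jordan_set_Compl:
  assumes "jordan_set \<mu> A"
  shows "jordan_set \<mu> (- A)"
  unfolding jordan_set_def
proof (intro conjI allI impI)
  show "- A \<in> sets borel" using assms by (auto simp: jordan_set_def)
  fix e :: real assume "0 < e"
  from assms this obtain f h where fh: "continuous_on UNIV f" "continuous_on UNIV h"
    "\<And>x. f x \<le> indicator A x" "\<And>x. indicator A x \<le> h x" "(\<integral>x. h x - f x \<partial>\<mu>) < e"
    by (rule jordan_setD) (rule that)
  have "1 - h x \<le> indicator (- A) x \<and> indicator (- A) x \<le> 1 - f x" for x
    using fh(3)[of x] fh(4)[of x] by (auto simp: indicator_def split: if_splits)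
  moreover have "continuous_on UNIV (\<lambda>x. 1 - h x)" "continuous_on UNIV (\<lambda>x. 1 - f x)"
    using fh(1,2) by (auto intro: continuous_intros)
  moreover have "(\<integral>x. (1 - f x) - (1 - h x) \<partial>\<mu>) < e" using fh(5) by simp
  ultimately show "\<exists>f h :: 'a \<Rightarrow> real. continuous_on UNIV f \<and> continuous_on UNIV h \<and>
      (\<forall>x. f x \<le> indicator (- A) x \<and> indicator (- A) x \<le> h x) \<and> (\<integral>x. h x - f x \<partial>\<mu>) < e"
    by (intro exI[of _ "\<lambda>x. 1 - h x"] exI[of _ "\<lambda>x. 1 - f x"]) blast
qed

lemma x_ln_x_tendsto:
  assumes p: "p \<longlonglongrightarrow> p0" and 0: "\<And>k. 0 \<le> p k"
  shows "(\<lambda>k. p k * ln (p k)) \<longlonglongrightarrow> p0 * ln (p0 :: real)"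
proof (cases "p0 = 0")
  case True
  have "(\<lambda>k. 2 * sqrt (p k)) \<longlonglongrightarrow> 2 * sqrt p0" by (intro tendsto_intros p)
  then have lim: "(\<lambda>k. 2 * sqrt (p k)) \<longlonglongrightarrow> 0" using True by simp
  have "\<forall>\<^sub>F k in sequentially. p k < 1" using p True by (intro order_tendstoD(2)) auto
  then have "\<forall>\<^sub>F k in sequentially. norm (p k * ln (p k)) \<le> 2 * sqrt (p k)"
  proof eventually_elim
    case (elim k)
    have "p k * ln (p k) \<le> 0"
    proof (cases "p k = 0")
      case False
      then have "ln (p k) \<le> 0" using 0[of k] elim by simp
      then show ?thesis using 0[of k] by (simp add: mult_nonneg_nonpos)
    qed simp
    then show ?case using neg_x_ln_x_le[OF 0[of k]] by simp
  qed
  then have "(\<lambda>k. p k * ln (p k)) \<longlonglongrightarrow> 0" using lim by (rule Lim_null_comparison)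
  then show ?thesis using True by simp
next
  case False
  then show ?thesis by (intro tendsto_intros p)
qed

context expanding_system begin

lemma expanding_measureI: "\<mu> \<in> invariant_measures T \<Longrightarrow> expanding_measure T L \<kappa> \<delta> \<mu>"
  by (intro expanding_measure.intro expanding_measure_axioms.intro expanding_system_axioms)

lemma continuous_integrable:
  assumes "borel_prob \<mu>" "continuous_on UNIV (g :: 'a \<Rightarrow> real)"
  shows "integrable \<mu> g"
proof -
  interpret prob_space \<mu> using assms(1) by (simp add: borel_prob_def)
  obtain M where M: "\<And>x. \<bar>g x\<bar> \<le> M" using continuous_bounded[OF assms(2)] by blast
  show ?thesis
    by (rule integrable_const_bound[of _ M])
      (use M borel_prob_measurable[OF assms(1) borel_measurable_continuous_onI[OF assms(2)]] in auto)
qed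

lemma indicator_integrable:
  assumes "borel_prob \<mu>" "A \<in> sets borel"
  shows "integrable \<mu> (indicator A :: 'a \<Rightarrow> real)"
proof -
  interpret prob_space \<mu> using assms(1) by (simp add: borel_prob_def)
  show ?thesis
    by (rule integrable_const_bound[of _ 1])
      (use assms borel_prob_measurable[OF assms(1) borel_measurable_indicator[OF assms(2)]] in auto)
qed

lemma jordan_set_Int:
  assumes \<mu>: "borel_prob \<mu>" and A: "jordan_set \<mu> (A :: 'a set)" and B: "jordan_set \<mu> B"
  shows "jordan_set \<mu> (A \<inter> B)"
  unfolding jordan_set_def
proof (intro conjI allI impI)
  show "A \<inter> B \<in> sets borel" using A B by (auto simp: jordan_set_def)
  fix e :: real assume "0 < e"
  then have e: "0 < e / 2" by simp
  obtain f h where fh: "continuous_on UNIV f" "continuous_on UNIV h"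
    "\<And>x. f x \<le> indicator A x" "\<And>x. indicator A x \<le> h x" "(\<integral>x. h x - f x \<partial>\<mu>) < e / 2"
    using A e by (rule jordan_setD) (rule that)
  obtain f' h' where fh': "continuous_on UNIV f'" "continuous_on UNIV h'"
    "\<And>x. f' x \<le> indicator B x" "\<And>x. indicator B x \<le> h' x" "(\<integral>x. h' x - f' x \<partial>\<mu>) < e / 2"
    using B e by (rule jordan_setD) (rule that)
  have bd: "min (f x) (f' x) \<le> indicator (A \<inter> B) x \<and> indicator (A \<inter> B) x \<le> min (h x) (h' x)" for x
    using fh(3)[of x] fh(4)[of x] fh'(3)[of x] fh'(4)[of x] by (cases "x \<in> A"; cases "x \<in> B") auto
  have c: "continuous_on UNIV (\<lambda>x. min (f x) (f' x))" "continuous_on UNIV (\<lambda>x. min (h x) (h' x))"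
    using fh(1,2) fh'(1,2) by (auto intro: continuous_intros)
  have cd: "continuous_on UNIV (\<lambda>x. h x - f x)" "continuous_on UNIV (\<lambda>x. h' x - f' x)"
    using fh(1,2) fh'(1,2) by (auto intro: continuous_intros)
  have "(\<integral>x. min (h x) (h' x) - min (f x) (f' x) \<partial>\<mu>) \<le> (\<integral>x. (h x - f x) + (h' x - f' x) \<partial>\<mu>)"
  proof (rule integral_mono)
    show "min (h x) (h' x) - min (f x) (f' x) \<le> (h x - f x) + (h' x - f' x)" for x
      using order_trans[OF fh(3)[of x] fh(4)[of x]] order_trans[OF fh'(3)[of x] fh'(4)[of x]] by linarith
  qed (intro continuous_integrable[OF \<mu>] continuous_intros c fh(1,2) fh'(1,2))+
  also have "\<dots> = (\<integral>x. h x - f x \<partial>\<mu>) + (\<integral>x. h' x - f' x \<partial>\<mu>)"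
    by (intro Bochner_Integration.integral_add continuous_integrable[OF \<mu>] cd)
  also have "\<dots> < e" using fh(5) fh'(5) by linarith
  finally show "\<exists>f h :: 'a \<Rightarrow> real. continuous_on UNIV f \<and> continuous_on UNIV h \<and>
      (\<forall>x. f x \<le> indicator (A \<inter> B) x \<and> indicator (A \<inter> B) x \<le> h x) \<and> (\<integral>x. h x - f x \<partial>\<mu>) < e"
    using bd c by (intro exI[of _ "\<lambda>x. min (f x) (f' x)"] exI[of _ "\<lambda>x. min (h x) (h' x)"]) blast
qed

lemma jordan_set_INT:
  assumes \<mu>: "borel_prob \<mu>" and I: "finite I" "\<And>i. i \<in> I \<Longrightarrow> jordan_set \<mu> (A i :: 'a set)"
  shows "jordan_set \<mu> (\<Inter>i\<in>I. A i)"
  using I by (induction I rule: finite_induct) (auto intro: jordan_set_UNIV jordan_set_Int[OF \<mu>])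

lemma integral_T:
  assumes \<mu>: "\<mu> \<in> invariant_measures T" and g: "g \<in> borel_measurable borel"
  shows "(\<integral>x. g (T x) \<partial>\<mu>) = (\<integral>x. g x \<partial>\<mu> :: real)"
proof -
  have T: "T \<in> measurable \<mu> borel"
    by (rule borel_prob_measurable[OF invariant_imp_borel_prob[OF \<mu>] borel_measurable_continuous_onI[OF continuous_T]])
  have "distr \<mu> borel T = \<mu>" using \<mu> by (simp add: invariant_measures_def)
  then show ?thesis using integral_distr[OF T g] by simp
qed

lemma integral_T_iterate:
  assumes \<mu>: "\<mu> \<in> invariant_measures T" and g: "continuous_on UNIV (g :: 'a \<Rightarrow> real)"
  shows "(\<integral>x. g ((T ^^ n) x) \<partial>\<mu>) = (\<integral>x. g x \<partial>\<mu>)"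
proof (induction n)
  case (Suc n)
  have "continuous_on UNIV (\<lambda>x. g ((T ^^ n) x))"
    using g continuous_T_iterate by (rule continuous_on_compose2) simp
  then have "(\<integral>x. g ((T ^^ n) (T x)) \<partial>\<mu>) = (\<integral>x. g ((T ^^ n) x) \<partial>\<mu>)"
    by (intro integral_T[OF \<mu>] borel_measurable_continuous_onI)
  then show ?case using Suc by (simp add: funpow_swap1)
qed simp

lemma jordan_set_vimage:
  assumes \<mu>: "\<mu> \<in> invariant_measures T" and A: "jordan_set \<mu> A"
  shows "jordan_set \<mu> ((T ^^ n) -` A)"
  unfolding jordan_set_def
proof (intro conjI allI impI)
  show "(T ^^ n) -` A \<in> sets borel"
    using A expanding_measure.vimage_T_iterate[OF expanding_measureI[OF \<mu>]] by (simp add: jordan_set_def)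
  fix e :: real assume "0 < e"
  from A this obtain f h where fh: "continuous_on UNIV f" "continuous_on UNIV h"
    "\<And>x. f x \<le> indicator A x" "\<And>x. indicator A x \<le> h x" "(\<integral>x. h x - f x \<partial>\<mu>) < e"
    by (rule jordan_setD) (rule that)
  have c: "continuous_on UNIV (\<lambda>x. f ((T ^^ n) x))" "continuous_on UNIV (\<lambda>x. h ((T ^^ n) x))"
    by (rule continuous_on_compose2[OF fh(1) continuous_T_iterate], simp)
      (rule continuous_on_compose2[OF fh(2) continuous_T_iterate], simp)
  have "continuous_on UNIV (\<lambda>x. h x - f x)" using fh(1,2) by (intro continuous_intros)
  then have "(\<integral>x. h ((T ^^ n) x) - f ((T ^^ n) x) \<partial>\<mu>) < e" using integral_T_iterate[OF \<mu>, of "\<lambda>x. h x - f x" n] fh(5) by simp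
  moreover have "indicator ((T ^^ n) -` A) x = (indicator A ((T ^^ n) x) :: real)" for x by (simp add: indicator_def)
  ultimately show "\<exists>f h :: 'a \<Rightarrow> real. continuous_on UNIV f \<and> continuous_on UNIV h \<and>
      (\<forall>x. f x \<le> indicator ((T ^^ n) -` A) x \<and> indicator ((T ^^ n) -` A) x \<le> h x) \<and> (\<integral>x. h x - f x \<partial>\<mu>) < e"
    using c fh(3,4) by (intro exI[of _ "\<lambda>x. f ((T ^^ n) x)"] exI[of _ "\<lambda>x. h ((T ^^ n) x)"]) simp
qed

text \<open>The measure of a ball is a monotone function of the radius, so it is continuous at all but countably
  many radii.\<close>

lemma jordan_ball:
  assumes \<mu>: "borel_prob \<mu>" and R: "0 < R"
  shows "\<exists>r. R / 2 < r \<and> r < R \<and> jordan_set \<mu> (ball (x :: 'a) r)"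
proof -
  interpret prob_space \<mu> using \<mu> by (simp add: borel_prob_def)
  have sets: "ball x t \<in> sets \<mu>" for t using \<mu> by (simp add: borel_prob_def)
  define \<phi> where "\<phi> t = measure \<mu> (ball x t)" for t
  have mono: "mono \<phi>" unfolding \<phi>_def by (intro monoI finite_measure_mono sets) (auto simp: ball_def)
  obtain r where r: "R / 2 < r" "r < R" "isCont \<phi> r"
  proof -
    have "countable {a. \<not> isCont \<phi> a}" by (rule mono_ctble_discont[OF mono])
    moreover have "uncountable {R / 2<..<R}" using R by (subst uncountable_open_interval) simp
    ultimately have "\<not> {R / 2<..<R} \<subseteq> {a. \<not> isCont \<phi> a}" using countable_subset by blast
    then show ?thesis using that by auto
  qed
  have "jordan_set \<mu> (ball x r)"
    unfolding jordan_set_def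
  proof (intro conjI allI impI)
    fix e :: real assume e: "0 < e"
    obtain s where s: "0 < s" "\<And>t. \<bar>t - r\<bar> < s \<Longrightarrow> \<bar>\<phi> t - \<phi> r\<bar> < e / 2"
      using r(3) half_gt_zero[OF e] unfolding continuous_at_eps_delta dist_real_def by blast
    define t where "t = s / 2"
    have t: "0 < t" "t < s" using s(1) by (auto simp: t_def)
    define f where "f y = min 1 (max 0 ((r - dist x y) / t))" for y
    define h where "h y = min 1 (max 0 ((r + t - dist x y) / t))" for y
    have cont: "continuous_on UNIV f" "continuous_on UNIV h"
      unfolding f_def h_def using t(1) by (auto intro!: continuous_intros)
    have f: "f y \<le> indicator (ball x r) y" "indicator (ball x (r - t)) y \<le> f y" for y
      using t(1) by (auto simp: f_def indicator_def min_def max_def field_simps)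
    have h: "indicator (ball x r) y \<le> h y" "h y \<le> indicator (ball x (r + t)) y" for y
      using t(1) by (auto simp: h_def indicator_def min_def max_def field_simps)
    note int = continuous_integrable[OF \<mu>] indicator_integrable[OF \<mu>]
    have "(\<integral>y. h y \<partial>\<mu>) \<le> (\<integral>y. indicator (ball x (r + t)) y \<partial>\<mu>)"
      by (intro integral_mono int cont h) simp
    moreover have "(\<integral>y. indicator (ball x (r - t)) y \<partial>\<mu>) \<le> (\<integral>y. f y \<partial>\<mu>)"
      by (intro integral_mono int cont f) simp
    moreover have "(\<integral>y. h y - f y \<partial>\<mu>) = (\<integral>y. h y \<partial>\<mu>) - (\<integral>y. f y \<partial>\<mu>)"
      by (intro Bochner_Integration.integral_diff int cont)
    moreover have ind: "(\<integral>y. indicator (ball x a) y \<partial>\<mu>) = \<phi> a" for a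
      unfolding \<phi>_def by (rule borel_prob_integral_indicator[OF \<mu>]) simp
    moreover have "\<bar>\<phi> (r + t) - \<phi> r\<bar> < e / 2" "\<bar>\<phi> (r - t) - \<phi> r\<bar> < e / 2" using t s(2)[of "r + t"] s(2)[of "r - t"] by auto
    ultimately have "(\<integral>y. h y - f y \<partial>\<mu>) < e" using ind[of "r + t"] ind[of "r - t"] by linarith
    then show "\<exists>f h :: 'a \<Rightarrow> real. continuous_on UNIV f \<and> continuous_on UNIV h \<and>
      (\<forall>y. f y \<le> indicator (ball x r) y \<and> indicator (ball x r) y \<le> h y) \<and> (\<integral>y. h y - f y \<partial>\<mu>) < e"
      using cont f(1) h(1) by blast
  qed simp
  then show ?thesis using r by blast
qed

lemma jordan_set_measure_tendsto:
  assumes m: "\<And>k. borel_prob (m k)" and \<mu>: "borel_prob \<mu>"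
    and conv: "weak_star_tendsto m \<mu> sequentially" and A: "jordan_set \<mu> (A :: 'a set)"
  shows "(\<lambda>k. measure (m k) A) \<longlonglongrightarrow> measure \<mu> A"
proof (rule LIMSEQ_I)
  fix e :: real assume "0 < e"
  then have e: "0 < e / 2" by simp
  have Ab: "A \<in> sets borel" using A by (simp add: jordan_set_def)
  obtain f h where fh: "continuous_on UNIV f" "continuous_on UNIV h"
    "\<And>x. f x \<le> indicator A x" "\<And>x. indicator A x \<le> h x" "(\<integral>x. h x - f x \<partial>\<mu>) < e / 2"
    using A e by (rule jordan_setD) (rule that)
  have sq: "(\<integral>x. f x \<partial>M) \<le> measure M A" "measure M A \<le> (\<integral>x. h x \<partial>M)" if M: "borel_prob M" for M
    unfolding borel_prob_integral_indicator[OF M Ab, symmetric]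
    by (intro integral_mono continuous_integrable[OF M] indicator_integrable[OF M] fh Ab; simp)+
  have diff: "(\<integral>x. h x - f x \<partial>\<mu>) = (\<integral>x. h x \<partial>\<mu>) - (\<integral>x. f x \<partial>\<mu>)"
    by (intro Bochner_Integration.integral_diff continuous_integrable[OF \<mu>] fh)
  have "(\<lambda>k. \<integral>x. f x \<partial>m k) \<longlonglongrightarrow> (\<integral>x. f x \<partial>\<mu>)" "(\<lambda>k. \<integral>x. h x \<partial>m k) \<longlonglongrightarrow> (\<integral>x. h x \<partial>\<mu>)"
    using conv fh(1,2) unfolding weak_star_tendsto_def by auto
  then have "\<forall>\<^sub>F k in sequentially. (\<integral>x. f x \<partial>\<mu>) - e / 2 < (\<integral>x. f x \<partial>m k)"
    "\<forall>\<^sub>F k in sequentially. (\<integral>x. h x \<partial>m k) < (\<integral>x. h x \<partial>\<mu>) + e / 2"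
    using e by (auto intro!: order_tendstoD)
  then have "\<forall>\<^sub>F k in sequentially. norm (measure (m k) A - measure \<mu> A) < e"
  proof eventually_elim
    case (elim k)
    have "\<bar>measure (m k) A - measure \<mu> A\<bar> < e"
      using elim sq[OF m[of k]] sq[OF \<mu>] diff fh(5) unfolding abs_less_iff by (intro conjI; linarith)
    then show ?case by simp
  qed
  then show "\<exists>N. \<forall>k\<ge>N. norm (measure (m k) A - measure \<mu> A) < e" by (simp add: eventually_sequentially)
qed

text \<open>Recording all balls that contain a point, rather than the first one, makes the fibres intersections
  of balls and complements of balls.\<close>

definition ball_code :: "'a set \<Rightarrow> ('a \<Rightarrow> real) \<Rightarrow> 'a \<Rightarrow> 'a set" where
  "ball_code F r x = {c \<in> F. x \<in> ball c (r c)}"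

lemma ball_code_fibre:
  "ball_code F r -` {I} = (if I \<subseteq> F then \<Inter>c\<in>F. (if c \<in> I then ball c (r c) else - ball c (r c)) else {})"
proof -
  have "ball_code F r x = I \<longleftrightarrow> I \<subseteq> F \<and> (\<forall>c\<in>F. c \<in> I \<longleftrightarrow> x \<in> ball c (r c))" for x
    unfolding ball_code_def set_eq_iff subset_eq by (simp only: mem_Collect_eq) blast
  moreover have "x \<in> (\<Inter>c\<in>F. if c \<in> I then ball c (r c) else - ball c (r c)) \<longleftrightarrow>
      (\<forall>c\<in>F. c \<in> I \<longleftrightarrow> x \<in> ball c (r c))" for x
    unfolding INT_iff by (intro ball_cong refl) (simp split: if_split)
  ultimately show ?thesis
    by (cases "I \<subseteq> F"; intro set_eqI) (simp_all only: vimage_singleton_eq if_True if_False simp_thms empty_iff)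
qed

lemma ball_code_simple:
  assumes \<mu>: "borel_prob \<mu>" and F: "finite F"
  shows "simple_function \<mu> (ball_code F r)"
  unfolding simple_function_def
proof
  have "range (ball_code F r) \<subseteq> Pow F" by (auto simp: ball_code_def)
  moreover have "finite (Pow F)" using F by simp
  ultimately have "finite (range (ball_code F r))" by (rule finite_subset)
  then show "finite (ball_code F r ` space \<mu>)" by (simp only: borel_prob_space[OF \<mu>])
  have "(\<Inter>c\<in>F. (if c \<in> I then ball c (r c) else - ball c (r c))) \<in> sets borel" for I
  proof (cases "F = {}")
    case False
    show ?thesis by (rule sets.finite_INT[OF F False]) (simp split: if_split)
  qed (simp only: INT_empty sets.top[of borel, unfolded space_borel])
  note meas = this
  have fib: "ball_code F r -` {I} \<in> sets borel" for I
  proof (cases "I \<subseteq> F")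
    case True
    show ?thesis unfolding ball_code_fibre if_P[OF True] by (rule meas)
  next
    case False
    show ?thesis unfolding ball_code_fibre if_not_P[OF False] by (rule sets.empty_sets)
  qed
  have "sets \<mu> = sets borel" using \<mu> by (simp add: borel_prob_def)
  then show "\<forall>I\<in>ball_code F r ` space \<mu>. ball_code F r -` {I} \<inter> space \<mu> \<in> sets \<mu>"
    by (simp only: borel_prob_space[OF \<mu>] Int_UNIV_right fib) simp
qed

lemma ball_code_expansive:
  assumes "\<And>x. \<exists>c\<in>F. dist c x < r c" "\<And>c. c \<in> F \<Longrightarrow> r c \<le> \<delta> / 2" and eq: "ball_code F r x = ball_code F r y"
  shows "dist x y < \<delta>"
proof -
  obtain c where c: "c \<in> F" "dist c x < r c" using assms(1)[of x] by (rule bexE)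
  then have "c \<in> ball_code F r x" by (simp add: ball_code_def)
  then have "c \<in> ball_code F r y" by (simp only: eq)
  then have "dist c y < r c" by (simp add: ball_code_def)
  then show ?thesis using dist_triangle3[of x y c] c assms(2)[OF c(1)] by linarith
qed

lemma jordan_set_itinerary:
  assumes \<mu>: "\<mu> \<in> invariant_measures T" and F: "finite F" and j: "\<And>c. c \<in> F \<Longrightarrow> jordan_set \<mu> (ball c (r c))"
  shows "jordan_set \<mu> (itinerary T (ball_code F r) n -` {u})"
proof (cases "length u = n")
  case True
  note bp = invariant_imp_borel_prob[OF \<mu>]
  have fib: "jordan_set \<mu> (ball_code F r -` {I})" for I
  proof (cases "I \<subseteq> F")
    case True
    have "jordan_set \<mu> (\<Inter>c\<in>F. if c \<in> I then ball c (r c) else - ball c (r c))"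
      by (rule jordan_set_INT[OF bp F]) (simp add: j jordan_set_Compl)
    then show ?thesis using True by (simp only: ball_code_fibre if_True)
  qed (simp add: ball_code_fibre jordan_set_empty)
  have "itinerary T (ball_code F r) n -` {u} = (\<Inter>i\<in>{..<n}. (T ^^ i) -` (ball_code F r -` {u ! i}))"
  proof -
    have "itinerary T d n x = u \<longleftrightarrow> (\<forall>i<n. d ((T ^^ i) x) = u ! i)" for d and x :: 'a
      using True by (auto simp: itinerary_def list_eq_iff_nth_eq)
    then show ?thesis 
      by (intro set_eqI) (simp only: vimage_eq singleton_iff INT_iff lessThan_iff Ball_def)
  qed
  also have "jordan_set \<mu> \<dots>" by (intro jordan_set_INT[OF bp] jordan_set_vimage[OF \<mu>] fib) simp
  finally show ?thesis .
next
  case False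
  then have "itinerary T (ball_code F r) n -` {u} = {}" by auto
  then show ?thesis by (simp add: jordan_set_empty)
qed

lemma KS_entropy_bounded: "\<exists>H. \<forall>\<mu>\<in>invariant_measures T. \<exists>k. KS_entropy T \<mu> = ereal k \<and> 0 \<le> k \<and> k \<le> H"
proof -
  obtain F :: "'a set" where F: "finite F" "\<And>x. \<exists>c\<in>F. dist c x < \<delta> / 2"
    using finite_cover[of "\<delta> / 2"] \<delta>_pos by auto
  define d where "d = ball_code F (\<lambda>_. \<delta> / 2)"
  have d: "dist x y < \<delta>" if "d x = d y" for x y
    using ball_code_expansive[of F "\<lambda>_. \<delta> / 2" x y] F(2) that by (simp add: d_def)
  define H where "H = ln (real (card (range (itinerary T d 1))))"
  have "\<exists>k. KS_entropy T \<mu> = ereal k \<and> 0 \<le> k \<and> k \<le> H" if \<mu>: "\<mu> \<in> invariant_measures T" for \<mu>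
  proof -
    interpret expanding_measure T L \<kappa> \<delta> \<mu> by (rule expanding_measureI[OF \<mu>])
    have s: "simple_function \<mu> d" unfolding d_def by (rule ball_code_simple[OF invariant_imp_borel_prob[OF \<mu>] F(1)])
    have "rate d \<le> ent \<mu> (itinerary T d 1)" using rate(2)[OF s, of 1] by simp
    also have "\<dots> \<le> H"
      using ent_le_card[OF simple_function_itinerary[OF s, of 1]] by (simp add: H_def)
    finally show ?thesis using KS_entropy_generator[OF s d] rate_nonneg[OF s] by blast
  qed
  then show ?thesis by blast
qed

text \<open>The entropies \<open>ent (m k) (itinerary T d n)\<close> bound \<open>n * a k\<close> and converge as \<open>k\<close> grows, because the
  radii of the balls are chosen so that the fibres are Jordan sets for the limit measure.\<close>

lemma KS_entropy_upper_semicontinuous: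
  assumes m: "\<And>k. m k \<in> invariant_measures T" and \<mu>: "\<mu> \<in> invariant_measures T"
    and conv: "weak_star_tendsto m \<mu> sequentially"
    and a: "a \<longlonglongrightarrow> a0" "\<And>k. ereal (a k) \<le> KS_entropy T (m k)"
  shows "ereal a0 \<le> KS_entropy T \<mu>"
proof -
  note bp = invariant_imp_borel_prob
  have "\<exists>r. \<delta> / 4 < r \<and> r < \<delta> / 2 \<and> jordan_set \<mu> (ball c r)" for c
    using jordan_ball[OF bp[OF \<mu>], of "\<delta> / 2" c] \<delta>_pos by simp
  then obtain r where r: "\<And>c. \<delta> / 4 < r c" "\<And>c. r c < \<delta> / 2" "\<And>c. jordan_set \<mu> (ball c (r c))" by metis
  obtain F :: "'a set" where F: "finite F" "\<And>x. \<exists>c\<in>F. dist c x < \<delta> / 4"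
    using finite_cover[of "\<delta> / 4"] \<delta>_pos by auto
  define d where "d = ball_code F r"
  have cov: "\<exists>c\<in>F. dist c x < r c" for x using F(2)[of x] r(1) by (meson less_trans)
  have d: "dist x y < \<delta>" if "d x = d y" for x y
    using ball_code_expansive[of F r x y] cov r(2) that by (simp add: d_def less_imp_le)
  have s: "simple_function \<nu> d" if "\<nu> \<in> invariant_measures T" for \<nu>
    unfolding d_def by (rule ball_code_simple[OF bp[OF that] F(1)])
  interpret \<mu>: expanding_measure T L \<kappa> \<delta> \<mu> by (rule expanding_measureI[OF \<mu>])
  have le: "real n * a0 \<le> ent \<mu> (itinerary T d n)" for n
  proof (rule LIMSEQ_le)
    show "(\<lambda>k. real n * a k) \<longlonglongrightarrow> real n * a0" by (intro tendsto_intros a(1))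
    have "(\<lambda>k. measure (m k) (itinerary T d n -` {u})) \<longlonglongrightarrow> measure \<mu> (itinerary T d n -` {u})" for u
      by (rule jordan_set_measure_tendsto[OF bp[OF m] bp[OF \<mu>] conv])
        (unfold d_def, rule jordan_set_itinerary[OF \<mu> F(1) r(3)])
    then have "(\<lambda>k. - (\<Sum>u\<in>range (itinerary T d n). measure (m k) (itinerary T d n -` {u}) * ln (measure (m k) (itinerary T d n -` {u}))))
      \<longlonglongrightarrow> - (\<Sum>u\<in>range (itinerary T d n). measure \<mu> (itinerary T d n -` {u}) * ln (measure \<mu> (itinerary T d n -` {u})))"
      by (intro tendsto_minus tendsto_sum x_ln_x_tendsto) auto
    then show "(\<lambda>k. ent (m k) (itinerary T d n)) \<longlonglongrightarrow> ent \<mu> (itinerary T d n)"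
      by (simp add: ent_def borel_prob_space[OF bp[OF m]])
    show "\<exists>N. \<forall>k\<ge>N. real n * a k \<le> ent (m k) (itinerary T d n)"
    proof (intro exI[of _ 0] allI impI)
      fix k
      interpret mk: expanding_measure T L \<kappa> \<delta> "m k" by (rule expanding_measureI[OF m])
      have "a k \<le> mk.rate d" using a(2)[of k] mk.KS_entropy_generator[OF s[OF m] d] by simp
      then have "real n * a k \<le> real n * mk.rate d" by (rule mult_left_mono) simp
      also have "\<dots> \<le> ent (m k) (itinerary T d n)" by (rule mk.rate(2)[OF s[OF m]])
      finally show "real n * a k \<le> ent (m k) (itinerary T d n)" .
    qed
  qed
  have "a0 \<le> \<mu>.rate d"
  proof (rule LIMSEQ_le_const[OF \<mu>.rate(1)[OF s[OF \<mu>]]])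
    show "\<exists>N. \<forall>n\<ge>N. a0 \<le> ent \<mu> (itinerary T d n) / real n"
      using le by (intro exI[of _ 1]) (auto simp: le_divide_eq mult.commute)
  qed
  then show ?thesis using \<mu>.KS_entropy_generator[OF s[OF \<mu>] d] by simp
qed

lemma invariant_limit:
  assumes m: "\<And>k. m k \<in> invariant_measures T" and \<mu>: "borel_prob \<mu>"
    and conv: "weak_star_tendsto m \<mu> sequentially"
  shows "\<mu> \<in> invariant_measures T"
proof -
  have T: "T \<in> measurable \<mu> borel"
    by (rule borel_prob_measurable[OF \<mu> borel_measurable_continuous_onI[OF continuous_T]])
  have "distr \<mu> borel T = \<mu>"
  proof (rule measure_eq_by_continuous_integrals)
    show "prob_space (distr \<mu> borel T)" using \<mu> T by (auto simp: borel_prob_def intro: prob_space.prob_space_distr)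
    fix g :: "'a \<Rightarrow> real" assume g: "continuous_on UNIV g"
    have gT: "continuous_on UNIV (\<lambda>x. g (T x))" using g continuous_T by (rule continuous_on_compose2) simp
    have gm: "g \<in> borel_measurable borel" by (rule borel_measurable_continuous_onI[OF g])
    have "(\<lambda>k. \<integral>x. g (T x) \<partial>m k) \<longlonglongrightarrow> (\<integral>x. g (T x) \<partial>\<mu>)" "(\<lambda>k. \<integral>x. g x \<partial>m k) \<longlonglongrightarrow> (\<integral>x. g x \<partial>\<mu>)"
      using conv g gT by (auto simp: weak_star_tendsto_def)
    then have "(\<integral>x. g (T x) \<partial>\<mu>) = (\<integral>x. g x \<partial>\<mu>)"
      unfolding integral_T[OF m gm] by (rule LIMSEQ_unique)
    then show "(\<integral>x. g x \<partial>distr \<mu> borel T) = (\<integral>x. g x \<partial>\<mu>)" by (simp add: integral_distr[OF T gm])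
  qed (use \<mu> in \<open>simp_all add: borel_prob_def\<close>)
  then show ?thesis using \<mu> by (simp add: invariant_measures_def borel_prob_def)
qed

theorem equilibrium_state_exists:
  assumes \<phi>: "continuous_on UNIV (\<phi> :: 'a \<Rightarrow> real)" and ne: "invariant_measures T \<noteq> {}"
  shows "\<exists>\<mu>. equilibrium_state T \<phi> \<mu>"
proof -
  obtain H where H: "\<And>\<mu>. \<mu> \<in> invariant_measures T \<Longrightarrow> \<exists>k. KS_entropy T \<mu> = ereal k \<and> 0 \<le> k \<and> k \<le> H"
    using KS_entropy_bounded by blast
  then obtain k where k: "\<And>\<mu>. \<mu> \<in> invariant_measures T \<Longrightarrow> KS_entropy T \<mu> = ereal (k \<mu>)"
    "\<And>\<mu>. \<mu> \<in> invariant_measures T \<Longrightarrow> k \<mu> \<le> H" by metis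
  obtain M where M: "\<And>x. \<bar>\<phi> x\<bar> \<le> M" using continuous_bounded[OF \<phi>] by blast
  define E where "E \<mu> = k \<mu> + (\<integral>x. \<phi> x \<partial>\<mu>)" for \<mu>
  have free: "free_energy T \<phi> \<mu> = ereal (E \<mu>)" if "\<mu> \<in> invariant_measures T" for \<mu>
    using k(1)[OF that] by (simp add: free_energy_def E_def)
  define S where "S = (SUP \<mu>\<in>invariant_measures T. E \<mu>)"
  have bdd: "bdd_above (E ` invariant_measures T)"
  proof (rule bdd_aboveI[of _ "H + M"])
    fix t assume "t \<in> E ` invariant_measures T"
    then obtain \<mu> where \<mu>: "\<mu> \<in> invariant_measures T" "t = E \<mu>" by blast
    interpret expanding_measure T L \<kappa> \<delta> \<mu> by (rule expanding_measureI[OF \<mu>(1)])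
    have "(\<integral>x. \<phi> x \<partial>\<mu>) \<le> (\<integral>x. M \<partial>\<mu>)"
      using M by (intro integral_mono continuous_integrable[OF invariant_imp_borel_prob[OF \<mu>(1)] \<phi>]) (auto intro: order_trans[OF abs_ge_self])
    moreover have "prob UNIV = 1" using prob_space by simp
    ultimately show "t \<le> H + M" using k(2)[OF \<mu>(1)] \<mu>(2) by (simp add: E_def)
  qed
  have "\<exists>\<mu>\<in>invariant_measures T. S - 1 / real (Suc j) < E \<mu>" for j
  proof -
    have "S - 1 / real (Suc j) < (SUP \<mu>\<in>invariant_measures T. E \<mu>)" by (simp add: S_def)
    then show ?thesis using less_cSUP_iff[OF ne bdd] by blast
  qed
  then obtain m where m: "\<And>j. m j \<in> invariant_measures T" "\<And>j. S - 1 / real (Suc j) < E (m j)" by metis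
  obtain r \<mu> where r: "strict_mono r" and \<mu>: "prob_space \<mu>" "sets \<mu> = sets borel"
    and conv: "weak_star_tendsto (\<lambda>j. m (r j)) \<mu> sequentially"
    using weak_star_sequentially_compact[OF compact_space, of m] m(1) by (auto simp: invariant_measures_def)
  have inv: "\<mu> \<in> invariant_measures T"
    using \<mu> by (intro invariant_limit[OF m(1) _ conv]) (simp add: borel_prob_def)
  have lim\<phi>: "(\<lambda>j. \<integral>x. \<phi> x \<partial>m (r j)) \<longlonglongrightarrow> (\<integral>x. \<phi> x \<partial>\<mu>)" using conv \<phi> by (simp add: weak_star_tendsto_def)
  have "(\<lambda>j. 1 / real (Suc (r j))) \<longlonglongrightarrow> 0"
    using LIMSEQ_subseq_LIMSEQ[OF LIMSEQ_inverse_real_of_nat r] by (simp add: comp_def inverse_eq_divide)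
  then have "(\<lambda>j. S - 1 / real (Suc (r j)) - (\<integral>x. \<phi> x \<partial>m (r j))) \<longlonglongrightarrow> S - 0 - (\<integral>x. \<phi> x \<partial>\<mu>)"
    by (intro tendsto_diff tendsto_const lim\<phi>)
  moreover have "ereal (S - 1 / real (Suc (r j)) - (\<integral>x. \<phi> x \<partial>m (r j))) \<le> KS_entropy T (m (r j))" for j
    using m(2)[of "r j"] k(1)[OF m(1)] by (simp add: E_def)
  ultimately have "ereal (S - 0 - (\<integral>x. \<phi> x \<partial>\<mu>)) \<le> KS_entropy T \<mu>"
    by (rule KS_entropy_upper_semicontinuous[OF m(1) inv conv])
  then have "S \<le> E \<mu>" using k(1)[OF inv] by (simp add: E_def)
  moreover have "E \<nu> \<le> S" if "\<nu> \<in> invariant_measures T" for \<nu>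
    unfolding S_def by (rule cSUP_upper[OF that bdd])
  ultimately have "free_energy T \<phi> \<nu> \<le> free_energy T \<phi> \<mu>" if "\<nu> \<in> invariant_measures T" for \<nu>
    using free[OF that] free[OF inv] that by (auto intro: order_trans)
  then show ?thesis using inv by (auto simp: equilibrium_state_def)
qed

end

section \<open>Zero temperature limits of functions with a periodic maximizing orbit\<close>

lemma lip_norm_le:
  assumes "\<And>x. \<bar>f x\<bar> \<le> a" "b-lipschitz_on UNIV f"
  shows "lip_norm f \<le> a + b"
  unfolding lip_norm_def
proof (rule add_mono)
  show "(SUP x. \<bar>f x\<bar>) \<le> a" using assms(1) by (intro cSUP_least) auto
  have "\<bar>f x - f y\<bar> / dist x y \<le> b" for x y
  proof (cases "x = y")
    case False
    then show ?thesis using lipschitz_onD[OF assms(2), of x y] by (simp add: dist_real_def divide_le_eq)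
  qed (use lipschitz_on_nonneg[OF assms(2)] in simp)
  then show "(SUP (x, y). \<bar>f x - f y\<bar> / dist x y) \<le> b" by (intro cSUP_least) auto
qed

lemma lip_norm_bounds:
  assumes cpt: "compact (UNIV :: 'a::metric_space set)" and f: "f \<in> Lip"
  shows "\<bar>f (x :: 'a)\<bar> \<le> lip_norm f" "(lip_norm f)-lipschitz_on UNIV f"
proof -
  have s: "\<bar>f x\<bar> \<le> (SUP x. \<bar>f x\<bar>)" for x by (rule cSUP_upper[OF UNIV_I Lip_bdd(1)[OF cpt f]])
  have q: "\<bar>f x - f y\<bar> / dist x y \<le> (SUP (x, y). \<bar>f x - f y\<bar> / dist x y)" for x y
    using cSUP_upper[OF UNIV_I Lip_bdd(2)[OF cpt f], of "(x, y)"] by simp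
  have s0: "0 \<le> (SUP x. \<bar>f x\<bar>)" using s[of undefined] by linarith
  have q0: "0 \<le> (SUP (x, y). \<bar>f x - f y\<bar> / dist x y)" using q[of undefined undefined] by simp
  show "\<bar>f x\<bar> \<le> lip_norm f" using s[of x] q0 by (simp add: lip_norm_def)
  show "(lip_norm f)-lipschitz_on UNIV f"
  proof (rule lipschitz_onI)
    show "0 \<le> lip_norm f" using s0 q0 by (simp add: lip_norm_def)
    fix x y :: 'a
    show "dist (f x) (f y) \<le> lip_norm f * dist x y"
    proof (cases "x = y")
      case False
      then have "\<bar>f x - f y\<bar> \<le> (SUP (x, y). \<bar>f x - f y\<bar> / dist x y) * dist x y"
        using q[of x y] by (simp add: divide_le_eq)
      also have "\<dots> \<le> lip_norm f * dist x y" using s0 by (intro mult_right_mono) (auto simp: lip_norm_def)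
      finally show ?thesis by (simp add: dist_real_def)
    qed simp
  qed
qed

context expanding_system begin

definition orbit :: "'a \<Rightarrow> nat \<Rightarrow> 'a set" where
  "orbit y p = (\<lambda>i. (T ^^ i) y) ` {..<p}"

text \<open>Integrating the bound against an invariant measure \<open>\<mu>\<close> gives \<open>\<integral>F d\<mu> + s \<integral>dist(\<cdot>, Q) d\<mu> \<le> A\<close>, where \<open>A\<close> is the
  mean of \<open>F\<close> over the orbit \<open>Q\<close> of \<open>y\<close>. Hence the measure on \<open>Q\<close> is the only maximizing one, with
  a quantitative gap.\<close>

definition uniquely_maximized :: "('a \<Rightarrow> real) \<Rightarrow> 'a \<Rightarrow> nat \<Rightarrow> real \<Rightarrow> real \<Rightarrow> bool" where
  "uniquely_maximized F y p s B \<longleftrightarrow> 1 \<le> p \<and> (T ^^ p) y = y \<and> 0 < s \<and>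
    (\<forall>n x. orbit_sum T (\<lambda>x. F x + s * infdist x (orbit y p)) n x
      - real n * (orbit_sum T F p y / real p) \<le> B)"

lemma orbit_nonempty: "1 \<le> p \<Longrightarrow> orbit y p \<noteq> {}"
  by (auto simp: orbit_def lessThan_empty_iff)

lemma orbit_closed: "closed (orbit y p)"
  by (simp add: orbit_def finite_imp_closed)

lemma orbit_sum_infdist_0: "orbit_sum T (\<lambda>x. infdist x (orbit y p)) p y = 0"
proof -
  have "infdist ((T ^^ i) y) (orbit y p) = 0" if "i < p" for i
    using that by (intro infdist_zero) (auto simp: orbit_def)
  then show ?thesis by (simp add: orbit_sum_def)
qed

lemma continuous_orbit_sum:
  assumes g: "continuous_on UNIV g"
  shows "continuous_on UNIV (orbit_sum T g n)"
proof -
  have "continuous_on UNIV (\<lambda>x. g ((T ^^ i) x))" for i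
    by (rule continuous_on_compose2[OF g continuous_T_iterate]) simp
  then have "continuous_on UNIV (\<lambda>x. \<Sum>i<n. g ((T ^^ i) x))" by (intro continuous_on_sum)
  then show ?thesis by (simp add: orbit_sum_def[abs_def])
qed

lemma integral_orbit_sum:
  assumes \<mu>: "\<mu> \<in> invariant_measures T" and g: "continuous_on UNIV (g :: 'a \<Rightarrow> real)"
  shows "(\<integral>x. orbit_sum T g n x \<partial>\<mu>) = real n * (\<integral>x. g x \<partial>\<mu>)"
proof -
  have c: "continuous_on UNIV (\<lambda>x. g ((T ^^ i) x))" for i
    by (rule continuous_on_compose2[OF g continuous_T_iterate]) simp
  have "(\<integral>x. orbit_sum T g n x \<partial>\<mu>) = (\<Sum>i<n. \<integral>x. g ((T ^^ i) x) \<partial>\<mu>)"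
    unfolding orbit_sum_def
    by (rule Bochner_Integration.integral_sum) (rule continuous_integrable[OF invariant_imp_borel_prob[OF \<mu>] c])
  then show ?thesis by (simp add: integral_T_iterate[OF \<mu> g])
qed

lemma integral_le_of_orbit_sum_bound:
  assumes \<mu>: "\<mu> \<in> invariant_measures T" and g: "continuous_on UNIV (g :: 'a \<Rightarrow> real)"
    and B: "\<And>n x. orbit_sum T g n x - real n * A \<le> B"
  shows "(\<integral>x. g x \<partial>\<mu>) \<le> A"
proof (rule ccontr)
  assume "\<not> ?thesis"
  then have "0 < (\<integral>x. g x \<partial>\<mu>) - A" by simp
  from reals_Archimedean3[OF this] obtain n where n: "B < real n * ((\<integral>x. g x \<partial>\<mu>) - A)" by blast
  interpret prob_space \<mu> using \<mu> by (simp add: invariant_measures_def)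
  have one: "prob UNIV = 1" using prob_space borel_prob_space[OF invariant_imp_borel_prob[OF \<mu>]] by simp
  have "real n * (\<integral>x. g x \<partial>\<mu>) = (\<integral>x. orbit_sum T g n x \<partial>\<mu>)" by (rule integral_orbit_sum[OF \<mu> g, symmetric])
  also have "\<dots> \<le> (\<integral>x. B + real n * A \<partial>\<mu>)"
  proof (rule integral_mono)
    show "integrable \<mu> (orbit_sum T g n)"
      by (rule continuous_integrable[OF invariant_imp_borel_prob[OF \<mu>] continuous_orbit_sum[OF g]])
    show "orbit_sum T g n x \<le> B + real n * A" for x using B[of n x] by linarith
  qed simp
  also have "\<dots> = B + real n * A" using one borel_prob_space[OF invariant_imp_borel_prob[OF \<mu>]] by simp
  finally show False using n by (simp add: algebra_simps)
qed

lemma periodic_measure: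
  assumes p: "1 \<le> p" "(T ^^ p) y = y"
  shows "\<exists>\<mu>\<in>invariant_measures T. measure \<mu> (orbit y p) = 1 \<and>
    (\<forall>g :: 'a \<Rightarrow> real. continuous_on UNIV g \<longrightarrow> (\<integral>x. g x \<partial>\<mu>) = orbit_sum T g p y / real p)"
proof -
  define N where "N = measure_pmf (pmf_of_set {..<p})"
  have ne: "{..<p} \<noteq> {}" using p(1) by (auto simp: lessThan_empty_iff)
  interpret N: prob_space N unfolding N_def by (rule measure_pmf.prob_space_axioms)
  have meas: "(\<lambda>i. (T ^^ i) y) \<in> measurable N borel" by (simp add: N_def)
  define \<mu> where "\<mu> = distr N borel (\<lambda>i. (T ^^ i) y)"
  have int: "(\<integral>x. g x \<partial>\<mu>) = orbit_sum T g p y / real p" if g: "g \<in> borel_measurable borel" for g :: "'a \<Rightarrow> real"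
  proof -
    have "(\<integral>x. g x \<partial>\<mu>) = (\<integral>i. g ((T ^^ i) y) \<partial>N)" unfolding \<mu>_def by (rule integral_distr[OF meas g])
    also have "\<dots> = (\<Sum>i<p. g ((T ^^ i) y)) / real (card {..<p})"
      unfolding N_def using ne by (subst integral_pmf_of_set) auto
    finally show ?thesis by (simp add: orbit_sum_def)
  qed
  have prob: "prob_space \<mu>" unfolding \<mu>_def by (rule N.prob_space_distr[OF meas])
  have sets: "sets \<mu> = sets borel" by (simp add: \<mu>_def)
  have Tm: "T \<in> measurable \<mu> borel"
    by (rule borel_prob_measurable[OF _ borel_measurable_continuous_onI[OF continuous_T]])
      (simp add: borel_prob_def prob sets)
  have "distr \<mu> borel T = \<mu>"
  proof (rule measure_eq_by_continuous_integrals[OF prob_space.prob_space_distr[OF prob Tm] _ prob sets])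
    fix g :: "'a \<Rightarrow> real" assume g: "continuous_on UNIV g"
    have gT: "continuous_on UNIV (\<lambda>x. g (T x))" using g continuous_T by (rule continuous_on_compose2) simp
    have gm: "g \<in> borel_measurable borel" by (rule borel_measurable_continuous_onI[OF g])
    have "(\<integral>x. g x \<partial>distr \<mu> borel T) = (\<integral>x. g (T x) \<partial>\<mu>)" by (rule integral_distr[OF Tm gm])
    also have "\<dots> = orbit_sum T (\<lambda>x. g (T x)) p y / real p" by (rule int[OF borel_measurable_continuous_onI[OF gT]])
    also have "orbit_sum T (\<lambda>x. g (T x)) p y = orbit_sum T g p (T y)" by (simp add: orbit_sum_def funpow_swap1)
    also have "\<dots> = orbit_sum T g p y" using orbit_sum_shift_period[OF p(2), of g 1] by simp
    finally show "(\<integral>x. g x \<partial>distr \<mu> borel T) = (\<integral>x. g x \<partial>\<mu>)" using int[OF gm] by simp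
  qed simp
  then have inv: "\<mu> \<in> invariant_measures T" using prob sets by (simp add: invariant_measures_def)
  have "orbit y p \<in> sets borel" using orbit_closed by (rule borel_closed)
  then have "measure \<mu> (orbit y p) = (\<integral>x. indicator (orbit y p) x \<partial>\<mu>)"
    by (rule borel_prob_integral_indicator[OF invariant_imp_borel_prob[OF inv], symmetric])
  also have "\<dots> = orbit_sum T (indicator (orbit y p)) p y / real p"
    by (rule int[OF borel_measurable_indicator[OF borel_closed[OF orbit_closed]]])
  also have "orbit_sum T (indicator (orbit y p)) p y = (\<Sum>i<p. 1)"
    unfolding orbit_sum_def by (intro sum.cong refl indicator_eq_1_iff[THEN iffD2]) (auto simp: orbit_def)
  finally have "measure \<mu> (orbit y p) = 1" using p(1) by simp
  then show ?thesis using inv int borel_measurable_continuous_onI by blast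
qed

text \<open>With this a small mean distance to a periodic orbit forces the integrals of all continuous functions to
  be close to their values for the measure on the orbit.\<close>

lemma continuous_le_infdist:
  assumes \<phi>: "continuous_on UNIV (\<phi> :: 'a \<Rightarrow> real)" and Q: "closed Q" "Q \<noteq> {}" "\<And>x. x \<in> Q \<Longrightarrow> \<phi> x = 0" and e: "0 < e"
  shows "\<exists>C\<ge>0. \<forall>x. \<phi> x \<le> e + C * infdist x Q"
proof -
  obtain M where M: "0 \<le> M" "\<And>x. \<bar>\<phi> x\<bar> \<le> M" using continuous_bounded[OF \<phi>] by blast
  define K where "K = {x. e \<le> \<phi> x}"
  have "closed K" unfolding K_def using closed_Collect_le[OF continuous_on_const \<phi>] by simp
  then have cK: "compact K" using compact_space compact_Int_closed[of UNIV K] by simp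
  obtain d where d: "0 < d" "\<And>x. x \<in> K \<Longrightarrow> d \<le> infdist x Q"
  proof (cases "K = {}")
    case False
    have "continuous_on K (\<lambda>x. infdist x Q)" by (intro continuous_intros)
    then obtain x where x: "x \<in> K" "\<And>z. z \<in> K \<Longrightarrow> infdist x Q \<le> infdist z Q"
      using continuous_attains_inf[OF cK False] by blast
    have "x \<notin> Q" using x(1) Q(3)[of x] e by (auto simp: K_def)
    then have "0 < infdist x Q" using in_closed_iff_infdist_zero[OF Q(1,2), of x] infdist_nonneg[of x Q] by linarith
    then show ?thesis using that x(2) by blast
  next
    case True
    then show ?thesis using that[of 1] by simp
  qed
  have "\<phi> x \<le> e + M / d * infdist x Q" for x
  proof (cases "x \<in> K")
    case True
    have "\<phi> x \<le> M / d * d" using M(2)[of x] d(1) by simp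
    also have "\<dots> \<le> M / d * infdist x Q" using d(2)[OF True] M(1) d(1) by (intro mult_left_mono) auto
    finally show ?thesis using e by simp
  next
    case False
    then have "\<phi> x \<le> e" by (simp add: K_def)
    moreover have "0 \<le> M / d * infdist x Q" using M(1) d(1) infdist_nonneg by (intro mult_nonneg_nonneg) auto
    ultimately show ?thesis by linarith
  qed
  moreover have "0 \<le> M / d" using M(1) d(1) by simp
  ultimately show ?thesis by blast
qed

text \<open>Comparing an equilibrium state with the measure \<open>\<mu>\<close> on the orbit bounds its mean distance to the orbit
  by \<open>H / (\<beta> s)\<close>, where \<open>H\<close> bounds all entropies. For an invariant measure the integral of \<open>g\<close> equals that of
  its average over \<open>p\<close> steps, which is constant on the orbit, so it is close to the integral with
  respect to \<open>\<mu>\<close>.\<close>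

theorem zero_temperature_limit_periodic:
  assumes F: "continuous_on UNIV F" and um: "uniquely_maximized F y p s B"
  shows "\<exists>\<mu>. zero_temperature_limit T F \<mu> \<and> measure \<mu> (orbit y p) = 1"
proof -
  have p: "1 \<le> p" "(T ^^ p) y = y" and s: "0 < s"
    and bound: "\<And>n x. orbit_sum T (\<lambda>x. F x + s * infdist x (orbit y p)) n x - real n * (orbit_sum T F p y / real p) \<le> B"
    using um by (auto simp: uniquely_maximized_def)
  define D where "D = (\<lambda>x. infdist x (orbit y p))"
  define A where "A = orbit_sum T F p y / real p"
  have Dc: "continuous_on UNIV D" unfolding D_def by (intro continuous_intros)
  obtain \<mu> where \<mu>: "\<mu> \<in> invariant_measures T" "measure \<mu> (orbit y p) = 1"
    "\<And>g :: 'a \<Rightarrow> real. continuous_on UNIV g \<Longrightarrow> (\<integral>x. g x \<partial>\<mu>) = orbit_sum T g p y / real p"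
    using periodic_measure[OF p] by blast
  obtain H where H: "\<And>\<nu>. \<nu> \<in> invariant_measures T \<Longrightarrow> \<exists>k. KS_entropy T \<nu> = ereal k \<and> 0 \<le> k \<and> k \<le> H"
    using KS_entropy_bounded by blast
  note integr = continuous_integrable[OF invariant_imp_borel_prob]
  have upper: "(\<integral>x. F x \<partial>\<nu>) + s * (\<integral>x. D x \<partial>\<nu>) \<le> A" if \<nu>: "\<nu> \<in> invariant_measures T" for \<nu>
  proof -
    have "(\<integral>x. F x + s * D x \<partial>\<nu>) \<le> A"
      unfolding A_def D_def using F by (intro integral_le_of_orbit_sum_bound[OF \<nu> _ bound] continuous_intros)
    moreover have "(\<integral>x. F x + s * D x \<partial>\<nu>) = (\<integral>x. F x \<partial>\<nu>) + (\<integral>x. s * D x \<partial>\<nu>)"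
      by (intro Bochner_Integration.integral_add integr[OF \<nu>] continuous_intros F Dc)
    ultimately show ?thesis by simp
  qed
  have D_small: "s * (\<integral>x. D x \<partial>\<nu>) \<le> H / \<beta>" if \<beta>: "0 < \<beta>" and eq: "equilibrium_state T (\<lambda>x. \<beta> * F x) \<nu>" for \<beta> \<nu>
  proof -
    have \<nu>: "\<nu> \<in> invariant_measures T" using eq by (simp add: equilibrium_state_def)
    obtain k where k: "KS_entropy T \<nu> = ereal k" "k \<le> H" using H[OF \<nu>] by blast
    obtain k0 where k0: "KS_entropy T \<mu> = ereal k0" "0 \<le> k0" using H[OF \<mu>(1)] by blast
    have "free_energy T (\<lambda>x. \<beta> * F x) \<mu> \<le> free_energy T (\<lambda>x. \<beta> * F x) \<nu>" using eq \<mu>(1) by (simp add: equilibrium_state_def)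
    then have "k0 + \<beta> * (\<integral>x. F x \<partial>\<mu>) \<le> k + \<beta> * (\<integral>x. F x \<partial>\<nu>)" using k(1) k0(1) by (simp add: free_energy_def)
    then have "\<beta> * A \<le> H + \<beta> * (\<integral>x. F x \<partial>\<nu>)" using k0(2) k(2) \<mu>(3)[OF F] by (simp add: A_def)
    also have "\<dots> \<le> H + \<beta> * (A - s * (\<integral>x. D x \<partial>\<nu>))" using upper[OF \<nu>] \<beta> by (intro add_left_mono mult_left_mono) auto
    finally have "\<beta> * (s * (\<integral>x. D x \<partial>\<nu>)) \<le> H" by (simp add: algebra_simps)
    then show ?thesis using \<beta> by (simp add: le_divide_eq mult.commute)
  qed
  have "zero_temperature_limit T F \<mu>"
    unfolding zero_temperature_limit_def
  proof (intro conjI allI impI)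
    show "\<mu> \<in> invariant_measures T" by (rule \<mu>(1))
    show "\<exists>\<nu>. equilibrium_state T (\<lambda>x. \<beta> * F x) \<nu>" if "0 < \<beta>" for \<beta> :: real
      using \<mu>(1) by (intro equilibrium_state_exists continuous_intros F) auto
    fix m :: "real \<Rightarrow> 'a measure" assume m: "\<forall>\<beta>>0. equilibrium_state T (\<lambda>x. \<beta> * F x) (m \<beta>)"
    show "weak_star_tendsto m \<mu> at_top"
      unfolding weak_star_tendsto_def
    proof (intro allI impI tendstoI)
      fix g :: "'a \<Rightarrow> real" and e :: real assume g: "continuous_on UNIV g" and "0 < e"
      then have e: "0 < e / 2" by simp
      define a where "a = orbit_sum T g p y / real p"
      define \<phi> where "\<phi> = (\<lambda>x. \<bar>orbit_sum T g p x / real p - a\<bar>)"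
      have dc: "continuous_on UNIV (\<lambda>x. orbit_sum T g p x / real p - a)"
        using p(1) by (intro continuous_intros continuous_orbit_sum[OF g]) auto
      then have \<phi>c: "continuous_on UNIV \<phi>" unfolding \<phi>_def by (rule continuous_on_rabs)
      have \<phi>Q: "\<phi> x = 0" if "x \<in> orbit y p" for x
        using that orbit_sum_shift_period[OF p(2), of g] by (auto simp: orbit_def \<phi>_def a_def)
      obtain C where C: "0 \<le> C" "\<And>x. \<phi> x \<le> e / 2 + C * D x"
        using continuous_le_infdist[OF \<phi>c orbit_closed orbit_nonempty[OF p(1)] \<phi>Q e] by (auto simp: D_def)
      have est: "\<bar>(\<integral>x. g x \<partial>m \<beta>) - (\<integral>x. g x \<partial>\<mu>)\<bar> \<le> e / 2 + C * (H / \<beta> / s)" if \<beta>: "0 < \<beta>" for \<beta>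
      proof -
        have eq: "equilibrium_state T (\<lambda>x. \<beta> * F x) (m \<beta>)" using m \<beta> by blast
        then have inv: "m \<beta> \<in> invariant_measures T" by (simp add: equilibrium_state_def)
        interpret prob_space "m \<beta>" using inv by (simp add: invariant_measures_def)
        have one: "prob UNIV = 1" using prob_space borel_prob_space[OF invariant_imp_borel_prob[OF inv]] by simp
        have "(\<integral>x. orbit_sum T g p x / real p - a \<partial>m \<beta>) = (\<integral>x. orbit_sum T g p x / real p \<partial>m \<beta>) - (\<integral>x. a \<partial>m \<beta>)"
          using p(1) by (intro Bochner_Integration.integral_diff integr[OF inv] continuous_intros continuous_orbit_sum[OF g]) auto
        also have "(\<integral>x. orbit_sum T g p x / real p \<partial>m \<beta>) = (\<integral>x. g x \<partial>m \<beta>)"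
          using p(1) integral_orbit_sum[OF inv g, of p] by simp
        also have "(\<integral>x. a \<partial>m \<beta>) = a" using one borel_prob_space[OF invariant_imp_borel_prob[OF inv]] by simp
        finally have "\<bar>(\<integral>x. g x \<partial>m \<beta>) - a\<bar> = \<bar>\<integral>x. orbit_sum T g p x / real p - a \<partial>m \<beta>\<bar>" by simp
        also have "\<dots> \<le> (\<integral>x. \<phi> x \<partial>m \<beta>)" unfolding \<phi>_def by (rule integral_abs_bound)
        also have "\<dots> \<le> (\<integral>x. e / 2 + C * D x \<partial>m \<beta>)"
          by (intro integral_mono integr[OF inv] \<phi>c C continuous_intros Dc)
        also have "\<dots> = (\<integral>x. e / 2 \<partial>m \<beta>) + (\<integral>x. C * D x \<partial>m \<beta>)"
          by (intro Bochner_Integration.integral_add integr[OF inv] continuous_intros Dc)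
        also have "\<dots> = e / 2 + C * (\<integral>x. D x \<partial>m \<beta>)"
          using one borel_prob_space[OF invariant_imp_borel_prob[OF inv]] by simp
        also have "\<dots> \<le> e / 2 + C * (H / \<beta> / s)"
        proof -
          have "(\<integral>x. D x \<partial>m \<beta>) * s \<le> H / \<beta>" using D_small[OF \<beta> eq] by (simp only: mult.commute)
          then have "(\<integral>x. D x \<partial>m \<beta>) \<le> H / \<beta> / s" by (simp only: pos_le_divide_eq[OF s])
          then show ?thesis using C(1) by (intro add_left_mono mult_left_mono)
        qed
        finally show ?thesis using \<mu>(3)[OF g] by (simp add: a_def)
      qed
      have lim: "((\<lambda>\<beta>. e / 2 + C * (H / \<beta> / s)) \<longlongrightarrow> e / 2 + C * (0 / s)) at_top"
        by (intro tendsto_intros tendsto_divide_0[OF tendsto_const] filterlim_at_top_imp_at_infinity filterlim_ident) (use s in auto)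
      have "e / 2 + C * (0 / s) < e" using \<open>0 < e\<close> by simp
      from order_tendstoD(2)[OF lim this] have "\<forall>\<^sub>F \<beta> in at_top. e / 2 + C * (H / \<beta> / s) < e" .
      then show "\<forall>\<^sub>F \<beta> in at_top. dist (\<integral>x. g x \<partial>m \<beta>) (\<integral>x. g x \<partial>\<mu>) < e"
        using eventually_gt_at_top[of 0]
      proof eventually_elim
        case (elim \<beta>)
        then show ?case using est[of \<beta>] by (simp add: dist_real_def)
      qed
    qed
  qed
  then show ?thesis using \<mu>(2) by blast
qed

section \<open>Density\<close>

text \<open>The perturbation is \<open>- \<epsilon> dist(\<cdot>, Q)\<close> for the orbit \<open>Q\<close> from \<open>locking\<close>. The difference \<open>F' - G\<close> uses up only
  half of the freedom \<open>\<eta>\<close> in \<open>locking\<close>; the other half is spent on the extra term \<open>s dist(\<cdot>, Q)\<close>.\<close>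

lemma perturb_to_uniquely_maximized:
  assumes F: "F \<in> Lip" and e: "0 < e"
  shows "\<exists>G\<in>Lip. lip_dist F G < e \<and>
    (\<exists>\<eta>>0. \<forall>F'\<in>Lip. lip_dist G F' < \<eta> \<longrightarrow> (\<exists>y p s B. uniquely_maximized F' y p s B))"
proof -
  obtain K where K: "K-lipschitz_on UNIV F" using F by (auto simp: Lip_def)
  obtain d where d: "0 < d" "\<And>x y :: 'a. dist x y \<le> d" using bounded_dist by blast
  obtain \<beta> u K' g K'' where mane: "K'-lipschitz_on UNIV u" "g = (\<lambda>x. F x - \<beta> + u x - u (T x))"
    "K''-lipschitz_on UNIV g" "\<And>x. g x \<le> 0" and z: "\<exists>z. \<forall>n. g ((T ^^ n) z) = 0"
    using mane[OF K] by blast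
  obtain z where z: "\<And>n. g ((T ^^ n) z) = 0" using z by blast
  obtain M where M: "\<And>x. \<bar>u x\<bar> \<le> M" using lipschitz_bounded[OF mane(1)] by blast
  define \<epsilon> where "\<epsilon> = e / 2 / (d + 1)"
  have half: "a / 2 / c * c = a / 2" if "0 < c" for a c :: real using that by simp
  have \<epsilon>: "0 < \<epsilon>" "\<epsilon> * (d + 1) < e"
    unfolding \<epsilon>_def using e d(1) by (simp, subst half) auto
  obtain y p \<eta> where p: "1 \<le> p" "(T ^^ p) y = y" and \<eta>: "0 < \<eta>"
    and lock: "\<And>h. \<eta>-lipschitz_on UNIV h \<Longrightarrow> (\<And>x. \<bar>h x\<bar> \<le> \<eta>) \<Longrightarrow>
      \<exists>B. \<forall>n x. orbit_sum T (\<lambda>x. g x - \<epsilon> * infdist x (orbit y p) + h x) n x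
        - real n * (orbit_sum T (\<lambda>x. g x + h x) p y / real p) \<le> B"
    using locking[OF mane(3,4) z \<epsilon>(1)] unfolding orbit_def[symmetric] by blast
  define D where "D = (\<lambda>x. infdist x (orbit y p))"
  have D_lip: "1-lipschitz_on UNIV D"
    by (rule lipschitz_onI) (auto simp: D_def dist_real_def infdist_triangle_abs)
  have D_bd: "\<bar>D x\<bar> \<le> d" for x
  proof -
    obtain q where "q \<in> orbit y p" using orbit_nonempty[OF p(1)] by blast
    then have "infdist x (orbit y p) \<le> d" using d(2) by (rule infdist_le2)
    then show ?thesis by (simp add: D_def infdist_nonneg)
  qed
  have cD_lip: "c-lipschitz_on UNIV (\<lambda>x. c * D x)" if "0 \<le> c" for c
    using lipschitz_on_cmult_real[OF D_lip, of c] that by simp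
  have cD_bd: "\<bar>c * D x\<bar> \<le> c * d" if "0 \<le> c" for c x
    using that D_bd[of x] by (simp add: abs_mult mult_left_mono)
  have D_orbit: "orbit_sum T D p y = 0" unfolding D_def by (rule orbit_sum_infdist_0)
  define G where "G = (\<lambda>x. F x - \<epsilon> * D x)"
  have G: "G \<in> Lip"
    using lipschitz_on_diff[OF K cD_lip[of \<epsilon>]] \<epsilon>(1) by (auto simp: Lip_def G_def)
  have "lip_dist F G < e"
  proof -
    have "lip_dist F G = lip_norm (\<lambda>x. \<epsilon> * D x)" using F G by (simp add: lip_dist_def G_def)
    also have "\<dots> \<le> \<epsilon> * d + \<epsilon>" using \<epsilon>(1) by (intro lip_norm_le cD_bd cD_lip) auto
    also have "\<dots> < e" using \<epsilon>(2) by (simp add: algebra_simps)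
    finally show ?thesis .
  qed
  moreover have "\<exists>y p s B. uniquely_maximized F' y p s B" if F': "F' \<in> Lip" "lip_dist G F' < \<eta> / 2" for F'
  proof -
    define h0 where "h0 = (\<lambda>x. F' x - G x)"
    define s where "s = \<eta> / 2 / (d + 1)"
    have s: "0 < s" "s * (d + 1) = \<eta> / 2"
      unfolding s_def using \<eta> d(1) by (simp, intro half) simp
    have s1: "s \<le> \<eta> / 2" "s * d \<le> \<eta> / 2" using s d(1) by (auto simp: algebra_simps)
    have h0: "h0 \<in> Lip" unfolding h0_def by (rule Lip_diff[OF F'(1) G])
    have "lip_dist F' G < \<eta> / 2"
      using F'(2) Metric_space.commute[OF Metric_space_Lip[OF compact_space], of G F'] by simp
    then have n: "lip_norm h0 \<le> \<eta> / 2" using F'(1) G by (simp add: lip_dist_def h0_def)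
    define h where "h = (\<lambda>x. h0 x + s * D x)"
    have "(\<eta> / 2 + s)-lipschitz_on UNIV h"
      unfolding h_def using s(1)
      by (intro lipschitz_on_add cD_lip lipschitz_on_le[OF lip_norm_bounds(2)[OF compact_space h0] n]) auto
    then have h_lip: "\<eta>-lipschitz_on UNIV h" by (rule lipschitz_on_le) (use s1 in auto)
    have h_bd: "\<bar>h x\<bar> \<le> \<eta>" for x
    proof -
      have "\<bar>h x\<bar> \<le> \<bar>h0 x\<bar> + \<bar>s * D x\<bar>" unfolding h_def by (rule abs_triangle_ineq)
      also have "\<dots> \<le> \<eta> / 2 + \<eta> / 2"
        using lip_norm_bounds(1)[OF compact_space h0, of x] n cD_bd[of s x] s(1) s1(2) by (intro add_mono) auto
      finally show ?thesis by simp
    qed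
    obtain B where B: "\<And>n x. orbit_sum T (\<lambda>x. g x - \<epsilon> * D x + h x) n x
        - real n * (orbit_sum T (\<lambda>x. g x + h x) p y / real p) \<le> B"
      using lock[OF h_lip h_bd] unfolding D_def by blast
    define F'' where "F'' = (\<lambda>x. F' x + s * D x)"
    have eq: "(\<lambda>x. g x - \<epsilon> * D x + h x) = (\<lambda>x. F'' x - \<beta> + u x - u (T x))"
      by (simp add: mane(2) h_def h0_def G_def F''_def fun_eq_iff)
    have lin: "orbit_sum T (\<lambda>x. a x + c * D x) p y = orbit_sum T a p y" for a c
      using D_orbit by (simp add: orbit_sum_def sum.distrib sum_distrib_left[symmetric])
    have "orbit_sum T (\<lambda>x. g x + h x) p y = orbit_sum T (\<lambda>x. g x - \<epsilon> * D x + h x) p y"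
      using lin[of "\<lambda>x. g x + h x" "- \<epsilon>"] by (simp add: algebra_simps)
    also have "\<dots> = orbit_sum T F'' p y - real p * \<beta>" unfolding eq orbit_sum_coboundary using p(2) by simp
    also have "orbit_sum T F'' p y = orbit_sum T F' p y" unfolding F''_def by (rule lin)
    finally have avg: "orbit_sum T (\<lambda>x. g x + h x) p y / real p = orbit_sum T F' p y / real p - \<beta>"
      using p(1) by (simp add: diff_divide_distrib)
    have "orbit_sum T F'' n x - real n * (orbit_sum T F' p y / real p) \<le> B + 2 * M" for n x
      using B[of n x] M[of x] M[of "(T ^^ n) x"] unfolding eq orbit_sum_coboundary avg
      by (simp add: algebra_simps abs_le_iff)
    then have "uniquely_maximized F' y p s (B + 2 * M)"
      using p s(1) by (simp add: uniquely_maximized_def F''_def D_def)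
    then show ?thesis by blast
  qed
  moreover have "0 < \<eta> / 2" using \<eta> by simp
  ultimately show ?thesis using G by blast
qed

end

theorem corollary2:
  fixes T :: "'a::metric_space \<Rightarrow> 'a"
  assumes "compact (UNIV :: 'a set)"
    and "expanding T"
  shows "\<exists>\<O> :: ('a \<Rightarrow> real) set.
    openin lip_topology \<O> \<and>
    lip_topology closure_of \<O> = Lip \<and>
    (\<forall>F\<in>\<O>. \<exists>\<mu> Q. zero_temperature_limit T F \<mu> \<and> periodic_orbit T Q \<and> measure \<mu> Q = 1)"
proof -
  obtain L \<kappa> \<delta> where "expanding_system T L \<kappa> \<delta>"
    using expanding_imp_expanding_system[OF assms] by blast
  then interpret expanding_system T L \<kappa> \<delta> .
  interpret Lip: Metric_space "Lip :: ('a \<Rightarrow> real) set" lip_dist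
    by (rule Metric_space_Lip[OF assms(1)])
  define U where "U = {F. \<exists>y p s B. uniquely_maximized F y p s B}"
  define \<O> where "\<O> = Lip.mtopology interior_of (U \<inter> Lip)"
  have op: "openin Lip.mtopology \<O>" unfolding \<O>_def by (rule openin_interior_of)
  have sub: "\<O> \<subseteq> U \<inter> Lip" unfolding \<O>_def by (rule interior_of_subset)
  have "Lip.mtopology closure_of \<O> = Lip"
  proof
    show "Lip.mtopology closure_of \<O> \<subseteq> Lip" using closure_of_subset_topspace[of Lip.mtopology \<O>] by simp
    show "Lip \<subseteq> Lip.mtopology closure_of \<O>"
    proof
      fix F :: "'a \<Rightarrow> real" assume F: "F \<in> Lip"
      have "\<exists>G\<in>\<O>. G \<in> Lip.mball F e" if e: "0 < e" for e
      proof -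
        obtain G \<eta> where G: "G \<in> Lip" "lip_dist F G < e" "0 < \<eta>"
          and near: "\<And>F'. F' \<in> Lip \<Longrightarrow> lip_dist G F' < \<eta> \<Longrightarrow> \<exists>y p s B. uniquely_maximized F' y p s B"
          using perturb_to_uniquely_maximized[OF F e] by blast
        have "Lip.mball G \<eta> \<subseteq> U \<inter> Lip" using near by (auto simp: U_def)
        then have "Lip.mball G \<eta> \<subseteq> \<O>" unfolding \<O>_def by (intro interior_of_maximal Lip.openin_mball)
        moreover have "G \<in> Lip.mball G \<eta>" using G by simp
        moreover have "G \<in> Lip.mball F e" using F G by simp
        ultimately show ?thesis by blast
      qed
      then show "F \<in> Lip.mtopology closure_of \<O>" using F unfolding Lip.metric_closure_of by blast
    qed
  qed
  moreover have "\<exists>\<mu> Q. zero_temperature_limit T F \<mu> \<and> periodic_orbit T Q \<and> measure \<mu> Q = 1" if FO: "F \<in> \<O>" for F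
  proof -
    obtain y p s B where um: "uniquely_maximized F y p s B" using FO sub by (auto simp: U_def)
    obtain K where "K-lipschitz_on UNIV F" using FO sub by (auto simp: Lip_def)
    then have "continuous_on UNIV F" by (rule lipschitz_on_continuous_on)
    then obtain \<mu> where "zero_temperature_limit T F \<mu>" "measure \<mu> (orbit y p) = 1"
      using zero_temperature_limit_periodic[OF _ um] by blast
    moreover have "periodic_orbit T (orbit y p)"
      using um by (auto simp: periodic_orbit_def orbit_def uniquely_maximized_def)
    ultimately show ?thesis by blast
  qed
  ultimately show ?thesis using op by blast
qed

end
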